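(* Suppose the common distribution of the nonnegative i.i.d. random variables $\omega_j$ satisfies $0<\mathbb{P}(\omega=0)<1$. For a positive integer $L$ and a realization of $\omega$, let $L_{\max}=L_{\max}(L,\omega)$ denote the longest length of an interval in $[0,L]$ on which $V_\omega(x)=0$. Let $k>0$ be the coupling constant, which is allowed to depend on $L$. Suppose there are constants $C,\alpha>0$ such that, for almost every $\omega$, $$k\,L_{\max}^{1-\alpha}>C\quad\text{for all sufficiently large } L .$$ Then, with probability one, $$\lim_{L\to\infty}\frac{\lambda_1}{\min\frac1u}=\frac{\pi^2}{8}.$$ In particular, for any fixed $k>0$ (independent of $L$), $\lim_{L\to\infty}\lambda_1/\min\frac1u=\pi^2/8$ with probability one.
   Context: Let $\{\omega_j\}_{j\in\mathbb{Z}}$ be nonnegative i.i.d. real random variables on a probability space, with $\omega$ denoting a random variable with their common distribution. Let $\chi$ be the characteristic function of $[0,1)$ and $V_\omega(x)=\sum_{j\in\mathbb{Z}}\omega_j\chi(x-j)$, $x\in\mathbb{R}$. For a positive integer $L$ and $k\ge 0$ let $H=-\Delta+kV_\omega$ on $\Omega=(0,L)$ with Dirichlet boundary conditions, where $\Delta=d^2/dx^2$. $\lambda_1$ denotes the smallest (ground state) eigenvalue of $H$ on $\Omega$. $u$ (the landscape function) denotes the unique solution of $Hu=1$ on $\Omega$ with $u(0)=u(L)=0$; it is strictly positive on $(0,L)$. $\min\frac1u$ is the minimum of $1/u$ over $\Omega$, i.e. $1/\max_{[0,L]}u$. Both $\lambda_1$ and $u$ depend on $L,k$ and $\omega$. Limits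 $L\to\infty$ are over positive integers, for a fixed realization of the whole sequence $(\omega_j)$. *)

theory Defs
  imports "HOL-Probability.Probability"
begin

definition anderson_potential :: "(int \<Rightarrow> real) \<Rightarrow> real \<Rightarrow> real" where
  "anderson_potential w x = (\<Sum>\<^sub>\<infinity>j. w j * indicator {0..<1} (x - of_int j))"

text \<open>
  \<open>has_H2_derivative L f h\<close>: \<open>f\<close> belongs to the Sobolev space \<open>H\<^sup>2(0,L)\<close> and \<open>h\<close> is its weak second
  derivative. In one dimension this means that (the continuous representative of) \<open>f\<close> is
  continuously differentiable on \<open>[0,L]\<close> and that \<open>f'\<close> is the indefinite integral of the
  square-integrable function \<open>h\<close>.
\<close>

definition has_H2_derivative :: "real \<Rightarrow> (real \<Rightarrow> real) \<Rightarrow> (real \<Rightarrow> real) \<Rightarrow> bool" where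
  "has_H2_derivative L f h \<longleftrightarrow>
     set_integrable lborel {0..L} h \<and>
     set_integrable lborel {0..L} (\<lambda>x. (h x)\<^sup>2) \<and>
     (\<exists>g. \<forall>x\<in>{0..L}.
        (f has_real_derivative g x) (at x within {0..L}) \<and>
        g x = g 0 + (LBINT t:{0..x}. h t))"

text \<open>
  \<open>dirichlet_solution L W f F\<close>: \<open>f\<close> lies in \<open>H\<^sup>2(0,L) \<inter> H\<^sub>0\<^sup>1(0,L)\<close>, the domain of the Dirichlet
  realization of \<open>H = -d\<^sup>2/dx\<^sup>2 + W\<close> for a bounded potential \<open>W\<close>, and \<open>H f = F\<close> almost everywhere.
\<close>

definition dirichlet_solution ::
  "real \<Rightarrow> (real \<Rightarrow> real) \<Rightarrow> (real \<Rightarrow> real) \<Rightarrow> (real \<Rightarrow> real) \<Rightarrow> bool" where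
  "dirichlet_solution L W f F \<longleftrightarrow>
     f 0 = 0 \<and> f L = 0 \<and>
     (\<exists>h. has_H2_derivative L f h \<and>
        (AE x in lborel. x \<in> {0<..<L} \<longrightarrow> - h x + W x * f x = F x))"

text \<open>
  The operator is self-adjoint with real coefficients, so real numbers and real-valued
  eigenfunctions suffice.
\<close>

definition dirichlet_eigenvalue :: "real \<Rightarrow> (real \<Rightarrow> real) \<Rightarrow> real \<Rightarrow> bool" where
  "dirichlet_eigenvalue L W E \<longleftrightarrow>
     (\<exists>f. dirichlet_solution L W f (\<lambda>x. E * f x) \<and> (\<exists>x\<in>{0..L}. f x \<noteq> 0))"

definition ground_state_eigenvalue :: "real \<Rightarrow> (real \<Rightarrow> real) \<Rightarrow> real" where
  "ground_state_eigenvalue L W = (LEAST E. dirichlet_eigenvalue L W E)"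

text \<open>
  The solution is unique only as a function on \<open>[0,L]\<close>; it is extended by zero to make the
  description definite.
\<close>

definition landscape :: "real \<Rightarrow> (real \<Rightarrow> real) \<Rightarrow> real \<Rightarrow> real" where
  "landscape L W =
     (THE u. dirichlet_solution L W u (\<lambda>_. 1) \<and> (\<forall>x. x \<notin> {0..L} \<longrightarrow> u x = 0))"

definition min_inverse_landscape :: "real \<Rightarrow> (real \<Rightarrow> real) \<Rightarrow> real" where
  "min_inverse_landscape L W = (LEAST m. m \<in> (\<lambda>x. 1 / landscape L W x) ` {0<..<L})"

text \<open>
  Intervals of every kind are admitted: the potential is built from half-open cells, so the maximum
  is in general not attained by a closed interval. It is \<open>0\<close> if the potential vanishes nowhere
  on \<open>[0,L]\<close>, because the empty interval is admitted.
\<close>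

definition longest_zero_interval :: "real \<Rightarrow> (int \<Rightarrow> real) \<Rightarrow> real" where
  "longest_zero_interval L w =
     (GREATEST l. \<exists>I. is_interval I \<and> I \<subseteq> {0..L} \<and>
        (\<forall>x\<in>I. anderson_potential w x = 0) \<and> l = measure lborel I)"

definition eigenvalue_landscape_ratio :: "real \<Rightarrow> real \<Rightarrow> (int \<Rightarrow> real) \<Rightarrow> real" where
  "eigenvalue_landscape_ratio L k w =
     ground_state_eigenvalue L (\<lambda>x. k * anderson_potential w x) /
     min_inverse_landscape L (\<lambda>x. k * anderson_potential w x)"

end

theory Submission
  imports Defs "HOL-Real_Asymp.Real_Asymp"
begin

text \<open>
  Let \<open>R\<close> be the length of the longest run of cells in \<open>[0,L]\<close> on which the potential vanishes. The
  ratio is the product of \<open>\<lambda>\<^sub>1\<close> and the maximum of the landscape function \<open>u\<close>. Comparison with the run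
  alone gives \<open>\<lambda>\<^sub>1 \<le> \<pi>\<^sup>2/R\<^sup>2\<close> (a sine) and \<open>max u \<ge> R\<^sup>2/8\<close> (a parabola), and the product of the two
  bounds is \<open>\<pi>\<^sup>2/8\<close>. The theorem therefore says that both bounds are sharp up to a factor
  \<open>1 + o(1)\<close>: outside the longest run nothing matters.

  Small positive values of \<open>\<omega>\<close> might create wells that are longer than \<open>R\<close>, so a cell is called a
  barrier only if \<open>\<omega> \<ge> \<epsilon>\<close>. Since \<open>P(\<omega> < \<epsilon>)\<close> tends to \<open>p = P(\<omega> = 0)\<close> as \<open>\<epsilon>\<close> tends to \<open>0\<close>, and the longest
  run of an event of probability \<open>q\<close> among \<open>L\<close> independent trials is asymptotic to
  \<open>ln L / ln (1/q)\<close>, for every \<open>\<delta> > 0\<close> there is an \<open>\<epsilon>\<close> such that almost surely, for large \<open>L\<close>, any \<open>m\<close>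
  consecutive cells contain a barrier, where \<open>m + 1 \<le> (1 + \<delta>) R\<close>
  (\<open>AE_barriers_comparable_to_zero_run\<close>, by Borel--Cantelli).

  A barrier acts almost like a Dirichlet condition (\<open>barrier_low_point\<close>). Let \<open>f\<close> be the landscape
  function or the ground state, with \<open>0 \<le> f \<le> M\<close> and \<open>f'' \<ge> -c\<close>, where \<open>c = 1\<close> or \<open>c = \<lambda>\<^sub>1 M\<close>. These
  bounds and the boundary conditions give \<open>\<bar>f'\<bar> \<le> sqrt (2cM)\<close>. On a barrier \<open>f'' \<ge> k\<epsilon>f - c\<close>, and
  integrating over this cell yields a point where \<open>f \<le> (2 sqrt (2cM) + c)/(k\<epsilon>)\<close>. Relative to \<open>M\<close> this
  is of order \<open>1/(k\<epsilon>R)\<close>. The hypothesis \<open>k R\<^bsup>1-\<alpha>\<^esup> > C\<close> means \<open>kR > C R\<^sup>\<alpha>\<close>, so the relative height of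
  these low points tends to \<open>0\<close>.

  The maximum point of \<open>f\<close> lies between two low points at distance at most \<open>m + 1\<close>. Between them
  \<open>u'' \<ge> -1\<close> bounds \<open>u\<close> by a parabola of height about \<open>(m+1)\<^sup>2/8\<close>, and \<open>f'' \<ge> -\<lambda>\<^sub>1 f\<close> keeps the ground
  state above a cosine, which needs the length \<open>\<pi>/sqrt \<lambda>\<^sub>1\<close> to descend to \<open>0\<close> on both sides. This gives
  explicit two-sided bounds for the ratio (\<open>eigenvalue_landscape_ratio_bounds\<close>) in terms of \<open>R\<close>,
  \<open>m\<close> and \<open>1/(k\<epsilon>R)\<close>, and the limit follows by letting \<open>L \<rightarrow> \<infinity>\<close> and then \<open>\<delta> \<rightarrow> 0\<close>.

  That the ground state and the landscape function exist is proved by shooting: on each cell the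
  equation has constant coefficients, and gluing the explicit solutions gives solutions of the
  initial value problem that depend continuously on the energy (\<open>shooting_solutions\<close>). The
  ground state energy is the least energy for which the shot from the left end returns to zero.
\<close>

section \<open>Functions with a piecewise continuous second derivative\<close>

text \<open>
  The classical counterpart of \<open>has_H2_derivative\<close> for potentials with finitely many jumps. The
  exceptional set is arbitrary but finite, which makes the notion stable under restriction,
  reflection and gluing, so that the points where the potential jumps never need to be tracked.
\<close>

definition piecewise_C2 ::
  "real \<Rightarrow> real \<Rightarrow> (real \<Rightarrow> real) \<Rightarrow> (real \<Rightarrow> real) \<Rightarrow> (real \<Rightarrow> real) \<Rightarrow> bool" where
  "piecewise_C2 a b f g h \<longleftrightarrow>
     (\<forall>x\<in>{a..b}. (f has_real_derivative g x) (at x within {a..b})) \<and>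
     continuous_on {a..b} g \<and>
     (\<exists>S. finite S \<and> (\<forall>x\<in>{a<..<b} - S. (g has_real_derivative h x) (at x)))"

lemma piecewise_C2D:
  assumes "piecewise_C2 a b f g h"
  shows "\<And>x. x \<in> {a..b} \<Longrightarrow> (f has_real_derivative g x) (at x within {a..b})"
    and "continuous_on {a..b} g" and "continuous_on {a..b} f"
    and "\<And>x. a < x \<Longrightarrow> x < b \<Longrightarrow> (f has_real_derivative g x) (at x)"
proof -
  show 1: "\<And>x. x \<in> {a..b} \<Longrightarrow> (f has_real_derivative g x) (at x within {a..b})"
    and "continuous_on {a..b} g"
    using assms by (auto simp: piecewise_C2_def)
  show "continuous_on {a..b} f"
    using 1 by (meson DERIV_continuous_on)
  fix x assume "a < x" "x < b"
  with 1[of x] show "(f has_real_derivative g x) (at x)"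
    by (simp add: at_within_Icc_at)
qed

lemma piecewise_C2_exceptional:
  assumes "piecewise_C2 a b f g h"
  obtains S where "finite S" "\<And>x. a < x \<Longrightarrow> x < b \<Longrightarrow> x \<notin> S \<Longrightarrow> (g has_real_derivative h x) (at x)"
  using assms by (auto simp: piecewise_C2_def)

lemma piecewise_C2_subinterval:
  assumes "piecewise_C2 a b f g h" "a \<le> c" "d \<le> b"
  shows "piecewise_C2 c d f g h"
proof -
  have sub: "{c..d} \<subseteq> {a..b}" using assms by auto
  obtain S where "finite S" "\<And>x. a < x \<Longrightarrow> x < b \<Longrightarrow> x \<notin> S \<Longrightarrow> (g has_real_derivative h x) (at x)"
    using piecewise_C2_exceptional[OF assms(1)] by blast
  moreover have "\<forall>x\<in>{c..d}. (f has_real_derivative g x) (at x within {c..d})"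
    using piecewise_C2D(1)[OF assms(1)] sub by (meson DERIV_subset subsetD)
  moreover have "continuous_on {c..d} g"
    using piecewise_C2D(2)[OF assms(1)] sub continuous_on_subset by blast
  ultimately show ?thesis unfolding piecewise_C2_def using assms(2,3) by (intro conjI) (auto intro!: exI[of _ S])
qed

lemma piecewise_C2_cong:
  assumes "piecewise_C2 a b f g h"
    and "\<And>x. x \<in> {a..b} \<Longrightarrow> f x = f' x" "\<And>x. x \<in> {a..b} \<Longrightarrow> g x = g' x"
    and "finite T" "\<And>x. x \<in> {a<..<b} - T \<Longrightarrow> h x = h' x"
  shows "piecewise_C2 a b f' g' h'"
proof -
  obtain S where S: "finite S" "\<And>x. a < x \<Longrightarrow> x < b \<Longrightarrow> x \<notin> S \<Longrightarrow> (g has_real_derivative h x) (at x)"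
    using piecewise_C2_exceptional[OF assms(1)] by blast
  have "(f' has_real_derivative g' x) (at x within {a..b})" if x: "x \<in> {a..b}" for x
    using piecewise_C2D(1)[OF assms(1) x] assms(2,3) x
    by (metis has_field_derivative_transform_within zero_less_one)
  moreover have "continuous_on {a..b} g'"
    using piecewise_C2D(2)[OF assms(1)] assms(3) continuous_on_cong by metis
  moreover have "(g' has_real_derivative h' x) (at x)" if x: "x \<in> {a<..<b} - (S \<union> T)" for x
  proof -
    have "(g has_real_derivative h' x) (at x)" using S(2)[of x] x assms(5)[of x] by auto
    then show ?thesis
      by (rule has_field_derivative_transform_within_open[of _ _ _ "{a<..<b}"]) (use x assms(3) in auto)
  qed
  ultimately show ?thesis unfolding piecewise_C2_def using S(1) assms(4)
    by (intro conjI exI[of _ "S \<union> T"]) (blast | simp)+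
qed

lemma piecewise_C2_linear_combination:
  assumes "piecewise_C2 a b f1 g1 h1" "piecewise_C2 a b f2 g2 h2"
  shows "piecewise_C2 a b (\<lambda>x. r * f1 x + s * f2 x) (\<lambda>x. r * g1 x + s * g2 x) (\<lambda>x. r * h1 x + s * h2 x)"
proof -
  obtain S1 where S1: "finite S1" "\<And>x. a < x \<Longrightarrow> x < b \<Longrightarrow> x \<notin> S1 \<Longrightarrow> (g1 has_real_derivative h1 x) (at x)"
    using piecewise_C2_exceptional[OF assms(1)] by blast
  obtain S2 where S2: "finite S2" "\<And>x. a < x \<Longrightarrow> x < b \<Longrightarrow> x \<notin> S2 \<Longrightarrow> (g2 has_real_derivative h2 x) (at x)"
    using piecewise_C2_exceptional[OF assms(2)] by blast
  show ?thesis unfolding piecewise_C2_def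
  proof (intro conjI ballI exI[of _ "S1 \<union> S2"])
    show "((\<lambda>x. r * f1 x + s * f2 x) has_real_derivative r * g1 x + s * g2 x) (at x within {a..b})" if "x \<in> {a..b}" for x
      using piecewise_C2D(1)[OF assms(1) that] piecewise_C2D(1)[OF assms(2) that]
      by (auto intro!: derivative_eq_intros)
    show "continuous_on {a..b} (\<lambda>x. r * g1 x + s * g2 x)"
      using piecewise_C2D(2)[OF assms(1)] piecewise_C2D(2)[OF assms(2)] by (intro continuous_intros)
    show "((\<lambda>x. r * g1 x + s * g2 x) has_real_derivative r * h1 x + s * h2 x) (at x)" if "x \<in> {a<..<b} - (S1 \<union> S2)" for x
      using S1(2)[of x] S2(2)[of x] that by (auto intro!: derivative_eq_intros)
  qed (use S1 S2 in auto)
qed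

lemma piecewise_C2_smooth:
  assumes "\<And>x. (f has_real_derivative g x) (at x)" "\<And>x. (g has_real_derivative h x) (at x)"
  shows "piecewise_C2 a b f g h"
  unfolding piecewise_C2_def
  using assms by (auto intro: has_field_derivative_at_within intro!: exI[of _ "{}"] continuous_at_imp_continuous_on DERIV_isCont)

lemma piecewise_C2_reflect:
  assumes "piecewise_C2 a b f g h"
  shows "piecewise_C2 (N - b) (N - a) (\<lambda>x. f (N - x)) (\<lambda>x. - g (N - x)) (\<lambda>x. h (N - x))"
proof -
  obtain S where S: "finite S" "\<And>x. a < x \<Longrightarrow> x < b \<Longrightarrow> x \<notin> S \<Longrightarrow> (g has_real_derivative h x) (at x)"
    using piecewise_C2_exceptional[OF assms(1)] by blast
  have im: "(\<lambda>x. N - x) ` {N - b..N - a} = {a..b}"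
    by simp
  show ?thesis unfolding piecewise_C2_def
  proof (intro conjI ballI exI[of _ "(\<lambda>x. N - x) ` S"])
    fix x assume x: "x \<in> {N - b..N - a}"
    have "(f \<circ> (\<lambda>x. N - x) has_real_derivative g (N - x) * (- 1)) (at x within {N - b..N - a})"
      by (rule DERIV_image_chain) (use piecewise_C2D(1)[OF assms, of "N - x"] x im in \<open>auto intro!: derivative_eq_intros\<close>)
    then show "((\<lambda>x. f (N - x)) has_real_derivative - g (N - x)) (at x within {N - b..N - a})"
      by (simp add: o_def)
  next
    show "continuous_on {N - b..N - a} (\<lambda>x. - g (N - x))"
      by (intro continuous_intros continuous_on_compose2[OF piecewise_C2D(2)[OF assms]]) auto
  next
    show "((\<lambda>x. - g (N - x)) has_real_derivative h (N - x)) (at x)" if x: "x \<in> {N - b<..<N - a} - (\<lambda>x. N - x) ` S" for x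
    proof -
      have "N - x \<notin> S" using x by force
      then have "(g has_real_derivative h (N - x)) (at (N - x))" using S(2)[of "N - x"] x by auto
      then have "((\<lambda>x. g (N - x)) has_real_derivative h (N - x) * (-1)) (at x)"
        by (rule DERIV_chain2) (auto intro!: derivative_eq_intros)
      then show ?thesis by (auto intro!: derivative_eq_intros)
    qed
  qed (use S in auto)
qed

lemma piecewise_C2_join:
  assumes "piecewise_C2 a m f g h" "piecewise_C2 m b f g h" "a \<le> m" "m \<le> b"
  shows "piecewise_C2 a b f g h"
proof -
  obtain S1 where S1: "finite S1" "\<And>x. a < x \<Longrightarrow> x < m \<Longrightarrow> x \<notin> S1 \<Longrightarrow> (g has_real_derivative h x) (at x)"
    using piecewise_C2_exceptional[OF assms(1)] by blast
  obtain S2 where S2: "finite S2" "\<And>x. m < x \<Longrightarrow> x < b \<Longrightarrow> x \<notin> S2 \<Longrightarrow> (g has_real_derivative h x) (at x)"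
    using piecewise_C2_exceptional[OF assms(2)] by blast
  have un: "{a..b} = {a..m} \<union> {m..b}" using assms by auto
  show ?thesis unfolding piecewise_C2_def
  proof (intro conjI ballI exI[of _ "insert m (S1 \<union> S2)"])
    fix x assume x: "x \<in> {a..b}"
    have 1: "(f has_real_derivative g x) (at x within {a..m})"
    proof (cases "x \<le> m")
      case False
      then have "at x within {a..m} = bot" by (simp add: trivial_limit_within[unfolded trivial_limit_def] islimpt_Icc at_within_eq_bot_iff)
      then show ?thesis by (simp add: has_field_derivative_iff)
    qed (use piecewise_C2D(1)[OF assms(1), of x] x in auto)
    have 2: "(f has_real_derivative g x) (at x within {m..b})"
    proof (cases "m \<le> x")
      case False
      then have "at x within {m..b} = bot" by (simp add: at_within_eq_bot_iff)
      then show ?thesis by (simp add: has_field_derivative_iff)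
    qed (use piecewise_C2D(1)[OF assms(2), of x] x in auto)
    show "(f has_real_derivative g x) (at x within {a..b})"
      using 1 2 unfolding has_field_derivative_iff un by (rule Lim_within_Un[THEN iffD2, OF conjI])
  next
    show "continuous_on {a..b} g" unfolding un
      by (rule continuous_on_closed_Un) (use piecewise_C2D(2) assms in auto)
  next
    fix x assume "x \<in> {a<..<b} - insert m (S1 \<union> S2)"
    then show "(g has_real_derivative h x) (at x)" using S1(2)[of x] S2(2)[of x] by (cases "x < m") auto
  qed (use S1 S2 in auto)
qed

text \<open>
  The fundamental theorem of calculus ignores finitely many points, whereas the mean value theorem
  does not. All comparison arguments below reduce to this lemma and its strict version.
\<close>

lemma nondecreasing_off_finite:
  fixes G :: "real \<Rightarrow> real"
  assumes "finite S" "a \<le> b" "continuous_on {a..b} G"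
    and "\<And>x. a < x \<Longrightarrow> x < b \<Longrightarrow> x \<notin> S \<Longrightarrow> (G has_real_derivative G' x) (at x)"
    and "\<And>x. a < x \<Longrightarrow> x < b \<Longrightarrow> x \<notin> S \<Longrightarrow> 0 \<le> G' x"
  shows "G a \<le> G b"
proof -
  let ?G' = "\<lambda>x. if x \<in> {a<..<b} - S then G' x else 0"
  have "(?G' has_integral (G b - G a)) {a..b}"
    by (rule fundamental_theorem_of_calculus_interior_strong[OF assms(1,2)])
       (use assms in \<open>auto simp: has_real_derivative_iff_has_vector_derivative[symmetric]\<close>)
  then have "0 \<le> G b - G a" by (rule has_integral_nonneg) (use assms in auto)
  then show ?thesis by simp
qed

lemma increasing_off_finite:
  fixes G :: "real \<Rightarrow> real"
  assumes "finite S" "a < b" "continuous_on {a..b} G"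
    and "\<And>x. a < x \<Longrightarrow> x < b \<Longrightarrow> x \<notin> S \<Longrightarrow> (G has_real_derivative G' x) (at x)"
    and "\<And>x. a < x \<Longrightarrow> x < b \<Longrightarrow> x \<notin> S \<Longrightarrow> 0 < G' x"
  shows "G a < G b"
proof -
  have mono: "G x \<le> G y" if "a \<le> x" "x \<le> y" "y \<le> b" for x y
  proof (rule nondecreasing_off_finite[OF assms(1) that(2), where G' = G'])
    show "continuous_on {x..y} G"
      using continuous_on_subset[OF assms(3)] that by auto
  qed (use assms(4,5) that in \<open>auto intro: less_imp_le\<close>)
  show ?thesis
  proof (rule ccontr)
    assume "\<not> G a < G b"
    then have const: "G x = G a" if "a \<le> x" "x \<le> b" for x
      using mono[of a x] mono[of x b] that by force
    have "infinite {a<..<b}" using assms(2) by simp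
    then obtain x where x: "x \<in> {a<..<b} - S" using assms(1)
      by (metis Diff_eq_empty_iff equals0I finite_subset)
    have "((\<lambda>_. G a) has_real_derivative G' x) (at x)"
      by (rule has_field_derivative_transform_within_open[of G _ _ "{a<..<b}"])
         (use assms(4)[of x] x in \<open>auto intro: const\<close>)
    then have "G' x = 0" using DERIV_unique[OF _ DERIV_const] by blast
    with assms(5)[of x] x show False by auto
  qed
qed

section \<open>Comparison for second-order differential inequalities\<close>

text \<open>
  Gronwall's argument: the energy \<open>f\<^sup>2 + g\<^sup>2\<close> grows at most like \<open>exp ((K+1) x)\<close>, so it stays zero.
\<close>

lemma second_order_uniqueness:
  assumes C2: "piecewise_C2 a b f g h" and K: "0 \<le> K"
    and h: "\<And>x. a < x \<Longrightarrow> x < b \<Longrightarrow> \<bar>h x\<bar> \<le> K * \<bar>f x\<bar>"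
    and init: "f a = 0" "g a = 0" and x: "x \<in> {a..b}"
  shows "f x = 0 \<and> g x = 0"
proof -
  obtain S where S: "finite S" "\<And>x. a < x \<Longrightarrow> x < b \<Longrightarrow> x \<notin> S \<Longrightarrow> (g has_real_derivative h x) (at x)"
    using piecewise_C2_exceptional[OF C2] by blast
  let ?G = "\<lambda>x. - exp (-(K + 1) * x) * ((f x)\<^sup>2 + (g x)\<^sup>2)"
  let ?D = "\<lambda>x. exp (-(K + 1) * x) * ((K + 1) * ((f x)\<^sup>2 + (g x)\<^sup>2) - (2 * f x * g x + 2 * g x * h x))"
  have "?G a \<le> ?G x"
  proof (rule nondecreasing_off_finite[OF S(1), where G = ?G and G' = ?D])
    show "continuous_on {a..x} ?G"
      using piecewise_C2D(2,3)[OF C2] x by (intro continuous_intros) (auto intro: continuous_on_subset)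
  next
    fix y assume y: "a < y" "y < x" "y \<notin> S"
    then have "(f has_real_derivative g y) (at y)" "(g has_real_derivative h y) (at y)"
      using S(2)[of y] x piecewise_C2D(4)[OF C2, of y] by auto
    then show "(?G has_real_derivative ?D y) (at y)"
      by (auto intro!: derivative_eq_intros simp: algebra_simps power2_eq_square)
    have "2 * f y * g y \<le> (f y)\<^sup>2 + (g y)\<^sup>2" by (rule sum_squares_bound)
    moreover have "2 * g y * h y \<le> K * ((f y)\<^sup>2 + (g y)\<^sup>2)"
    proof -
      have "2 * g y * h y \<le> 2 * (\<bar>g y\<bar> * \<bar>h y\<bar>)"
        by (metis abs_ge_self abs_mult mult.assoc mult_le_cancel_left_pos zero_less_numeral)
      also have "\<dots> \<le> 2 * (\<bar>g y\<bar> * (K * \<bar>f y\<bar>))"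
        using h[of y] y x by (intro mult_left_mono) auto
      also have "\<dots> = K * (2 * \<bar>f y\<bar> * \<bar>g y\<bar>)" by simp
      also have "\<dots> \<le> K * (\<bar>f y\<bar>\<^sup>2 + \<bar>g y\<bar>\<^sup>2)" using K by (intro mult_left_mono sum_squares_bound)
      finally show ?thesis by simp
    qed
    ultimately have "2 * f y * g y + 2 * g y * h y \<le> (K + 1) * ((f y)\<^sup>2 + (g y)\<^sup>2)"
      by (simp add: algebra_simps)
    then show "0 \<le> ?D y" by simp
  qed (use x in auto)
  then have "(f x)\<^sup>2 + (g x)\<^sup>2 \<le> 0" using init by (simp add: mult_le_0_iff)
  then show ?thesis by (simp add: sum_power2_le_zero_iff)
qed

text \<open>
  The product \<open>f f'\<close> has the derivative \<open>f'\<^sup>2 + f f'' \<ge> 0\<close> and vanishes at both ends, hence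
  everywhere. This replaces the maximum principle for a nonnegative potential: it yields the uniqueness
  of the landscape function and the positivity of eigenvalues.
\<close>

lemma dirichlet_energy_trivial:
  assumes C2: "piecewise_C2 a b f g h" and pos: "\<And>x. a < x \<Longrightarrow> x < b \<Longrightarrow> 0 \<le> f x * h x"
    and bc: "f a = 0" "f b = 0" and x: "x \<in> {a..b}"
  shows "f x = 0"
proof -
  obtain S where S: "finite S" "\<And>x. a < x \<Longrightarrow> x < b \<Longrightarrow> x \<notin> S \<Longrightarrow> (g has_real_derivative h x) (at x)"
    using piecewise_C2_exceptional[OF C2] by blast
  have cont: "continuous_on {c..d} f" "continuous_on {c..d} g" if "a \<le> c" "d \<le> b" for c d
    using piecewise_C2D(2,3)[OF C2] that by (auto elim!: continuous_on_subset)
  have mono: "f c * g c \<le> f d * g d" if cd: "a \<le> c" "c \<le> d" "d \<le> b" for c d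
  proof (rule nondecreasing_off_finite[OF S(1) cd(2), where G = "\<lambda>x. f x * g x" and G' = "\<lambda>x. g x * g x + f x * h x"])
    show "continuous_on {c..d} (\<lambda>x. f x * g x)" using cont cd by (intro continuous_intros) auto
    fix y assume y: "c < y" "y < d" "y \<notin> S"
    then have "(f has_real_derivative g y) (at y)" "(g has_real_derivative h y) (at y)"
      using S(2)[of y] cd piecewise_C2D(4)[OF C2, of y] by auto
    then show "((\<lambda>x. f x * g x) has_real_derivative g y * g y + f y * h y) (at y)"
      by (auto intro!: derivative_eq_intros)
    show "0 \<le> g y * g y + f y * h y" using pos[of y] y cd by simp
  qed
  have zero: "f y * g y = 0" if "y \<in> {a..b}" for y
    using mono[of a y] mono[of y b] that bc by simp
  have "- (f a)\<^sup>2 \<le> - (f x)\<^sup>2"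
  proof (rule nondecreasing_off_finite[where G = "\<lambda>x. - (f x)\<^sup>2" and G' = "\<lambda>_. 0" and S = "{}"])
    show "continuous_on {a..x} (\<lambda>x. - (f x)\<^sup>2)" using cont[of a x] x by (intro continuous_intros) auto
    fix y assume y: "a < y" "y < x"
    then have "(f has_real_derivative g y) (at y)" using x piecewise_C2D(4)[OF C2, of y] by auto
    then show "((\<lambda>x. - (f x)\<^sup>2) has_real_derivative 0) (at y)"
      using zero[of y] y x by (auto intro!: derivative_eq_intros)
  qed (use x in auto)
  then show ?thesis using bc by simp
qed

text \<open>
  A positive function with \<open>f'' \<le> -\<mu> f\<close> cannot live on an interval longer than a half-wave of
  frequency \<open>sqrt \<mu>\<close>. It is used twice: on the longest zero run it bounds the ground state
  energy from above, and on the whole interval it shows that shooting with a large energy produces a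
  zero.
\<close>

lemma sine_comparison:
  assumes C2: "piecewise_C2 a b f g h" and ab: "a < b"
    and h: "\<And>x. a < x \<Longrightarrow> x < b \<Longrightarrow> h x \<le> - \<mu> * f x"
    and pos: "\<And>x. a < x \<Longrightarrow> x < b \<Longrightarrow> 0 < f x" and bc: "0 \<le> f a" "0 \<le> f b"
  shows "\<mu> \<le> (pi / (b - a))\<^sup>2"
proof (rule ccontr)
  define \<nu> where "\<nu> = pi / (b - a)"
  assume "\<not> \<mu> \<le> (pi / (b - a))\<^sup>2"
  then have \<mu>: "\<nu>\<^sup>2 < \<mu>" by (simp add: \<nu>_def)
  have \<nu>: "0 < \<nu>" "\<nu> * (b - a) = pi" using ab by (auto simp: \<nu>_def)
  obtain S where S: "finite S" "\<And>x. a < x \<Longrightarrow> x < b \<Longrightarrow> x \<notin> S \<Longrightarrow> (g has_real_derivative h x) (at x)"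
    using piecewise_C2_exceptional[OF C2] by blast
  \<comment> \<open>the Wronskian of \<open>f\<close> and the half-wave on \<open>[a,b]\<close>; the sine vanishes at both ends\<close>
  let ?G = "\<lambda>x. \<nu> * f x * cos (\<nu> * (x - a)) - g x * sin (\<nu> * (x - a))"
  have "?G a < ?G b"
  proof (rule increasing_off_finite[OF S(1) ab, where G' = "\<lambda>x. - (h x + \<nu>\<^sup>2 * f x) * sin (\<nu> * (x - a))"])
    show "continuous_on {a..b} ?G"
      using piecewise_C2D(2,3)[OF C2] by (intro continuous_intros)
    fix y assume y: "a < y" "y < b" "y \<notin> S"
    then have "(f has_real_derivative g y) (at y)" "(g has_real_derivative h y) (at y)"
      using S(2)[of y] piecewise_C2D(4)[OF C2, of y] by auto
    then show "(?G has_real_derivative - (h y + \<nu>\<^sup>2 * f y) * sin (\<nu> * (y - a))) (at y)"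
      by (auto intro!: derivative_eq_intros simp: algebra_simps power2_eq_square)
    have "\<nu> * (y - a) < \<nu> * (b - a)" using y \<nu> by (intro mult_strict_left_mono) auto
    then have s: "0 < sin (\<nu> * (y - a))" using y \<nu> by (intro sin_gt_zero) auto
    have "\<nu>\<^sup>2 * f y < \<mu> * f y" using \<mu> pos[OF y(1,2)] by simp
    then have "h y + \<nu>\<^sup>2 * f y < 0" using h[OF y(1,2)] by simp
    with s show "0 < - (h y + \<nu>\<^sup>2 * f y) * sin (\<nu> * (y - a))" by (simp add: mult_neg_pos)
  qed
  then have "\<nu> * f a < - (\<nu> * f b)" using \<nu> by simp
  moreover have "0 \<le> \<nu> * f a" "0 \<le> \<nu> * f b" using bc \<nu> by auto
  ultimately show False by linarith
qed

text \<open>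
  If \<open>x0\<close> were a minimum, then \<open>f'\<close> would vanish there and be negative on its right. This makes
  the landscape function positive in the interior.
\<close>

lemma no_local_min_where_concave:
  assumes C2: "piecewise_C2 a b f g h" and x0: "a < x0" "x0 < b" and \<delta>: "0 < \<delta>"
    and h: "\<And>x. a < x \<Longrightarrow> x < b \<Longrightarrow> \<bar>x - x0\<bar> < \<delta> \<Longrightarrow> h x < 0"
  shows "\<exists>x\<in>{a..b}. f x < f x0"
proof (rule ccontr)
  assume "\<not> (\<exists>x\<in>{a..b}. f x < f x0)"
  then have min: "\<And>x. x \<in> {a..b} \<Longrightarrow> f x0 \<le> f x" by force
  obtain S where S: "finite S" "\<And>x. a < x \<Longrightarrow> x < b \<Longrightarrow> x \<notin> S \<Longrightarrow> (g has_real_derivative h x) (at x)"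
    using piecewise_C2_exceptional[OF C2] by blast
  have g0: "g x0 = 0"
  proof (rule DERIV_local_min[of f _ x0 "min (x0 - a) (b - x0)"])
    show "(f has_real_derivative g x0) (at x0)" using piecewise_C2D(4)[OF C2] x0 by auto
    show "\<forall>y. \<bar>x0 - y\<bar> < min (x0 - a) (b - x0) \<longrightarrow> f x0 \<le> f y" using min by (auto simp: abs_less_iff)
  qed (use x0 in auto)
  define y where "y = min (x0 + \<delta>) b"
  have y: "x0 < y" "y \<le> b" "y \<le> x0 + \<delta>" using \<delta> x0 by (auto simp: y_def)
  have neg: "g z < 0" if z: "x0 < z" "z < y" for z
  proof -
    have "- g x0 < - g z"
    proof (rule increasing_off_finite[OF S(1) z(1), where G' = "\<lambda>x. - h x"])
      have "continuous_on {x0..z} g" by (rule continuous_on_subset[OF piecewise_C2D(2)[OF C2]]) (use x0 z y in auto)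
      then show "continuous_on {x0..z} (\<lambda>x. - g x)" by (intro continuous_intros)
    qed (use S(2) h x0 z y in \<open>auto intro!: derivative_intros\<close>)
    with g0 show ?thesis by simp
  qed
  have "- f x0 < - f y"
  proof (rule increasing_off_finite[of "{}", OF _ y(1), where G' = "\<lambda>x. - g x"])
    have "continuous_on {x0..y} f" by (rule continuous_on_subset[OF piecewise_C2D(3)[OF C2]]) (use x0 y in auto)
    then show "continuous_on {x0..y} (\<lambda>x. - f x)" by (intro continuous_intros)
  qed (use neg piecewise_C2D(4)[OF C2] x0 y in \<open>auto intro!: derivative_intros\<close>)
  with min[of y] y x0 show False by auto
qed

text \<open>
  Taylor's formula with a one-sided bound for the second derivative. It takes the place of convexity
  arguments for \<open>f + c x\<^sup>2/2\<close>.
\<close>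

lemma taylor_lower_bound:
  assumes C2: "piecewise_C2 a b f g h" and ab: "a \<le> b"
    and h: "\<And>x. a < x \<Longrightarrow> x < b \<Longrightarrow> - c \<le> h x"
  shows "f a + g a * (b - a) - c * (b - a)\<^sup>2 / 2 \<le> f b"
proof -
  obtain S where S: "finite S" "\<And>x. a < x \<Longrightarrow> x < b \<Longrightarrow> x \<notin> S \<Longrightarrow> (g has_real_derivative h x) (at x)"
    using piecewise_C2_exceptional[OF C2] by blast
  have g: "g a - c * (y - a) \<le> g y" if y: "a \<le> y" "y \<le> b" for y
  proof -
    have "g a + c * a \<le> g y + c * y"
    proof (rule nondecreasing_off_finite[OF S(1) y(1), where G = "\<lambda>x. g x + c * x" and G' = "\<lambda>x. h x + c"])
      have "continuous_on {a..y} g" by (rule continuous_on_subset[OF piecewise_C2D(2)[OF C2]]) (use y in auto)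
      then show "continuous_on {a..y} (\<lambda>x. g x + c * x)" by (intro continuous_intros)
      fix x assume x: "a < x" "x < y" "x \<notin> S"
      show "((\<lambda>x. g x + c * x) has_real_derivative h x + c) (at x)"
        using S(2)[of x] x y by (auto intro!: derivative_eq_intros)
      show "0 \<le> h x + c" using h[of x] x y by auto
    qed
    then show ?thesis by (simp add: algebra_simps)
  qed
  let ?F = "\<lambda>x. f x - g a * (x - a) + c * (x - a)\<^sup>2 / 2"
  have "?F a \<le> ?F b"
  proof (rule nondecreasing_off_finite[of "{}", OF _ ab, where G' = "\<lambda>x. g x - g a + c * (x - a)"])
    show "continuous_on {a..b} ?F" using piecewise_C2D(3)[OF C2] by (intro continuous_intros) auto
    fix x assume x: "a < x" "x < b"
    show "(?F has_real_derivative g x - g a + c * (x - a)) (at x)"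
      using piecewise_C2D(4)[OF C2 x] by (auto intro!: derivative_eq_intros)
    show "0 \<le> g x - g a + c * (x - a)" using g[of x] x by auto
  qed simp
  then show "f a + g a * (b - a) - c * (b - a)\<^sup>2 / 2 \<le> f b" by simp
qed

text \<open>
  A function that rises with slope \<open>s\<close> while \<open>f'' \<ge> -c\<close> keeps rising for the length \<open>s/c\<close> and
  gains \<open>s\<^sup>2/(2c)\<close> on the way; this must not exceed \<open>M\<close>. The rise is complete before \<open>b\<close>, since
  otherwise \<open>f b\<close> would be positive.
\<close>

lemma derivative_upper_bound:
  assumes C2: "piecewise_C2 a b f g h" and c: "0 < c"
    and h: "\<And>x. a < x \<Longrightarrow> x < b \<Longrightarrow> - c \<le> h x"
    and f: "\<And>x. a \<le> x \<Longrightarrow> x \<le> b \<Longrightarrow> 0 \<le> f x" "\<And>x. a \<le> x \<Longrightarrow> x \<le> b \<Longrightarrow> f x \<le> M"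
    and fb: "f b = 0" and x: "x \<in> {a..b}" and ab: "a < b"
  shows "g x \<le> sqrt (2 * c * M)"
proof -
  have M: "0 \<le> M" using f(1)[of a] f(2)[of a] ab by auto
  have *: "g x \<le> sqrt (2 * c * M)" if x: "a \<le> x" "x < b" for x
  proof (cases "0 < g x")
    case True
    have low: "f x + g x * (y - x) - c * (y - x)\<^sup>2 / 2 \<le> f y" if "x \<le> y" "y \<le> b" for y
      by (rule taylor_lower_bound[OF piecewise_C2_subinterval[OF C2 x(1)]]) (use h that x in auto)
    have "x + g x / c \<le> b"
    proof (rule ccontr)
      assume "\<not> x + g x / c \<le> b"
      then have "c * (b - x) < g x" using c by (simp add: field_simps)
      then have "c * (b - x) * (b - x) < g x * (b - x)" using x by (intro mult_strict_right_mono) auto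
      moreover have "0 < g x * (b - x)" using True x by simp
      moreover have "0 \<le> f x" using f(1)[of x] x by simp
      ultimately have "0 < f x + g x * (b - x) - c * (b - x)\<^sup>2 / 2"
        by (simp add: power2_eq_square)
      with low[of b] fb x show False by simp
    qed
    moreover have "x \<le> x + g x / c" using True c by simp
    ultimately have "f x + g x * (g x / c) - c * (g x / c)\<^sup>2 / 2 \<le> M"
      using low[of "x + g x / c"] f(2)[of "x + g x / c"] x by auto
    moreover have "0 \<le> f x" using f(1)[of x] x by simp
    moreover have "g x * (g x / c) - c * (g x / c)\<^sup>2 / 2 = (g x)\<^sup>2 / (2 * c)"
      using c by (simp add: field_simps power2_eq_square)
    ultimately have "(g x)\<^sup>2 / (2 * c) \<le> M" by linarith
    then have "(g x)\<^sup>2 \<le> 2 * c * M" using c by (simp add: field_simps)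
    then show ?thesis by (rule real_le_rsqrt)
  next
    case False
    have "0 \<le> sqrt (2 * c * M)" using c M by simp
    with False show ?thesis by linarith
  qed
  show ?thesis
    by (rule continuous_le_on_closure[of "{a..<b}" g])
       (use x ab * piecewise_C2D(2)[OF C2] in auto)
qed

lemma derivative_lower_bound:
  assumes C2: "piecewise_C2 a b f g h" and c: "0 < c"
    and h: "\<And>x. a < x \<Longrightarrow> x < b \<Longrightarrow> - c \<le> h x"
    and f: "\<And>x. a \<le> x \<Longrightarrow> x \<le> b \<Longrightarrow> 0 \<le> f x" "\<And>x. a \<le> x \<Longrightarrow> x \<le> b \<Longrightarrow> f x \<le> M"
    and fa: "f a = 0" and x: "x \<in> {a..b}" and ab: "a < b"
  shows "- sqrt (2 * c * M) \<le> g x"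
proof -
  have "- g (0 - (- x)) \<le> sqrt (2 * c * M)"
    by (rule derivative_upper_bound[OF piecewise_C2_reflect[OF C2, of 0], where c = c])
       (use assms in auto)
  then show ?thesis by simp
qed

text \<open>
  The derivative bounds limit the total increase of \<open>f'\<close> over the cell to \<open>2 sqrt (2cM)\<close>, while
  the barrier forces an increase of at least \<open>\<kappa> min f - c\<close>.
\<close>

lemma barrier_low_point:
  assumes C2: "piecewise_C2 a b f g h" and c: "0 < c" and \<kappa>: "0 < \<kappa>"
    and h: "\<And>x. a < x \<Longrightarrow> x < b \<Longrightarrow> - c \<le> h x"
    and f: "\<And>x. a \<le> x \<Longrightarrow> x \<le> b \<Longrightarrow> 0 \<le> f x" "\<And>x. a \<le> x \<Longrightarrow> x \<le> b \<Longrightarrow> f x \<le> M"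
    and bc: "f a = 0" "f b = 0" and cell: "a \<le> d" "d + 1 \<le> b"
    and barrier: "\<And>x. d < x \<Longrightarrow> x < d + 1 \<Longrightarrow> \<kappa> * f x - c \<le> h x"
  shows "\<exists>z\<in>{d..d+1}. f z \<le> (2 * sqrt (2 * c * M) + c) / \<kappa>"
proof (rule ccontr)
  define \<eta> where "\<eta> = (2 * sqrt (2 * c * M) + c) / \<kappa>"
  assume "\<not> (\<exists>z\<in>{d..d+1}. f z \<le> (2 * sqrt (2 * c * M) + c) / \<kappa>)"
  then have high: "\<And>z. z \<in> {d..d+1} \<Longrightarrow> \<eta> < f z" by (force simp: \<eta>_def)
  obtain S where S: "finite S" "\<And>x. a < x \<Longrightarrow> x < b \<Longrightarrow> x \<notin> S \<Longrightarrow> (g has_real_derivative h x) (at x)"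
    using piecewise_C2_exceptional[OF C2] by blast
  have "g d - (\<kappa> * \<eta> - c) * d < g (d + 1) - (\<kappa> * \<eta> - c) * (d + 1)"
  proof (rule increasing_off_finite[OF S(1), where G = "\<lambda>x. g x - (\<kappa> * \<eta> - c) * x" and G' = "\<lambda>x. h x - (\<kappa> * \<eta> - c)"])
    have "continuous_on {d..d+1} g" by (rule continuous_on_subset[OF piecewise_C2D(2)[OF C2]]) (use cell in auto)
    then show "continuous_on {d..d+1} (\<lambda>x. g x - (\<kappa> * \<eta> - c) * x)" by (intro continuous_intros)
    fix x assume x: "d < x" "x < d + 1" "x \<notin> S"
    show "((\<lambda>x. g x - (\<kappa> * \<eta> - c) * x) has_real_derivative h x - (\<kappa> * \<eta> - c)) (at x)"
      using S(2)[of x] x cell by (auto intro!: derivative_eq_intros)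
    have "\<kappa> * \<eta> < \<kappa> * f x" using high[of x] x \<kappa> by simp
    then show "0 < h x - (\<kappa> * \<eta> - c)" using barrier[of x] x by simp
  qed simp
  then have "\<kappa> * \<eta> - c < g (d + 1) - g d" by (simp add: algebra_simps)
  moreover have "g (d + 1) \<le> sqrt (2 * c * M)"
    by (rule derivative_upper_bound[OF C2 c h f bc(2)]) (use cell in auto)
  moreover have "- sqrt (2 * c * M) \<le> g d"
    by (rule derivative_lower_bound[OF C2 c h f bc(1)]) (use cell in auto)
  moreover have "\<kappa> * \<eta> = 2 * sqrt (2 * c * M) + c" using \<kappa> by (simp add: \<eta>_def)
  ultimately show False by linarith
qed

text \<open>
  Taylor's formula at \<open>x\<close> towards both ends bounds \<open>f x\<close> by \<open>\<eta> + c (x - a)(b - x)/2\<close>, which is largest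
  in the middle.
\<close>

lemma parabola_upper_bound:
  assumes C2: "piecewise_C2 a b f g h" and x: "x \<in> {a..b}" and c: "0 \<le> c"
    and h: "\<And>x. a < x \<Longrightarrow> x < b \<Longrightarrow> - c \<le> h x" and bc: "f a \<le> \<eta>" "f b \<le> \<eta>"
  shows "f x \<le> \<eta> + c * (b - a)\<^sup>2 / 8"
proof (cases "f x \<le> \<eta>")
  case True
  then show ?thesis using c by (simp add: add_increasing2)
next
  case False
  have r: "f x + g x * (b - x) - c * (b - x)\<^sup>2 / 2 \<le> f b"
    by (rule taylor_lower_bound[OF piecewise_C2_subinterval[OF C2]]) (use x h in auto)
  have "f (0 - (- x)) + (- g (0 - (- x))) * (- a - (- x)) - c * (- a - (- x))\<^sup>2 / 2 \<le> f (0 - (- a))"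
    by (rule taylor_lower_bound[OF piecewise_C2_subinterval[OF piecewise_C2_reflect[OF C2, of 0]]])
       (use x h in auto)
  then have l: "f x - g x * (x - a) - c * (x - a)\<^sup>2 / 2 \<le> f a" by (simp add: algebra_simps)
  have ab: "a < b" using x bc False by (cases "a = b") auto
  \<comment> \<open>the weights \<open>x - a\<close> and \<open>b - x\<close> eliminate the unknown slope at \<open>x\<close>\<close>
  have "(f x - \<eta>) * (b - a) \<le> c * (x - a) * (b - x) / 2 * (b - a)"
  proof -
    have "(x - a) * (f x + g x * (b - x) - c * (b - x)\<^sup>2 / 2 - \<eta>) \<le> 0"
      using r bc x by (intro mult_nonneg_nonpos) auto
    moreover have "(b - x) * (f x - g x * (x - a) - c * (x - a)\<^sup>2 / 2 - \<eta>) \<le> 0"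
      using l bc x by (intro mult_nonneg_nonpos) auto
    moreover have "(x - a) * (f x + g x * (b - x) - c * (b - x)\<^sup>2 / 2 - \<eta>) +
        (b - x) * (f x - g x * (x - a) - c * (x - a)\<^sup>2 / 2 - \<eta>) =
        (f x - \<eta>) * (b - a) - c * (x - a) * (b - x) / 2 * (b - a)"
      by (simp add: field_simps power2_eq_square)
    ultimately show ?thesis by linarith
  qed
  then have "f x - \<eta> \<le> c * (x - a) * (b - x) / 2" using ab by simp
  also have "\<dots> = c * ((x - a) * (b - x)) / 2" by simp
  also have "\<dots> \<le> c * ((b - a)\<^sup>2 / 4) / 2"
  proof -
    have "(x - a) * (b - x) \<le> (b - a)\<^sup>2 / 4"
      using zero_le_power2[of "(x - a) - (b - x)"] by (simp add: algebra_simps power2_eq_square)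
    then have "c * ((x - a) * (b - x)) \<le> c * ((b - a)\<^sup>2 / 4)" using c by (rule mult_left_mono)
    then show ?thesis by linarith
  qed
  finally show ?thesis by simp
qed

lemma parabola_lower_bound:
  assumes C2: "piecewise_C2 a b f g h" and ab: "a < b"
    and h: "\<And>x. a < x \<Longrightarrow> x < b \<Longrightarrow> h x \<le> - c" and bc: "0 \<le> f a" "0 \<le> f b"
  shows "c * (b - a)\<^sup>2 / 8 \<le> f ((a + b) / 2)"
proof -
  define m where "m = (a + b) / 2"
  have C2': "piecewise_C2 a b (\<lambda>x. (-1) * f x + 0 * f x) (\<lambda>x. (-1) * g x + 0 * g x) (\<lambda>x. (-1) * h x + 0 * h x)"
    by (rule piecewise_C2_linear_combination[OF C2 C2])
  have C2n: "piecewise_C2 a b (\<lambda>x. - f x) (\<lambda>x. - g x) (\<lambda>x. - h x)" using C2' by simp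
  have h': "- (- c) \<le> - h x" if "a < x" "x < b" for x using h[OF that] by simp
  have m: "a \<le> m" "m \<le> b" using ab by (auto simp: m_def)
  have r: "- f m + (- g m) * (b - m) - (- c) * (b - m)\<^sup>2 / 2 \<le> - f b"
    by (rule taylor_lower_bound[OF piecewise_C2_subinterval[OF C2n]]) (use m h' in \<open>auto intro: h'\<close>)
  have "- f (0 - (- m)) + (- (- g (0 - (- m)))) * (- a - (- m)) - (- c) * (- a - (- m))\<^sup>2 / 2 \<le> - f (0 - (- a))"
    by (rule taylor_lower_bound[OF piecewise_C2_subinterval[OF piecewise_C2_reflect[OF C2n, of 0]]])
       (use m h' in \<open>auto intro: h'\<close>)
  then have l: "- f m + g m * (m - a) + c * (m - a)\<^sup>2 / 2 \<le> - f a" by (simp add: algebra_simps)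
  have "m - a = (b - a) / 2" "b - m = (b - a) / 2" by (auto simp: m_def field_simps)
  with l r bc have "c * ((b - a) / 2)\<^sup>2 \<le> 2 * f m" by (simp add: power2_eq_square field_simps)
  then show ?thesis by (simp add: m_def power_divide)
qed

text \<open>
  The quotient of \<open>f\<close> and the cosine is nondecreasing, because its derivative is the Wronskian of
  the two functions over the square of the cosine, and the Wronskian grows from zero.
\<close>

lemma cosine_comparison:
  assumes C2: "piecewise_C2 a b f g h" and ab: "a \<le> b" and \<nu>: "0 < \<nu>" "\<nu> * (b - a) < pi / 2"
    and h: "\<And>x. a < x \<Longrightarrow> x < b \<Longrightarrow> - \<nu>\<^sup>2 * f x \<le> h x" and ga: "g a = 0"
  shows "f a * cos (\<nu> * (b - a)) \<le> f b"
proof -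
  obtain S where S: "finite S" "\<And>x. a < x \<Longrightarrow> x < b \<Longrightarrow> x \<notin> S \<Longrightarrow> (g has_real_derivative h x) (at x)"
    using piecewise_C2_exceptional[OF C2] by blast
  have cos_pos: "0 < cos (\<nu> * (x - a))" if "a \<le> x" "x \<le> b" for x
  proof (rule cos_gt_zero_pi)
    have "\<nu> * (x - a) \<le> \<nu> * (b - a)" using that \<nu> by (intro mult_left_mono) auto
    with \<nu>(2) show "\<nu> * (x - a) < pi / 2" by linarith
    have "0 \<le> \<nu> * (x - a)" using that \<nu> by simp
    then show "- (pi / 2) < \<nu> * (x - a)" using pi_gt_zero by linarith
  qed
  let ?G = "\<lambda>x. g x * cos (\<nu> * (x - a)) + \<nu> * f x * sin (\<nu> * (x - a))"
  have W: "0 \<le> ?G y" if y: "a \<le> y" "y \<le> b" for y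
  proof -
    have "?G a \<le> ?G y"
    proof (rule nondecreasing_off_finite[OF S(1) y(1), where G' = "\<lambda>x. (h x + \<nu>\<^sup>2 * f x) * cos (\<nu> * (x - a))"])
      have "continuous_on {a..y} f" "continuous_on {a..y} g"
        using continuous_on_subset[OF piecewise_C2D(3)[OF C2]] continuous_on_subset[OF piecewise_C2D(2)[OF C2]] y by auto
      then show "continuous_on {a..y} ?G" by (intro continuous_intros)
      fix x assume x: "a < x" "x < y" "x \<notin> S"
      then have "(f has_real_derivative g x) (at x)" "(g has_real_derivative h x) (at x)"
        using S(2)[of x] y piecewise_C2D(4)[OF C2, of x] by auto
      then show "(?G has_real_derivative (h x + \<nu>\<^sup>2 * f x) * cos (\<nu> * (x - a))) (at x)"
        by (auto intro!: derivative_eq_intros simp: algebra_simps power2_eq_square)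
      show "0 \<le> (h x + \<nu>\<^sup>2 * f x) * cos (\<nu> * (x - a))"
        using h[of x] cos_pos[of x] x y by (intro mult_nonneg_nonneg) auto
    qed
    with ga show ?thesis by simp
  qed
  let ?F = "\<lambda>x. f x / cos (\<nu> * (x - a))"
  have "?F a \<le> ?F b"
  proof (rule nondecreasing_off_finite[of "{}", OF _ ab, where G' = "\<lambda>x. ?G x / (cos (\<nu> * (x - a)))\<^sup>2"])
    show "continuous_on {a..b} ?F"
      using piecewise_C2D(3)[OF C2] cos_pos by (intro continuous_intros) (auto simp: less_imp_neq[symmetric])
    fix x assume x: "a < x" "x < b"
    have "cos (\<nu> * (x - a)) \<noteq> 0" using cos_pos[of x] x by simp
    with piecewise_C2D(4)[OF C2 x] show "(?F has_real_derivative ?G x / (cos (\<nu> * (x - a)))\<^sup>2) (at x)"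
      by (auto intro!: derivative_eq_intros simp: field_simps power2_eq_square)
    show "0 \<le> ?G x / (cos (\<nu> * (x - a)))\<^sup>2" using W[of x] x by simp
  qed simp
  then show ?thesis using cos_pos[of b] ab by (simp add: field_simps)
qed

text \<open>
  A quarter-wave is needed to come down from a maximum to zero; coming down to the fraction \<open>\<eta>\<close> of the
  maximum needs a piece \<open>arccos \<eta>\<close> of the phase.
\<close>

lemma descent_length:
  assumes C2: "piecewise_C2 a b f g h" and ab: "a \<le> b" and \<nu>: "0 < \<nu>"
    and h: "\<And>x. a < x \<Longrightarrow> x < b \<Longrightarrow> - \<nu>\<^sup>2 * f x \<le> h x" and ga: "g a = 0"
    and fa: "0 < f a" and fb: "f b \<le> \<eta> * f a" and \<eta>: "0 \<le> \<eta>" "\<eta> \<le> 1"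
  shows "arccos \<eta> \<le> \<nu> * (b - a)"
proof (rule ccontr)
  assume "\<not> arccos \<eta> \<le> \<nu> * (b - a)"
  then have lt: "\<nu> * (b - a) < arccos \<eta>" by simp
  then have "\<nu> * (b - a) < pi / 2" using arccos_le_pi2[OF \<eta>] by linarith
  from cosine_comparison[OF C2 ab \<nu> this h ga] have "f a * cos (\<nu> * (b - a)) \<le> f b" by simp
  with fb have "f a * cos (\<nu> * (b - a)) \<le> f a * \<eta>" by (simp add: mult.commute)
  then have "cos (\<nu> * (b - a)) \<le> \<eta>" using fa by simp
  moreover have "cos (arccos \<eta>) < cos (\<nu> * (b - a))"
    using lt ab \<nu> \<eta> arccos_le_pi2[OF \<eta>] pi_gt_zero
    by (intro cos_monotone_0_pi) (auto intro: order_trans[of _ "pi / 2"])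
  ultimately show False using \<eta> by simp
qed

text \<open>
  Take the nearest low points on both sides of \<open>x\<close>. If they were further apart than \<open>m + 1\<close>, then \<open>m\<close>
  whole cells would fit strictly between them, and these cells contain another low point.
  Working with low points instead of barriers gives the optimal distance even if \<open>x\<close> itself lies in
  a barrier.
\<close>

lemma enclosing_low_points:
  fixes f :: "real \<Rightarrow> real" and L m :: nat
  assumes cont: "continuous_on {0..real L} f" and bc: "f 0 \<le> \<eta>" "f (real L) \<le> \<eta>"
    and low: "\<And>n. n + m \<le> L \<Longrightarrow> \<exists>z\<in>{real n..real (n + m)}. f z \<le> \<eta>"
    and x: "x \<in> {0..real L}"
  obtains p q where "0 \<le> p" "p \<le> x" "x \<le> q" "q \<le> real L" "f p \<le> \<eta>" "f q \<le> \<eta>" "q - p \<le> real m + 1"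
proof -
  have comp: "compact {z \<in> {a..b}. f z \<le> \<eta>}" if "0 \<le> a" "b \<le> real L" for a b
  proof -
    have "continuous_on {a..b} f" using cont that by (auto elim!: continuous_on_subset)
    then have "closed ({a..b} \<inter> f -` {..\<eta>})" by (rule continuous_closed_preimage) auto
    then have "compact ({a..b} \<inter> ({a..b} \<inter> f -` {..\<eta>}))" by (intro compact_Int_closed) auto
    moreover have "{a..b} \<inter> ({a..b} \<inter> f -` {..\<eta>}) = {z \<in> {a..b}. f z \<le> \<eta>}" by auto
    ultimately show ?thesis by simp
  qed
  have "{z \<in> {0..x}. f z \<le> \<eta>} \<noteq> {}" using bc x by auto
  then obtain p where p: "p \<in> {0..x}" "f p \<le> \<eta>" and pmax: "\<And>z. z \<in> {0..x} \<Longrightarrow> f z \<le> \<eta> \<Longrightarrow> z \<le> p"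
    using compact_attains_sup[OF comp[of 0 x]] x by auto
  have "{z \<in> {x..real L}. f z \<le> \<eta>} \<noteq> {}" using bc x by auto
  then obtain q where q: "q \<in> {x..real L}" "f q \<le> \<eta>" and qmin: "\<And>z. z \<in> {x..real L} \<Longrightarrow> f z \<le> \<eta> \<Longrightarrow> q \<le> z"
    using compact_attains_inf[OF comp[of x "real L"]] x by auto
  have "q - p \<le> real m + 1"
  proof (rule ccontr)
    assume far: "\<not> q - p \<le> real m + 1"
    define n where "n = nat (\<lfloor>p\<rfloor> + 1)"
    have n: "p < real n" "real n \<le> p + 1" using p by (auto simp: n_def)
    then have "real (n + m) < q" using far by simp
    then have "n + m \<le> L" using q(1) by (simp flip: of_nat_le_iff)
    from low[OF this] obtain z where z: "z \<in> {real n..real (n + m)}" "f z \<le> \<eta>" by blast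
    have "p < z" "z < q" using z n \<open>real (n + m) < q\<close> by auto
    then show False using pmax[of z] qmin[of z] z p q by (cases "z \<le> x") auto
  qed
  then show ?thesis using that[of p q] p q by auto
qed

section \<open>Initial value problems with a piecewise constant coefficient\<close>

text \<open>
  The power series of \<open>cosh (sqrt z)\<close> for \<open>j = 0\<close> and of \<open>sinh (sqrt z) / sqrt z\<close> for \<open>j = 1\<close>. It is
  entire in \<open>z\<close>, which spares the distinction between negative, zero and positive coefficients.
\<close>

definition even_step_series :: "nat \<Rightarrow> real \<Rightarrow> real" where
  "even_step_series j z = (\<Sum>n. 1 / fact (2 * n + j) * z ^ n)"

lemma summable_even_step_series: "summable (\<lambda>n. 1 / fact (2 * n + j) * z ^ n :: real)"
proof (rule summable_comparison_test')
  show "summable (\<lambda>n. inverse (fact n) * \<bar>z\<bar> ^ n)" by (rule summable_exp)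
  show "norm (1 / fact (2 * n + j) * z ^ n) \<le> inverse (fact n) * \<bar>z\<bar> ^ n" for n
  proof -
    have "(fact n :: real) \<le> fact (2 * n + j)" by (intro fact_mono) auto
    then have "1 / fact (2 * n + j) \<le> inverse (fact n :: real)" by (simp add: field_simps)
    then have "1 / fact (2 * n + j) * \<bar>z\<bar> ^ n \<le> inverse (fact n) * \<bar>z\<bar> ^ n" by (rule mult_right_mono) simp
    then show ?thesis by (simp add: abs_mult power_abs)
  qed
qed

lemma isCont_even_step_series: "isCont (even_step_series j) z"
  unfolding even_step_series_def
  by (rule isCont_powser_converges_everywhere[OF summable_even_step_series])

text \<open>
  Comparison of coefficients: \<open>(j + 1 + 2n) / (2n + j + 1)! = 1 / (2n + j)!\<close>.
\<close>

lemma even_step_series_derivative: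
  obtains D where "(even_step_series (Suc j) has_real_derivative D) (at z)"
    and "real (Suc j) * even_step_series (Suc j) z + 2 * z * D = even_step_series j z"
proof
  let ?c = "\<lambda>n. 1 / fact (2 * n + Suc j) :: real"
  let ?D = "\<Sum>n. diffs ?c n * z ^ n"
  show "(even_step_series (Suc j) has_real_derivative ?D) (at z)"
    unfolding even_step_series_def
    by (rule termdiffs_strong_converges_everywhere[OF summable_even_step_series])
  have "summable (\<lambda>n. diffs ?c n * z ^ n)"
    by (rule termdiff_converges_all[OF summable_even_step_series])
  then have "(\<lambda>n. z * (diffs ?c n * z ^ n)) sums (z * ?D)"
    by (intro sums_mult summable_sums)
  then have "(\<lambda>n. (\<lambda>n. real n * ?c n * z ^ n) (Suc n)) sums (z * ?D)"
    by (simp add: diffs_def algebra_simps)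
  then have 1: "(\<lambda>n. real n * ?c n * z ^ n) sums (z * ?D)"
    by (subst (asm) sums_Suc_iff) simp
  have 2: "(\<lambda>n. ?c n * z ^ n) sums even_step_series (Suc j) z"
    unfolding even_step_series_def by (intro summable_sums summable_even_step_series)
  have "(\<lambda>n. real (Suc j) * (?c n * z ^ n) + 2 * (real n * ?c n * z ^ n)) sums
      (real (Suc j) * even_step_series (Suc j) z + 2 * (z * ?D))"
    by (intro sums_add sums_mult 1 2)
  moreover have "real (Suc j) * (?c n * z ^ n) + 2 * (real n * ?c n * z ^ n) = 1 / fact (2 * n + j) * z ^ n" for n
  proof -
    have "(fact (2 * n + Suc j) :: real) = real (2 * n + Suc j) * fact (2 * n + j)" by simp
    then have "real (2 * n + Suc j) * ?c n = 1 / fact (2 * n + j)"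
      by (simp add: divide_simps del: of_nat_add of_nat_Suc)
    then have "(real (Suc j) + 2 * real n) * ?c n = 1 / fact (2 * n + j)" by (simp add: algebra_simps)
    then show ?thesis by (simp only: flip: distrib_right mult.assoc)
  qed
  ultimately show "real (Suc j) * even_step_series (Suc j) z + 2 * z * ?D = even_step_series j z"
    unfolding even_step_series_def by (simp add: sums_iff)
qed

text \<open>
  With \<open>j = 0\<close> and \<open>j = 1\<close> these are the two fundamental solutions of \<open>f'' = q f\<close>, and \<open>j = 2\<close> is
  the solution of \<open>f'' = q f + 1\<close> with zero initial data.
\<close>

definition propagator :: "nat \<Rightarrow> real \<Rightarrow> real \<Rightarrow> real" where
  "propagator j q t = t ^ j * even_step_series j (q * t\<^sup>2)"

lemma propagator_Suc_derivative:
  "(propagator (Suc j) q has_real_derivative propagator j q t) (at t)"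
proof -
  obtain D where D: "(even_step_series (Suc j) has_real_derivative D) (at (q * t\<^sup>2))"
    and eq: "real (Suc j) * even_step_series (Suc j) (q * t\<^sup>2) + 2 * (q * t\<^sup>2) * D = even_step_series j (q * t\<^sup>2)"
    by (rule even_step_series_derivative)
  have "((\<lambda>t. q * t\<^sup>2) has_real_derivative q * (2 * t)) (at t)"
    by (auto intro!: derivative_eq_intros)
  from DERIV_chain2[OF D this]
  have "((\<lambda>t. even_step_series (Suc j) (q * t\<^sup>2)) has_real_derivative D * (q * (2 * t))) (at t)" .
  then have "((\<lambda>t. t ^ Suc j * even_step_series (Suc j) (q * t\<^sup>2)) has_real_derivative
      t ^ Suc j * (D * (q * (2 * t))) + real (Suc j) * t ^ j * even_step_series (Suc j) (q * t\<^sup>2)) (at t)"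
    by (auto intro!: derivative_eq_intros simp del: power_Suc)
  also have "t ^ Suc j * (D * (q * (2 * t))) + real (Suc j) * t ^ j * even_step_series (Suc j) (q * t\<^sup>2) =
      propagator j q t"
    unfolding propagator_def eq[symmetric] by (simp add: algebra_simps power2_eq_square)
  finally show ?thesis by (simp add: propagator_def[abs_def])
qed

lemma propagator_shift: "propagator j q t = t ^ j / fact j + q * propagator (Suc (Suc j)) q t"
proof -
  have "even_step_series j z = 1 / fact j + z * even_step_series (Suc (Suc j)) z" for z
  proof -
    have "(\<lambda>n. z * (1 / fact (2 * n + Suc (Suc j)) * z ^ n)) sums (z * even_step_series (Suc (Suc j)) z)"
      unfolding even_step_series_def by (intro sums_mult summable_sums summable_even_step_series)
    then have "(\<lambda>n. (\<lambda>n. 1 / fact (2 * n + j) * z ^ n) (Suc n)) sums (z * even_step_series (Suc (Suc j)) z)"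
      by (simp add: algebra_simps)
    then show ?thesis
      unfolding even_step_series_def by (subst (asm) sums_Suc_iff) (simp add: sums_iff)
  qed
  from this[of "q * t\<^sup>2"] show ?thesis
    by (simp add: propagator_def algebra_simps power2_eq_square)
qed

lemma propagator_0_derivative: "(propagator 0 q has_real_derivative q * propagator 1 q t) (at t)"
proof -
  have "propagator 0 q = (\<lambda>t. 1 + q * propagator (Suc (Suc 0)) q t)"
    using propagator_shift[of 0 q] by auto
  then show ?thesis
    using propagator_Suc_derivative[of "Suc 0" q t] by (auto intro!: derivative_eq_intros)
qed

lemma propagator_at_0 [simp]: "propagator 0 q 0 = 1" "propagator (Suc j) q 0 = 0"
  using propagator_shift[of 0 q 0] by (auto simp: propagator_def)

lemma continuous_on_propagator [continuous_intros]:
  assumes "continuous_on A a" "continuous_on A b"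
  shows "continuous_on A (\<lambda>x. propagator j (a x) (b x))"
proof -
  have "continuous_on UNIV (even_step_series j)"
    by (simp add: continuous_at_imp_continuous_on isCont_even_step_series)
  moreover have "continuous_on A (\<lambda>x. a x * (b x)\<^sup>2)" using assms by (intro continuous_intros)
  ultimately have "continuous_on A (\<lambda>x. even_step_series j (a x * (b x)\<^sup>2))"
    by (rule continuous_on_compose2) simp
  then show ?thesis unfolding propagator_def using assms by (intro continuous_intros)
qed

text \<open>
  Induction on the number of cells: the values and slopes at the end of a cell are the initial data
  for the next one. The continuity in the energy \<open>E\<close> and the position jointly is what the
  existence proof for the ground state needs; the constant inhomogeneity \<open>c\<close> serves the landscape
  function.
\<close>

lemma shooting_solutions:
  fixes Q :: "int \<Rightarrow> real" and L :: nat
  shows "\<exists>f g :: real \<Rightarrow> real \<Rightarrow> real.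
    (\<forall>E. f E 0 = 0 \<and> g E 0 = s \<and> piecewise_C2 0 (real L) (f E) (g E) (\<lambda>x. (Q \<lfloor>x\<rfloor> - E) * f E x + c)) \<and>
    continuous_on (UNIV \<times> {0..real L}) (\<lambda>y. f (fst y) (snd y)) \<and>
    continuous_on (UNIV \<times> {0..real L}) (\<lambda>y. g (fst y) (snd y))"
proof (induction L)
  case 0
  show ?case
    by (rule exI[of _ "\<lambda>_ x. s * x"], rule exI[of _ "\<lambda>_ _. s"])
       (auto simp: piecewise_C2_def intro!: continuous_intros derivative_eq_intros)
next
  case (Suc L)
  then obtain f g :: "real \<Rightarrow> real \<Rightarrow> real" where
    init: "\<And>E. f E 0 = 0" "\<And>E. g E 0 = s"
    and C2: "\<And>E. piecewise_C2 0 (real L) (f E) (g E) (\<lambda>x. (Q \<lfloor>x\<rfloor> - E) * f E x + c)"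
    and cont: "continuous_on (UNIV \<times> {0..real L}) (\<lambda>y. f (fst y) (snd y))"
      "continuous_on (UNIV \<times> {0..real L}) (\<lambda>y. g (fst y) (snd y))" by blast
  define q where "q E = Q (int L) - E" for E
  define f1 where "f1 E x = f E L * propagator 0 (q E) (x - L) + g E L * propagator 1 (q E) (x - L)
    + c * propagator 2 (q E) (x - L)" for E x :: real
  define g1 where "g1 E x = f E L * (q E * propagator 1 (q E) (x - L)) + g E L * propagator 0 (q E) (x - L)
    + c * propagator 1 (q E) (x - L)" for E x :: real
  let ?f = "\<lambda>E x. if x \<le> real L then f E x else f1 E x"
  let ?g = "\<lambda>E x. if x \<le> real L then g E x else g1 E x"
  have at_L: "f1 E L = f E L" "g1 E L = g E L" for E
    by (simp_all add: f1_def g1_def numeral_2_eq_2)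
  have shift: "((\<lambda>x. F (x - real L)) has_real_derivative D) (at x)"
    if "(F has_real_derivative D) (at (x - real L))" for F D and x :: real
    using DERIV_shift[of F D x "- real L"] that by simp
  have 1: "(f1 E has_real_derivative g1 E x) (at x)" for E x :: real
    unfolding f1_def[abs_def] g1_def
    using shift[OF propagator_0_derivative, of "q E" x] shift[OF propagator_Suc_derivative, of 0 "q E" x]
      shift[OF propagator_Suc_derivative, of 1 "q E" x]
    by (auto intro!: derivative_eq_intros simp: numeral_2_eq_2)
  have 2: "(g1 E has_real_derivative q E * f1 E x + c) (at x)" for E x :: real
    unfolding f1_def[abs_def] g1_def[abs_def]
    using shift[OF propagator_0_derivative, of "q E" x] shift[OF propagator_Suc_derivative, of 0 "q E" x]
      propagator_shift[of 0 "q E" "x - real L"]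
    by (auto intro!: derivative_eq_intros simp: numeral_2_eq_2 algebra_simps)
  have C2': "piecewise_C2 0 (real (Suc L)) (?f E) (?g E) (\<lambda>x. (Q \<lfloor>x\<rfloor> - E) * ?f E x + c)" for E
  proof (rule piecewise_C2_join[of _ "real L"])
    show "piecewise_C2 0 (real L) (?f E) (?g E) (\<lambda>x. (Q \<lfloor>x\<rfloor> - E) * ?f E x + c)"
      by (rule piecewise_C2_cong[OF C2, where T = "{}"]) auto
    have cell: "\<lfloor>x\<rfloor> = int L" if "real L < x" "x < 1 + real L" for x
      using that by (intro floor_unique) auto
    show "piecewise_C2 (real L) (real (Suc L)) (?f E) (?g E) (\<lambda>x. (Q \<lfloor>x\<rfloor> - E) * ?f E x + c)"
      by (rule piecewise_C2_cong[OF piecewise_C2_smooth[OF 1 2], where T = "{}"])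
         (auto simp: at_L cell q_def[symmetric] less_le)
  qed auto
  have pair: "continuous_on UNIV (\<lambda>E::real. (E, real L))" by (intro continuous_intros)
  have ran: "range (\<lambda>E::real. (E, real L)) \<subseteq> UNIV \<times> {0..real L}" by (rule image_subsetI) simp
  have contL: "continuous_on UNIV (\<lambda>E. f E L)" "continuous_on UNIV (\<lambda>E. g E L)"
    using continuous_on_compose2[OF cont(1) pair ran] continuous_on_compose2[OF cont(2) pair ran] by simp_all
  have contL': "continuous_on A (\<lambda>y. f (fst y) L)" "continuous_on A (\<lambda>y. g (fst y) L)" for A :: "(real \<times> real) set"
    by (rule continuous_on_compose2[OF contL(1)] continuous_on_compose2[OF contL(2)], auto intro!: continuous_intros)+
  have "continuous_on (UNIV \<times> {0..real (Suc L)}) (\<lambda>y. ?f (fst y) (snd y))"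
  proof (rule continuous_on_cases_le)
    show "continuous_on {t \<in> UNIV \<times> {0..real (Suc L)}. snd t \<le> real L} (\<lambda>y. f (fst y) (snd y))"
      by (rule continuous_on_subset[OF cont(1)]) auto
    show "continuous_on {t \<in> UNIV \<times> {0..real (Suc L)}. real L \<le> snd t} (\<lambda>y. f1 (fst y) (snd y))"
      unfolding f1_def q_def by (intro continuous_intros contL')
  qed (auto simp: at_L intro!: continuous_intros)
  moreover have "continuous_on (UNIV \<times> {0..real (Suc L)}) (\<lambda>y. ?g (fst y) (snd y))"
  proof (rule continuous_on_cases_le)
    show "continuous_on {t \<in> UNIV \<times> {0..real (Suc L)}. snd t \<le> real L} (\<lambda>y. g (fst y) (snd y))"
      by (rule continuous_on_subset[OF cont(2)]) auto
    show "continuous_on {t \<in> UNIV \<times> {0..real (Suc L)}. real L \<le> snd t} (\<lambda>y. g1 (fst y) (snd y))"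
      unfolding g1_def q_def by (intro continuous_intros contL')
  qed (auto simp: at_L intro!: continuous_intros)
  moreover have "\<forall>E. ?f E 0 = 0 \<and> ?g E 0 = s \<and>
      piecewise_C2 0 (real (Suc L)) (?f E) (?g E) (\<lambda>x. (Q \<lfloor>x\<rfloor> - E) * ?f E x + c)"
    using C2' init by simp
  ultimately show ?case by (intro exI[of _ ?f] exI[of _ ?g] conjI)
qed

section \<open>Weak and classical solutions for a cell potential\<close>

text \<open>
  Exactly one translate of the unit cell contains \<open>x\<close>.
\<close>

lemma anderson_potential_eq: "anderson_potential w x = w \<lfloor>x\<rfloor>"
proof -
  have "anderson_potential w x = (\<Sum>\<^sub>\<infinity>j\<in>{\<lfloor>x\<rfloor>}. w j)"
    unfolding anderson_potential_def
  proof (rule infsum_cong_neutral)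
    fix j assume "j \<in> UNIV - {\<lfloor>x\<rfloor>}"
    then have "x - of_int j \<notin> {0..<1}" using floor_unique[of j x] by auto
    then show "w j * indicator {0..<1} (x - of_int j) = 0" by simp
  qed (auto simp: indicator_def, linarith)
  then show ?thesis by simp
qed

lemma step_bounded:
  fixes W :: "int \<Rightarrow> real" and L :: nat
  obtains K where "0 \<le> K" "\<And>x. x \<in> {0..real L} \<Longrightarrow> \<bar>W \<lfloor>x\<rfloor>\<bar> \<le> K"
proof
  let ?K = "Max ((\<lambda>j. \<bar>W j\<bar>) ` {0..int L})"
  have le: "\<bar>W j\<bar> \<le> ?K" if "j \<in> {0..int L}" for j using that by (intro Max_ge) auto
  show "\<bar>W \<lfloor>x\<rfloor>\<bar> \<le> ?K" if "x \<in> {0..real L}" for x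
    using that by (intro le) (auto simp: floor_le_iff)
  show "0 \<le> ?K" by (rule order_trans[OF abs_ge_zero le[of 0]]) simp
qed

lemma set_integrable_step_times_continuous:
  fixes W :: "int \<Rightarrow> real" and L :: nat
  assumes "continuous_on {0..real L} f"
  shows "set_integrable lborel {0..real L} (\<lambda>x. indicator {0..real L} x * (W \<lfloor>x\<rfloor> * f x - e))"
    and "set_integrable lborel {0..real L} (\<lambda>x. (indicator {0..real L} x * (W \<lfloor>x\<rfloor> * f x - e))\<^sup>2)"
proof -
  let ?h = "\<lambda>x. indicator {0..real L} x * (W \<lfloor>x\<rfloor> * f x - e)"
  have "(\<lambda>x. indicator {0..real L} x *\<^sub>R f x) \<in> borel_measurable borel"
    by (rule borel_measurable_continuous_on_indicator) (use assms in auto)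
  moreover have "(\<lambda>x::real. W \<lfloor>x\<rfloor>) \<in> borel_measurable borel"
    by (rule measurable_compose[OF measurable_real_floor]) simp
  ultimately have "(\<lambda>x. W \<lfloor>x\<rfloor> * (indicator {0..real L} x *\<^sub>R f x) - e * indicator {0..real L} x) \<in> borel_measurable borel"
    by measurable
  also have "(\<lambda>x. W \<lfloor>x\<rfloor> * (indicator {0..real L} x *\<^sub>R f x) - e * indicator {0..real L} x) = ?h"
    by (auto simp: algebra_simps)
  finally have meas: "?h \<in> borel_measurable borel" .
  obtain K where K: "0 \<le> K" "\<And>x. x \<in> {0..real L} \<Longrightarrow> \<bar>W \<lfloor>x\<rfloor>\<bar> \<le> K"
    using step_bounded by blast
  have "compact (f ` {0..real L})" using assms by (intro compact_continuous_image) auto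
  then obtain B where B: "\<And>x. x \<in> {0..real L} \<Longrightarrow> \<bar>f x\<bar> \<le> B"
    using compact_imp_bounded bounded_iff by (metis imageI real_norm_def)
  have bound: "\<bar>?h x\<bar> \<le> K * B + \<bar>e\<bar>" if x: "x \<in> {0..real L}" for x
  proof -
    have "\<bar>W \<lfloor>x\<rfloor> * f x\<bar> \<le> K * B" unfolding abs_mult
      using K B x by (intro mult_mono) auto
    then show ?thesis using x by simp
  qed
  show "set_integrable lborel {0..real L} ?h" unfolding set_integrable_def
    by (rule integrableI_bounded_set_indicator[where B = "K * B + \<bar>e\<bar>"])
       (use meas bound in auto)
  show "set_integrable lborel {0..real L} (\<lambda>x. (?h x)\<^sup>2)" unfolding set_integrable_def
  proof (rule integrableI_bounded_set_indicator[where B = "(K * B + \<bar>e\<bar>)\<^sup>2"])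
    show "AE x in lborel. x \<in> {0..real L} \<longrightarrow> norm ((?h x)\<^sup>2) \<le> (K * B + \<bar>e\<bar>)\<^sup>2"
      using power_mono[OF bound, of _ 2] by (intro AE_I2) (simp add: power2_abs)
  qed (use meas in auto)
qed

text \<open>
  For a cell potential the weak second derivative is almost everywhere equal to a function that is
  continuous off the integers, so that \<open>f'\<close> as its indefinite integral is differentiable there.
  With \<open>e = 0\<close> this covers the eigenvalue equation, with \<open>E = 0\<close> and \<open>e = 1\<close> the landscape equation.
\<close>

lemma dirichlet_solution_iff_piecewise_C2:
  fixes W :: "int \<Rightarrow> real" and L :: nat
  shows "dirichlet_solution (real L) (\<lambda>x. W \<lfloor>x\<rfloor>) f (\<lambda>x. E * f x + e) \<longleftrightarrow>
    f 0 = 0 \<and> f (real L) = 0 \<and> (\<exists>g. piecewise_C2 0 (real L) f g (\<lambda>x. (W \<lfloor>x\<rfloor> - E) * f x - e))"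
proof
  let ?h = "\<lambda>x. indicator {0..real L} x * ((W \<lfloor>x\<rfloor> - E) * f x - e)"
  {
    assume "dirichlet_solution (real L) (\<lambda>x. W \<lfloor>x\<rfloor>) f (\<lambda>x. E * f x + e)"
    then obtain h g where bc: "f 0 = 0" "f (real L) = 0"
      and int: "set_integrable lborel {0..real L} h"
      and AE: "AE x in lborel. x \<in> {0<..<real L} \<longrightarrow> - h x + W \<lfloor>x\<rfloor> * f x = E * f x + e"
      and f: "\<And>x. x \<in> {0..real L} \<Longrightarrow> (f has_real_derivative g x) (at x within {0..real L})"
      and g: "\<And>x. x \<in> {0..real L} \<Longrightarrow> g x = g 0 + (LBINT t:{0..x}. h t)"
      unfolding dirichlet_solution_def has_H2_derivative_def by blast
    have contf: "continuous_on {0..real L} f" using f by (rule DERIV_continuous_on)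
    note int' = set_integrable_step_times_continuous(1)[OF contf, of "\<lambda>j. W j - E" e]
    have g': "g x = g 0 + integral {0..x} ?h" if x: "x \<in> {0..real L}" for x
    proof -
      have sub: "{0..x} \<subseteq> {0..real L}" using x by auto
      have i1: "set_integrable lborel {0..x} h" and i2: "set_integrable lborel {0..x} ?h"
        using set_integrable_subset[OF int _ sub] set_integrable_subset[OF int' _ sub] by auto
      have "(LBINT t:{0..x}. h t) = (LBINT t:{0..x}. ?h t)"
        unfolding set_lebesgue_integral_def
      proof (rule integral_cong_AE)
        show "AE t in lborel. indicator {0..x} t *\<^sub>R h t = indicator {0..x} t *\<^sub>R ?h t"
          using AE AE_lborel_singleton[of 0] AE_lborel_singleton[of "real L"]
        proof eventually_elim
          case (elim t)
          then show ?case using x by (auto simp: indicator_def algebra_simps)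
        qed
      qed (use i1 i2 in \<open>auto simp: set_integrable_def\<close>)
      also have "\<dots> = integral {0..x} ?h" by (rule set_borel_integral_eq_integral(2)[OF i2])
      finally show ?thesis using g[OF x] by simp
    qed
    have HK: "?h integrable_on {0..real L}" by (rule set_borel_integral_eq_integral(1)[OF int'])
    have "piecewise_C2 0 (real L) f g (\<lambda>x. (W \<lfloor>x\<rfloor> - E) * f x - e)"
      unfolding piecewise_C2_def
    proof (intro conjI ballI exI[of _ "{x \<in> \<int>. 0 \<le> x \<and> x \<le> real L}"] f)
      have "continuous_on {0..real L} (\<lambda>x. g 0 + integral {0..x} ?h)"
        by (intro continuous_intros indefinite_integral_continuous_1 HK)
      then show "continuous_on {0..real L} g" by (rule continuous_on_eq) (rule g'[symmetric])
      show "finite {x \<in> \<int>. 0 \<le> x \<and> x \<le> real L}" by (rule finite_int_segment)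
      fix x assume "x \<in> {0<..<real L} - {x \<in> \<int>. 0 \<le> x \<and> x \<le> real L}"
      then have x: "0 < x" "x < real L" "x \<notin> \<int>" by auto
      have isf: "isCont f x"
        using f[of x] x by (auto simp: at_within_Icc_at intro: DERIV_isCont)
      have "isCont (\<lambda>y. (W \<lfloor>x\<rfloor> - E) * f y - e) x" using isf by (intro continuous_intros)
      moreover have "eventually (\<lambda>y. ?h y = (W \<lfloor>x\<rfloor> - E) * f y - e) (nhds x)"
      proof -
        have "eventually (\<lambda>y. \<lfloor>y\<rfloor> = \<lfloor>x\<rfloor>) (nhds x)"
          by (rule eventually_floor_eq) (use x in \<open>auto intro: filterlim_ident\<close>)
        moreover have "eventually (\<lambda>y. y \<in> {0<..<real L}) (nhds x)"
          by (rule eventually_nhds_in_open) (use x in auto)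
        ultimately show ?thesis by eventually_elim auto
      qed
      ultimately have "isCont ?h x" by (simp only: isCont_cong)
      then have "continuous (at x within {0..real L} - {}) ?h"
        by (rule continuous_at_imp_continuous_at_within)
      then have "((\<lambda>u. integral {0..u} ?h) has_vector_derivative ?h x) (at x within {0..real L} - {})"
        using x by (intro integral_has_vector_derivative_continuous_at HK) auto
      then have "((\<lambda>u. integral {0..u} ?h) has_real_derivative ?h x) (at x)"
        using x by (simp add: has_real_derivative_iff_has_vector_derivative at_within_Icc_at)
      then have "((\<lambda>u. g 0 + integral {0..u} ?h) has_real_derivative (W \<lfloor>x\<rfloor> - E) * f x - e) (at x)"
        using x by (auto intro!: derivative_eq_intros)
      then show "(g has_real_derivative (W \<lfloor>x\<rfloor> - E) * f x - e) (at x)"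
      proof (rule has_field_derivative_transform_within_open[of _ _ _ "{0<..<real L}"])
        show "g 0 + integral {0..y} ?h = g y" if "y \<in> {0<..<real L}" for y
          by (rule g'[symmetric]) (use that in auto)
      qed (use x in auto)
    qed
    with bc show "f 0 = 0 \<and> f (real L) = 0 \<and> (\<exists>g. piecewise_C2 0 (real L) f g (\<lambda>x. (W \<lfloor>x\<rfloor> - E) * f x - e))"
      by blast
  next
    assume "f 0 = 0 \<and> f (real L) = 0 \<and> (\<exists>g. piecewise_C2 0 (real L) f g (\<lambda>x. (W \<lfloor>x\<rfloor> - E) * f x - e))"
    then obtain g where bc: "f 0 = 0" "f (real L) = 0"
      and C2: "piecewise_C2 0 (real L) f g (\<lambda>x. (W \<lfloor>x\<rfloor> - E) * f x - e)" by blast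
    obtain S where S: "finite S" "\<And>x. 0 < x \<Longrightarrow> x < real L \<Longrightarrow> x \<notin> S \<Longrightarrow>
        (g has_real_derivative (W \<lfloor>x\<rfloor> - E) * f x - e) (at x)"
      using piecewise_C2_exceptional[OF C2] by blast
    note contf = piecewise_C2D(3)[OF C2]
    note int = set_integrable_step_times_continuous[OF contf, of "\<lambda>j. W j - E" e]
    have "has_H2_derivative (real L) f ?h" unfolding has_H2_derivative_def
    proof (intro conjI exI[of _ g] ballI int)
      fix x assume x: "x \<in> {0..real L}"
      then show "(f has_real_derivative g x) (at x within {0..real L})" by (rule piecewise_C2D(1)[OF C2])
      have sub: "{0..x} \<subseteq> {0..real L}" using x by auto
      have "(?h has_integral (g x - g 0)) {0..x}"
      proof (rule fundamental_theorem_of_calculus_interior_strong[OF S(1)])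
        show "continuous_on {0..x} g" using continuous_on_subset[OF piecewise_C2D(2)[OF C2] sub] .
        show "(g has_vector_derivative ?h y) (at y)" if "y \<in> {0<..<x} - S" for y
          using S(2)[of y] that x by (auto simp: has_real_derivative_iff_has_vector_derivative)
      qed (use x in auto)
      moreover have "(LBINT t:{0..x}. ?h t) = integral {0..x} ?h"
        by (rule set_borel_integral_eq_integral(2)[OF set_integrable_subset[OF int(1) _ sub]]) simp
      ultimately show "g x = g 0 + (LBINT t:{0..x}. ?h t)" by (simp add: integral_unique)
    qed
    moreover have "AE x in lborel. x \<in> {0<..<real L} \<longrightarrow> - ?h x + W \<lfloor>x\<rfloor> * f x = E * f x + e"
      by (intro AE_I2) (auto simp: algebra_simps)
    ultimately show "dirichlet_solution (real L) (\<lambda>x. W \<lfloor>x\<rfloor>) f (\<lambda>x. E * f x + e)"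
      unfolding dirichlet_solution_def using bc by blast
  }
qed

section \<open>Ground state and landscape function\<close>

text \<open>
  A zero would make the solution vanish up to there by \<open>dirichlet_energy_trivial\<close>, against the
  initial slope \<open>1\<close>.
\<close>

lemma shooting_positive:
  assumes C2: "piecewise_C2 0 b f g h" and h: "\<And>x. 0 < x \<Longrightarrow> x < b \<Longrightarrow> 0 \<le> f x * h x"
    and init: "f 0 = 0" "g 0 = 1" and x: "0 < x" "x \<le> b"
  shows "f x \<noteq> 0"
proof
  assume "f x = 0"
  have zero: "f y = 0" if "y \<in> {0..x}" for y
    by (rule dirichlet_energy_trivial[OF piecewise_C2_subinterval[OF C2 order_refl x(2)]])
       (use h init x \<open>f x = 0\<close> that in auto)
  have "((\<lambda>_. 0) has_real_derivative g 0) (at 0 within {0..x})"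
  proof (rule has_field_derivative_transform_within[of f _ _ _ x])
    show "(f has_real_derivative g 0) (at 0 within {0..x})"
      using piecewise_C2D(1)[OF piecewise_C2_subinterval[OF C2 order_refl x(2)]] x by auto
  qed (use x zero in auto)
  moreover have "((\<lambda>_. 0 :: real) has_real_derivative 0) (at 0 within {0..x})" by simp
  ultimately have "g 0 = 0"
    using vector_derivative_unique_within_closed_interval[of 0 x 0 "\<lambda>_. 0" "g 0" 0] x
    by (auto simp: has_real_derivative_iff_has_vector_derivative)
  with init show False by simp
qed

lemma dirichlet_eigenvalue_iff:
  fixes W :: "int \<Rightarrow> real" and L :: nat
  shows "dirichlet_eigenvalue (real L) (\<lambda>x. W \<lfloor>x\<rfloor>) E \<longleftrightarrow>
    (\<exists>f g. f 0 = 0 \<and> f (real L) = 0 \<and> piecewise_C2 0 (real L) f g (\<lambda>x. (W \<lfloor>x\<rfloor> - E) * f x)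
      \<and> (\<exists>x\<in>{0..real L}. f x \<noteq> 0))"
  using dirichlet_solution_iff_piecewise_C2[of L W _ E 0] unfolding dirichlet_eigenvalue_def by auto

text \<open>
  Let \<open>E1\<close> be the least energy whose shot \<open>y E1\<close> from the left end has a zero in \<open>(0,L]\<close>. It exists
  by compactness: zeros stay away from \<open>0\<close> because the slope is close to \<open>1\<close> there, and they occur for
  large energies by \<open>sine_comparison\<close>. Below \<open>E1\<close> the shots are positive, hence \<open>y E1 \<ge> 0\<close>, and an interior
  zero would be a double zero, which uniqueness forbids. So the zero is at \<open>L\<close>, which makes \<open>y E1\<close> a
  positive eigenfunction. Every eigenfunction is a multiple of a shot, so no eigenvalue lies below \<open>E1\<close>.
\<close>

lemma ground_state_exists:
  fixes W :: "int \<Rightarrow> real" and L :: nat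
  assumes W: "\<And>j. 0 \<le> W j" and L: "0 < L"
  obtains E f g where "ground_state_eigenvalue (real L) (\<lambda>x. W \<lfloor>x\<rfloor>) = E" "0 < E"
    "f 0 = 0" "f (real L) = 0" "\<And>x. 0 < x \<Longrightarrow> x < real L \<Longrightarrow> 0 < f x"
    "piecewise_C2 0 (real L) f g (\<lambda>x. (W \<lfloor>x\<rfloor> - E) * f x)"
proof -
  obtain y y' :: "real \<Rightarrow> real \<Rightarrow> real" where init: "\<And>E. y E 0 = 0" "\<And>E. y' E 0 = 1"
    and C2: "\<And>E. piecewise_C2 0 (real L) (y E) (y' E) (\<lambda>x. (W \<lfloor>x\<rfloor> - E) * y E x)"
    and cont: "continuous_on (UNIV \<times> {0..real L}) (\<lambda>z. y (fst z) (snd z))"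
      "continuous_on (UNIV \<times> {0..real L}) (\<lambda>z. y' (fst z) (snd z))"
    using shooting_solutions[where s = 1 and c = 0 and Q = W and L = L] by auto
  obtain K where K: "0 \<le> K" "\<And>x. x \<in> {0..real L} \<Longrightarrow> \<bar>W \<lfloor>x\<rfloor>\<bar> \<le> K"
    using step_bounded by blast
  define B where "B = K + (pi / real L)\<^sup>2 + 1"
  have B0: "0 \<le> B" using K(1) by (simp add: B_def)
  \<comment> \<open>the slope stays above \<open>1/2\<close> near the left end, uniformly for energies in \<open>[0,B]\<close>\<close>
  obtain \<delta> where \<delta>: "0 < \<delta>" "\<delta> \<le> real L"
    and near: "\<And>E x. 0 \<le> E \<Longrightarrow> E \<le> B \<Longrightarrow> 0 < x \<Longrightarrow> x \<le> \<delta> \<Longrightarrow> 0 < y E x"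
  proof -
    have "uniformly_continuous_on ({0..B} \<times> {0..real L}) (\<lambda>z. y' (fst z) (snd z))"
      by (rule compact_uniformly_continuous[OF continuous_on_subset[OF cont(2)]])
         (auto intro: compact_Times)
    then obtain d where d: "0 < d" and unif: "\<And>z z'. z \<in> {0..B} \<times> {0..real L} \<Longrightarrow> z' \<in> {0..B} \<times> {0..real L} \<Longrightarrow>
        dist z' z < d \<Longrightarrow> dist (y' (fst z') (snd z')) (y' (fst z) (snd z)) < 1 / 2"
      unfolding uniformly_continuous_on_def by (meson half_gt_zero_iff zero_less_one)
    define \<delta> where "\<delta> = min (d / 2) (real L)"
    have \<delta>: "0 < \<delta>" "\<delta> \<le> real L" "\<delta> < d" using d L by (auto simp: \<delta>_def)
    have "0 < y E x" if E: "0 \<le> E" "E \<le> B" and x: "0 < x" "x \<le> \<delta>" for E x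
    proof -
      have "y E 0 < y E x"
      proof (rule increasing_off_finite[of "{}", OF _ x(1), where G' = "y' E"])
        show "continuous_on {0..x} (y E)"
          by (rule continuous_on_subset[OF piecewise_C2D(3)[OF C2]]) (use x \<delta> in auto)
        fix t assume t: "0 < t" "t < x"
        show "(y E has_real_derivative y' E t) (at t)"
          by (rule piecewise_C2D(4)[OF C2]) (use t x \<delta> in auto)
        have "dist (y' E t) (y' E 0) < 1 / 2"
          using unif[of "(E, 0)" "(E, t)"] E t x \<delta> by (auto simp: dist_Pair_Pair dist_real_def)
        then show "0 < y' E t" using init(2)[of E] by (simp add: dist_real_def abs_if split: if_splits)
      qed simp
      then show ?thesis by (simp add: init)
    qed
    with \<delta> that show ?thesis by blast
  qed
  have contx: "continuous_on {0..real L} (y E)" for E by (rule piecewise_C2D(3)[OF C2])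
  have pos: "0 < y E x" if E: "0 \<le> E" "E \<le> B" and nz: "\<And>z. 0 < z \<Longrightarrow> z \<le> x \<Longrightarrow> y E z \<noteq> 0"
    and x: "0 < x" "x \<le> real L" for E x
  proof (rule ccontr)
    assume neg: "\<not> 0 < y E x"
    define t where "t = min \<delta> x"
    have t: "0 < t" "t \<le> x" "t \<le> \<delta>" using \<delta> x by (auto simp: t_def)
    have "\<exists>z. t \<le> z \<and> z \<le> x \<and> y E z = 0"
    proof (rule IVT2')
      show "continuous_on {t..x} (y E)" by (rule continuous_on_subset[OF contx]) (use t x in auto)
    qed (use neg near[OF E t(1,3)] t in auto)
    with nz t show False by (meson less_le_trans)
  qed
  \<comment> \<open>with energy \<open>B\<close> the shot oscillates faster than the half-wave of length \<open>L\<close>\<close>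
  have "\<exists>x. 0 < x \<and> x \<le> real L \<and> y B x = 0"
  proof (rule ccontr)
    assume "\<not> (\<exists>x. 0 < x \<and> x \<le> real L \<and> y B x = 0)"
    then have p: "\<And>x. 0 < x \<Longrightarrow> x \<le> real L \<Longrightarrow> 0 < y B x" using pos[of B] B0 by force
    have "B - K \<le> (pi / (real L - 0))\<^sup>2"
    proof (rule sine_comparison[OF C2[of B]])
      fix x assume x: "0 < x" "x < real L"
      have "W \<lfloor>x\<rfloor> - B \<le> - (B - K)" using K(2)[of x] x by auto
      then show "(W \<lfloor>x\<rfloor> - B) * y B x \<le> - (B - K) * y B x"
        using p[of x] x by (intro mult_right_mono) auto
    qed (use less_imp_le[OF p[of "real L"]] p L init in auto)
    then show False by (simp add: B_def)
  qed
  then obtain xB where xB: "0 < xB" "xB \<le> real L" "y B xB = 0" by blast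
  \<comment> \<open>all pairs of an energy and a zero; its first coordinate is to be minimized\<close>
  define Z where "Z = ({0..B} \<times> {\<delta>..real L}) \<inter> (\<lambda>z. y (fst z) (snd z)) -` {0}"
  have far: "\<delta> \<le> x" if "0 \<le> E" "E \<le> B" "0 < x" "y E x = 0" for E x
    using near[of E x] that by force
  have "compact Z"
  proof -
    have comp: "compact ({0..B} \<times> {\<delta>..real L})" by (intro compact_Times) auto
    have "closed Z" unfolding Z_def
    proof (rule continuous_closed_preimage)
      show "continuous_on ({0..B} \<times> {\<delta>..real L}) (\<lambda>z. y (fst z) (snd z))"
        by (rule continuous_on_subset[OF cont(1)]) (use \<delta> in auto)
    qed (use comp in \<open>auto intro: compact_imp_closed\<close>)
    then have "compact ({0..B} \<times> {\<delta>..real L} \<inter> Z)" by (rule compact_Int_closed[OF comp])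
    moreover have "{0..B} \<times> {\<delta>..real L} \<inter> Z = Z" by (auto simp: Z_def)
    ultimately show ?thesis by simp
  qed
  moreover have "(B, xB) \<in> Z" using xB far[of B xB] B0 by (simp add: Z_def)
  then have "Z \<noteq> {}" by blast
  moreover have "continuous_on Z fst" by (intro continuous_intros)
  ultimately have "\<exists>z\<in>Z. \<forall>z'\<in>Z. fst z \<le> fst z'" by (rule continuous_attains_inf)
  then obtain z where z: "z \<in> Z" "\<And>z'. z' \<in> Z \<Longrightarrow> fst z \<le> fst z'" by blast
  define E1 where "E1 = fst z"
  define x1 where "x1 = snd z"
  have E1: "0 \<le> E1" "E1 \<le> B" and x1: "\<delta> \<le> x1" "x1 \<le> real L" "y E1 x1 = 0"
    using z(1) by (auto simp: Z_def E1_def x1_def)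
  have least: "E1 \<le> E" if E: "0 \<le> E" and x: "0 < x" "x \<le> real L" "y E x = 0" for E x
  proof (cases "E \<le> B")
    case True
    then have "(E, x) \<in> Z" using far[OF E True x(1,3)] E x by (auto simp: Z_def)
    from z(2)[OF this] show ?thesis by (simp add: E1_def)
  qed (use E1 in simp)
  have E1_pos: "0 < E1"
  proof (rule ccontr)
    assume "\<not> 0 < E1"
    then have "E1 = 0" using E1 by simp
    have "y E1 x1 \<noteq> 0"
    proof (rule shooting_positive[OF C2])
      show "0 \<le> y E1 x * ((W \<lfloor>x\<rfloor> - E1) * y E1 x)" for x
        using W[of "\<lfloor>x\<rfloor>"] \<open>E1 = 0\<close> by (simp add: mult.left_commute)
    qed (use init x1 \<delta> in auto)
    with x1 show False by simp
  qed
  have nonneg: "0 \<le> y E1 x" if x: "0 < x" "x \<le> real L" for x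
  proof (rule tendsto_lowerbound)
    have "continuous_on UNIV (\<lambda>E. y E x)"
    proof -
      have pair: "continuous_on UNIV (\<lambda>E::real. (E, x))" by (intro continuous_intros)
      have ran: "range (\<lambda>E::real. (E, x)) \<subseteq> UNIV \<times> {0..real L}" by (rule image_subsetI) (use x in simp)
      show ?thesis using continuous_on_compose2[OF cont(1) pair ran] by simp
    qed
    then have "((\<lambda>E. y E x) \<longlongrightarrow> y E1 x) (at E1)"
      by (simp add: continuous_on_def)
    then show "((\<lambda>E. y E x) \<longlongrightarrow> y E1 x) (at_left E1)"
      by (rule tendsto_within_subset) simp
    have "eventually (\<lambda>E. E \<in> {0<..<E1}) (at_left E1)"
      using E1_pos by (rule eventually_at_left_real)
    then show "eventually (\<lambda>E. 0 \<le> y E x) (at_left E1)"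
    proof eventually_elim
      case (elim E)
      have "y E z \<noteq> 0" if "0 < z" "z \<le> x" for z
        using least[of E z] that x elim by force
      then show ?case using pos[of E x] elim E1 x by auto
    qed
  qed simp
  have zero_at_end: "x = real L" if x: "0 < x" "x \<le> real L" "y E1 x = 0" for x
  proof (rule ccontr)
    assume "x \<noteq> real L"
    then have x': "x < real L" using x by simp
    have "y' E1 x = 0"
    proof (rule DERIV_local_min[of "y E1" _ x "min x (real L - x)"])
      show "(y E1 has_real_derivative y' E1 x) (at x)" using piecewise_C2D(4)[OF C2] x x' by auto
      show "\<forall>t. \<bar>x - t\<bar> < min x (real L - x) \<longrightarrow> y E1 x \<le> y E1 t"
        using nonneg x by (auto simp: abs_less_iff)
    qed (use x x' in auto)
    have R: "piecewise_C2 0 x (\<lambda>t. y E1 (x - t)) (\<lambda>t. - y' E1 (x - t)) (\<lambda>t. (W \<lfloor>x - t\<rfloor> - E1) * y E1 (x - t))"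
      using piecewise_C2_reflect[OF piecewise_C2_subinterval[OF C2[of E1], of 0 x], of x] x by simp
    have "y E1 (x - x) = 0 \<and> - y' E1 (x - x) = 0"
    proof (rule second_order_uniqueness[OF R, where K = "K + E1"])
      fix t assume t: "0 < t" "t < x"
      have "\<bar>W \<lfloor>x - t\<rfloor> - E1\<bar> \<le> K + E1" using K(2)[of "x - t"] t x E1 by auto
      then show "\<bar>(W \<lfloor>x - t\<rfloor> - E1) * y E1 (x - t)\<bar> \<le> (K + E1) * \<bar>y E1 (x - t)\<bar>"
        unfolding abs_mult by (rule mult_right_mono) simp
    qed (use x K E1 \<open>y' E1 x = 0\<close> in auto)
    then show False using init by simp
  qed
  have endpt: "y E1 (real L) = 0" using zero_at_end[of x1] x1 \<delta> by auto
  have pos1: "0 < y E1 x" if "0 < x" "x < real L" for x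
    using nonneg[of x] zero_at_end[of x] that by force
  have "ground_state_eigenvalue (real L) (\<lambda>x. W \<lfloor>x\<rfloor>) = E1"
    unfolding ground_state_eigenvalue_def
  proof (rule Least_equality)
    show "dirichlet_eigenvalue (real L) (\<lambda>x. W \<lfloor>x\<rfloor>) E1"
      unfolding dirichlet_eigenvalue_iff
      using C2[of E1] init endpt pos1[of "real L / 2"] L
      by (intro exI[of _ "y E1"] exI[of _ "y' E1"] conjI bexI[of _ "real L / 2"]) auto
  next
    fix E assume "dirichlet_eigenvalue (real L) (\<lambda>x. W \<lfloor>x\<rfloor>) E"
    then obtain f g x where f: "f 0 = 0" "f (real L) = 0"
      and C2f: "piecewise_C2 0 (real L) f g (\<lambda>x. (W \<lfloor>x\<rfloor> - E) * f x)"
      and x: "x \<in> {0..real L}" "f x \<noteq> 0" unfolding dirichlet_eigenvalue_iff by blast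
    have E: "0 < E"
    proof (rule ccontr)
      assume "\<not> 0 < E"
      have "f x = 0"
      proof (rule dirichlet_energy_trivial[OF C2f _ f x(1)])
        fix x
        have "f x * ((W \<lfloor>x\<rfloor> - E) * f x) = (W \<lfloor>x\<rfloor> - E) * (f x)\<^sup>2" by (simp add: power2_eq_square)
        moreover have "0 \<le> W \<lfloor>x\<rfloor> - E" using W[of "\<lfloor>x\<rfloor>"] \<open>\<not> 0 < E\<close> by simp
        ultimately show "0 \<le> f x * ((W \<lfloor>x\<rfloor> - E) * f x)" by (simp only: zero_le_mult_iff zero_le_power2 simp_thms)
      qed
      with x show False by simp
    qed
    have eq: "1 * f t + (- g 0) * y E t = 0 \<and> 1 * g t + (- g 0) * y' E t = 0" if t: "t \<in> {0..real L}" for t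
    proof (rule second_order_uniqueness[OF piecewise_C2_linear_combination[OF C2f C2[of E]], where K = "K + E"])
      fix t assume t: "0 < t" "t < real L"
      have "\<bar>W \<lfloor>t\<rfloor> - E\<bar> \<le> K + E" using K(2)[of "t"] t E by auto
      then have "\<bar>W \<lfloor>t\<rfloor> - E\<bar> * \<bar>1 * f t + (- g 0) * y E t\<bar> \<le> (K + E) * \<bar>1 * f t + (- g 0) * y E t\<bar>"
        by (rule mult_right_mono) simp
      then show "\<bar>1 * ((W \<lfloor>t\<rfloor> - E) * f t) + (- g 0) * ((W \<lfloor>t\<rfloor> - E) * y E t)\<bar>
          \<le> (K + E) * \<bar>1 * f t + (- g 0) * y E t\<bar>"
        by (simp add: abs_mult[symmetric] algebra_simps)
    qed (use f init K E t in auto)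
    have "g 0 \<noteq> 0" using eq[OF x(1)] x(2) by auto
    then have "y E (real L) = 0" using eq[of "real L"] f by simp
    then show "E1 \<le> E" using least[of E "real L"] E L by simp
  qed
  from that[OF this E1_pos init(1)[of E1] endpt pos1 C2[of E1]] show ?thesis .
qed

text \<open>
  The solution is the shot with zero slope corrected by a multiple of the homogeneous shot, which
  does not vanish at \<open>L\<close>. At an interior minimum with a nonpositive value the equation would make it
  concave, so the landscape function is positive.
\<close>

lemma landscape_properties:
  fixes W :: "int \<Rightarrow> real" and L :: nat
  assumes W: "\<And>j. 0 \<le> W j" and L: "0 < L"
  obtains u g where "landscape (real L) (\<lambda>x. W \<lfloor>x\<rfloor>) = u" "u 0 = 0" "u (real L) = 0"
    "\<And>x. 0 < x \<Longrightarrow> x < real L \<Longrightarrow> 0 < u x"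
    "piecewise_C2 0 (real L) u g (\<lambda>x. W \<lfloor>x\<rfloor> * u x - 1)"
proof -
  have iff: "dirichlet_solution (real L) (\<lambda>x. W \<lfloor>x\<rfloor>) f (\<lambda>_. 1) \<longleftrightarrow>
      f 0 = 0 \<and> f (real L) = 0 \<and> (\<exists>g. piecewise_C2 0 (real L) f g (\<lambda>x. W \<lfloor>x\<rfloor> * f x - 1))" for f
    using dirichlet_solution_iff_piecewise_C2[of L W f 0 1] by simp
  obtain v v' :: "real \<Rightarrow> real \<Rightarrow> real" where v: "\<And>E. v E 0 = 0" "\<And>E. v' E 0 = 1"
    and C2v: "\<And>E. piecewise_C2 0 (real L) (v E) (v' E) (\<lambda>x. (W \<lfloor>x\<rfloor> - E) * v E x)"
    using shooting_solutions[where s = 1 and c = 0 and Q = W and L = L] by auto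
  obtain p p' :: "real \<Rightarrow> real \<Rightarrow> real" where p: "\<And>E. p E 0 = 0"
    and C2p: "\<And>E. piecewise_C2 0 (real L) (p E) (p' E) (\<lambda>x. (W \<lfloor>x\<rfloor> - E) * p E x + - 1)"
    using shooting_solutions[where s = 0 and c = "- 1" and Q = W and L = L] by blast
  have vL: "v 0 (real L) \<noteq> 0"
  proof (rule shooting_positive[OF C2v])
    show "0 \<le> v 0 x * ((W \<lfloor>x\<rfloor> - 0) * v 0 x)" for x
      using W[of "\<lfloor>x\<rfloor>"] by (simp add: mult.left_commute)
  qed (use v L in auto)
  define s where "s = - p 0 (real L) / v 0 (real L)"
  define u where "u x = (if x \<in> {0..real L} then 1 * p 0 x + s * v 0 x else 0)" for x
  define g where "g x = 1 * p' 0 x + s * v' 0 x" for x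
  have C2u: "piecewise_C2 0 (real L) u g (\<lambda>x. W \<lfloor>x\<rfloor> * u x - 1)"
    by (rule piecewise_C2_cong[OF piecewise_C2_linear_combination[OF C2p[of 0] C2v[of 0], of 1 s], where T = "{}"])
       (auto simp: u_def g_def algebra_simps)
  have u0: "u 0 = 0" "u (real L) = 0" using p v vL L by (auto simp: u_def s_def)
  have "landscape (real L) (\<lambda>x. W \<lfloor>x\<rfloor>) = u"
    unfolding landscape_def
  proof (rule the_equality)
    show "dirichlet_solution (real L) (\<lambda>x. W \<lfloor>x\<rfloor>) u (\<lambda>_. 1) \<and> (\<forall>x. x \<notin> {0..real L} \<longrightarrow> u x = 0)"
      unfolding iff using C2u u0 by (auto simp: u_def)
  next
    fix f assume f: "dirichlet_solution (real L) (\<lambda>x. W \<lfloor>x\<rfloor>) f (\<lambda>_. 1) \<and> (\<forall>x. x \<notin> {0..real L} \<longrightarrow> f x = 0)"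
    then obtain f' where f0: "f 0 = 0" "f (real L) = 0"
      and C2f: "piecewise_C2 0 (real L) f f' (\<lambda>x. W \<lfloor>x\<rfloor> * f x - 1)" unfolding iff by blast
    have eq: "1 * f x + (-1) * u x = 0" if x: "x \<in> {0..real L}" for x
    proof (rule dirichlet_energy_trivial[OF piecewise_C2_linear_combination[OF C2f C2u] _ _ _ x])
      fix x
      have "(1 * f x + (-1) * u x) * (1 * (W \<lfloor>x\<rfloor> * f x - 1) + (-1) * (W \<lfloor>x\<rfloor> * u x - 1)) = W \<lfloor>x\<rfloor> * (f x - u x)\<^sup>2"
        by (simp add: algebra_simps power2_eq_square)
      then show "0 \<le> (1 * f x + (-1) * u x) * (1 * (W \<lfloor>x\<rfloor> * f x - 1) + (-1) * (W \<lfloor>x\<rfloor> * u x - 1))"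
        using W[of "\<lfloor>x\<rfloor>"] by simp
    qed (use f0 u0 in auto)
    have "f x = u x" for x
    proof (cases "x \<in> {0..real L}")
      case True
      then show ?thesis using eq[of x] by linarith
    next
      case False
      then have "u x = 0" unfolding u_def by (rule if_not_P)
      with f[THEN conjunct2, rule_format, OF False] show ?thesis by simp
    qed
    then show "f = u" by (rule ext)
  qed
  moreover have "0 < u x" if x: "0 < x" "x < real L" for x
  proof -
    have contu: "continuous_on {0..real L} u" by (rule piecewise_C2D(3)[OF C2u])
    obtain K where K: "0 \<le> K" "\<And>x. x \<in> {0..real L} \<Longrightarrow> \<bar>W \<lfloor>x\<rfloor>\<bar> \<le> K"
      using step_bounded by blast
    obtain x0 where x0: "x0 \<in> {0..real L}" and min: "\<And>t. t \<in> {0..real L} \<Longrightarrow> u x0 \<le> u t"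
      using continuous_attains_inf[OF _ _ contu] by auto
    have interior: "0 < u z" if z: "0 < z" "z < real L" and zmin: "\<And>t. t \<in> {0..real L} \<Longrightarrow> u z \<le> u t" for z
    proof (rule ccontr)
      assume "\<not> 0 < u z"
      then have uz: "u z < 1 / (K + 1)" using K(1) by (smt (verit) divide_pos_pos)
      have "isCont u z" using piecewise_C2D(4)[OF C2u z] by (rule DERIV_isCont)
      then have "eventually (\<lambda>t. u t < 1 / (K + 1)) (at z)"
        using uz by (auto simp: isCont_def intro: order_tendstoD)
      then obtain d where d: "0 < d" "\<And>t. t \<noteq> z \<Longrightarrow> dist t z < d \<Longrightarrow> u t < 1 / (K + 1)"
        unfolding eventually_at by auto
      have "\<exists>t\<in>{0..real L}. u t < u z"
      proof (rule no_local_min_where_concave[OF C2u z d(1)])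
        fix t assume t: "0 < t" "t < real L" "\<bar>t - z\<bar> < d"
        have ut: "u t < 1 / (K + 1)" using d(2)[of t] uz t by (cases "t = z") (auto simp: dist_real_def)
        have W': "0 \<le> W \<lfloor>t\<rfloor>" "W \<lfloor>t\<rfloor> \<le> K" using W[of "\<lfloor>t\<rfloor>"] K(2)[of t] t by auto
        have "W \<lfloor>t\<rfloor> * u t \<le> W \<lfloor>t\<rfloor> * (1 / (K + 1))" using ut W' by (intro mult_left_mono) auto
        also have "\<dots> \<le> K * (1 / (K + 1))" using W' K by (intro mult_right_mono) auto
        also have "\<dots> < 1" using K by (simp add: field_simps)
        finally show "W \<lfloor>t\<rfloor> * u t - 1 < 0" by simp
      qed
      with zmin show False by force
    qed
    have "0 \<le> u x0"
      using interior[of x0] min x0 u0 by (cases "x0 = 0 \<or> x0 = real L") (auto intro: less_imp_le)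
    show ?thesis
    proof (rule ccontr)
      assume "\<not> 0 < u x"
      then have "u x \<le> u x0" using \<open>0 \<le> u x0\<close> by simp
      then have "0 < u x" using interior[OF x] min by (meson order_trans)
      with \<open>\<not> 0 < u x\<close> show False by simp
    qed
  qed
  ultimately show ?thesis using u0 C2u by (intro that[of u g])
qed

lemma min_inverse_landscape_eq:
  fixes W :: "int \<Rightarrow> real" and L :: nat
  assumes W: "\<And>j. 0 \<le> W j" and L: "0 < L"
  obtains u g x0 where "u 0 = 0" "u (real L) = 0"
    "\<And>x. 0 < x \<Longrightarrow> x < real L \<Longrightarrow> 0 < u x"
    "piecewise_C2 0 (real L) u g (\<lambda>x. W \<lfloor>x\<rfloor> * u x - 1)"
    "0 < x0" "x0 < real L" "\<And>x. x \<in> {0..real L} \<Longrightarrow> u x \<le> u x0"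
    "min_inverse_landscape (real L) (\<lambda>x. W \<lfloor>x\<rfloor>) = 1 / u x0"
proof -
  obtain u g where u: "landscape (real L) (\<lambda>x. W \<lfloor>x\<rfloor>) = u" "u 0 = 0" "u (real L) = 0"
    "\<And>x. 0 < x \<Longrightarrow> x < real L \<Longrightarrow> 0 < u x"
    and C2: "piecewise_C2 0 (real L) u g (\<lambda>x. W \<lfloor>x\<rfloor> * u x - 1)"
    by (rule landscape_properties[of W, OF W L]) (rule that; assumption)
  obtain x0 where x0: "x0 \<in> {0..real L}" and max: "\<And>t. t \<in> {0..real L} \<Longrightarrow> u t \<le> u x0"
    using continuous_attains_sup[OF _ _ piecewise_C2D(3)[OF C2]] by auto
  have "0 < u x0" using max[of "real L / 2"] u(4)[of "real L / 2"] L by auto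
  then have x0': "0 < x0" "x0 < real L" using x0 u(2,3) by (cases "x0 = 0"; cases "x0 = real L"; simp)+
  have "min_inverse_landscape (real L) (\<lambda>x. W \<lfloor>x\<rfloor>) = 1 / u x0"
    unfolding min_inverse_landscape_def u(1)
  proof (rule Least_equality)
    fix m assume "m \<in> (\<lambda>x. 1 / u x) ` {0<..<real L}"
    then obtain x where "0 < x" "x < real L" "m = 1 / u x" by auto
    then show "1 / u x0 \<le> m" using max[of x] u(4)[of x] by (auto intro!: divide_left_mono)
  qed (use x0' in auto)
  from that[OF u(2,3,4) C2 x0' max this] show ?thesis .
qed

section \<open>Bounds by zero runs and barriers\<close>

text \<open>
  On the zero run \<open>u'' = -1\<close>, so that \<open>u\<close> lies above a parabola. Conversely, low points in the barriers
  enclose the maximum point, and between them \<open>u'' \<ge> -1\<close> keeps \<open>u\<close> below a parabola that starts from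
  the height of the low points.
\<close>

lemma landscape_maximum_bounds:
  fixes w :: "int \<Rightarrow> real" and L a R m :: nat
  assumes w: "\<And>j. 0 \<le> w j" and R: "0 < R" "a + R \<le> L"
    and zeros: "\<And>j. a \<le> j \<Longrightarrow> j < a + R \<Longrightarrow> w (int j) = 0"
    and \<kappa>: "0 < \<kappa>" and barrier: "\<And>n. n + m \<le> L \<Longrightarrow> \<exists>j. n \<le> j \<and> j < n + m \<and> \<kappa> \<le> w (int j)"
    and C2: "piecewise_C2 0 (real L) u g (\<lambda>x. w \<lfloor>x\<rfloor> * u x - 1)"
    and u: "u 0 = 0" "u (real L) = 0" "\<And>x. 0 < x \<Longrightarrow> x < real L \<Longrightarrow> 0 < u x"
    and x0: "0 < x0" "x0 < real L" "\<And>x. x \<in> {0..real L} \<Longrightarrow> u x \<le> u x0"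
  shows "(real R)\<^sup>2 / 8 \<le> u x0"
    and "u x0 \<le> (2 * sqrt (2 * u x0) + 1) / \<kappa> + (real m + 1)\<^sup>2 / 8"
proof -
  have nonneg: "0 \<le> u x" if "0 \<le> x" "x \<le> real L" for x
    using u that by (cases "x = 0"; cases "x = real L") (auto intro: less_imp_le)
  have "1 * (real (a + R) - real a)\<^sup>2 / 8 \<le> u ((real a + real (a + R)) / 2)"
  proof (rule parabola_lower_bound[OF piecewise_C2_subinterval[OF C2]])
    fix x assume x: "real a < x" "x < real (a + R)"
    have "w \<lfloor>x\<rfloor> = 0"
    proof -
      have "a \<le> nat \<lfloor>x\<rfloor>" "nat \<lfloor>x\<rfloor> < a + R" using x by (auto simp: le_nat_iff nat_less_iff le_floor_iff floor_less_iff)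
      with zeros[of "nat \<lfloor>x\<rfloor>"] show ?thesis using x by simp
    qed
    then show "w \<lfloor>x\<rfloor> * u x - 1 \<le> - 1" by simp
  qed (use R nonneg in auto)
  also have "\<dots> \<le> u x0" by (rule x0(3)) (use R in auto)
  finally show "(real R)\<^sup>2 / 8 \<le> u x0" by simp
  define \<eta> where "\<eta> = (2 * sqrt (2 * 1 * u x0) + 1) / \<kappa>"
  have \<eta>: "0 \<le> \<eta>" using \<kappa> nonneg[of x0] x0 by (simp add: \<eta>_def)
  have h: "- 1 \<le> w \<lfloor>x\<rfloor> * u x - 1" if "0 < x" "x < real L" for x
    using w[of "\<lfloor>x\<rfloor>"] nonneg[of x] that by simp
  have low: "\<exists>z\<in>{real n..real (n + m)}. u z \<le> \<eta>" if n: "n + m \<le> L" for n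
  proof -
    obtain j where j: "n \<le> j" "j < n + m" "\<kappa> \<le> w (int j)" using barrier[OF n] by blast
    have "\<exists>z\<in>{real j..real j + 1}. u z \<le> \<eta>" unfolding \<eta>_def
    proof (rule barrier_low_point[OF C2 zero_less_one \<kappa> h])
      fix x assume x: "real j < x" "x < real j + 1"
      then have "\<lfloor>x\<rfloor> = int j" by (intro floor_unique) auto
      moreover have "0 \<le> u x" by (rule nonneg) (use x j n in auto)
      ultimately show "\<kappa> * u x - 1 \<le> w \<lfloor>x\<rfloor> * u x - 1" using j by (simp add: mult_right_mono)
    qed (use j n u x0 nonneg in auto)
    then obtain z where z: "real j \<le> z" "z \<le> real j + 1" "u z \<le> \<eta>" by auto
    then show ?thesis using j by (intro bexI[of _ z]) auto
  qed
  obtain p q where pq: "0 \<le> p" "p \<le> x0" "x0 \<le> q" "q \<le> real L" "u p \<le> \<eta>" "u q \<le> \<eta>" "q - p \<le> real m + 1"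
    by (rule enclosing_low_points[OF piecewise_C2D(3)[OF C2], of \<eta> m x0]) (use u \<eta> low x0 in auto)
  have "u x0 \<le> \<eta> + 1 * (q - p)\<^sup>2 / 8"
    by (rule parabola_upper_bound[OF piecewise_C2_subinterval[OF C2 pq(1,4)]]) (use h pq in auto)
  also have "(q - p)\<^sup>2 \<le> (real m + 1)\<^sup>2" using pq by (intro power_mono) auto
  finally show "u x0 \<le> (2 * sqrt (2 * u x0) + 1) / \<kappa> + (real m + 1)\<^sup>2 / 8" by (simp add: \<eta>_def)
qed

text \<open>
  The zero run accommodates at most a half-wave of a positive function. Conversely, low points in the
  barriers enclose the maximum point of the ground state, and coming down to them on both sides
  costs twice the phase \<open>arccos\<close> of their relative height.
\<close>

lemma ground_state_eigenvalue_bounds: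
  fixes w :: "int \<Rightarrow> real" and L a R m :: nat
  assumes w: "\<And>j. 0 \<le> w j" and R: "0 < R" "a + R \<le> L"
    and zeros: "\<And>j. a \<le> j \<Longrightarrow> j < a + R \<Longrightarrow> w (int j) = 0"
    and \<kappa>: "0 < \<kappa>" and barrier: "\<And>n. n + m \<le> L \<Longrightarrow> \<exists>j. n \<le> j \<and> j < n + m \<and> \<kappa> \<le> w (int j)"
    and E: "0 < E" and C2: "piecewise_C2 0 (real L) f g (\<lambda>x. (w \<lfloor>x\<rfloor> - E) * f x)"
    and f: "f 0 = 0" "f (real L) = 0" "\<And>x. 0 < x \<Longrightarrow> x < real L \<Longrightarrow> 0 < f x"
  shows "E \<le> (pi / real R)\<^sup>2"
    and "(2 * sqrt (2 * E) + E) / \<kappa> \<le> 1 \<Longrightarrow>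
      2 * arccos ((2 * sqrt (2 * E) + E) / \<kappa>) \<le> sqrt E * (real m + 1)"
proof -
  have nonneg: "0 \<le> f x" if "0 \<le> x" "x \<le> real L" for x
    using f that by (cases "x = 0"; cases "x = real L") (auto intro: less_imp_le)
  have "E \<le> (pi / (real (a + R) - real a))\<^sup>2"
  proof (rule sine_comparison[OF piecewise_C2_subinterval[OF C2]])
    fix x assume x: "real a < x" "x < real (a + R)"
    have "w \<lfloor>x\<rfloor> = 0"
    proof -
      have "a \<le> nat \<lfloor>x\<rfloor>" "nat \<lfloor>x\<rfloor> < a + R" using x by (auto simp: le_nat_iff nat_less_iff le_floor_iff floor_less_iff)
      with zeros[of "nat \<lfloor>x\<rfloor>"] show ?thesis using x by simp
    qed
    then show "(w \<lfloor>x\<rfloor> - E) * f x \<le> - E * f x" by simp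
  qed (use R nonneg f in auto)
  then show "E \<le> (pi / real R)\<^sup>2" by simp
  define \<eta> where "\<eta> = (2 * sqrt (2 * E) + E) / \<kappa>"
  assume "(2 * sqrt (2 * E) + E) / \<kappa> \<le> 1"
  then have \<eta>: "0 \<le> \<eta>" "\<eta> \<le> 1" using \<kappa> E by (auto simp: \<eta>_def)
  have L: "0 < real L" using R by simp
  obtain x0 where "x0 \<in> {0..real L}" and max: "\<And>t. t \<in> {0..real L} \<Longrightarrow> f t \<le> f x0"
    using continuous_attains_sup[OF _ _ piecewise_C2D(3)[OF C2]] by auto
  have pos: "0 < f x0" using max[of "real L / 2"] f(3)[of "real L / 2"] L by auto
  then have x0: "0 < x0" "x0 < real L"
    using \<open>x0 \<in> {0..real L}\<close> f(1,2) by (cases "x0 = 0"; cases "x0 = real L"; simp)+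
  define c where "c = E * f x0"
  have c: "0 < c" using E pos by (simp add: c_def)
  have h: "- c \<le> (w \<lfloor>x\<rfloor> - E) * f x" if "0 < x" "x < real L" for x
  proof -
    have "E * f x \<le> c" using max[of x] that E by (simp add: c_def)
    moreover have "0 \<le> w \<lfloor>x\<rfloor> * f x" using w[of "\<lfloor>x\<rfloor>"] nonneg[of x] that by simp
    ultimately show ?thesis by (simp add: algebra_simps)
  qed
  have \<eta>_eq: "(2 * sqrt (2 * c * f x0) + c) / \<kappa> = \<eta> * f x0"
  proof -
    have "sqrt (2 * c * f x0) = sqrt (2 * E) * f x0"
      using pos E by (simp add: c_def real_sqrt_mult)
    then show ?thesis by (simp add: \<eta>_def c_def algebra_simps add_divide_distrib)
  qed
  have low: "\<exists>z\<in>{real n..real (n + m)}. f z \<le> \<eta> * f x0" if n: "n + m \<le> L" for n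
  proof -
    obtain j where j: "n \<le> j" "j < n + m" "\<kappa> \<le> w (int j)" using barrier[OF n] by blast
    have "\<exists>z\<in>{real j..real j + 1}. f z \<le> (2 * sqrt (2 * c * f x0) + c) / \<kappa>"
    proof (rule barrier_low_point[OF C2 c \<kappa> h])
      fix x assume x: "real j < x" "x < real j + 1"
      then have fl: "\<lfloor>x\<rfloor> = int j" by (intro floor_unique) auto
      have xL: "0 \<le> x" "x \<le> real L" using x j n by auto
      have "\<kappa> * f x \<le> w \<lfloor>x\<rfloor> * f x" using j fl nonneg[OF xL] by (simp add: mult_right_mono)
      moreover have "E * f x \<le> c" using max[of x] xL E by (simp add: c_def)
      ultimately show "\<kappa> * f x - c \<le> (w \<lfloor>x\<rfloor> - E) * f x" by (simp add: algebra_simps)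
    qed (use j n f max nonneg in auto)
    then obtain z where z: "real j \<le> z" "z \<le> real j + 1" "f z \<le> \<eta> * f x0" unfolding \<eta>_eq by auto
    then show ?thesis using j by (intro bexI[of _ z]) auto
  qed
  have \<eta>f: "0 \<le> \<eta> * f x0" using \<eta> pos by simp
  obtain p q where pq: "0 \<le> p" "p \<le> x0" "x0 \<le> q" "q \<le> real L" "f p \<le> \<eta> * f x0" "f q \<le> \<eta> * f x0"
    "q - p \<le> real m + 1"
    by (rule enclosing_low_points[OF piecewise_C2D(3)[OF C2], of "\<eta> * f x0" m x0])
       (use f(1,2) \<eta>f low x0 in auto)
  have g0: "g x0 = 0"
  proof (rule DERIV_local_max[of f _ x0 "min x0 (real L - x0)"])
    show "(f has_real_derivative g x0) (at x0)" using piecewise_C2D(4)[OF C2] x0 by auto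
    show "\<forall>y. \<bar>x0 - y\<bar> < min x0 (real L - x0) \<longrightarrow> f y \<le> f x0" using max by (auto simp: abs_less_iff)
  qed (use x0 in auto)
  have h': "- (sqrt E)\<^sup>2 * f x \<le> (w \<lfloor>x\<rfloor> - E) * f x" if "0 \<le> x" "x \<le> real L" for x
    using w[of "\<lfloor>x\<rfloor>"] nonneg[OF that] E by (intro mult_right_mono) auto
  have right: "arccos \<eta> \<le> sqrt E * (q - x0)"
    by (rule descent_length[OF piecewise_C2_subinterval[OF C2, of x0 q]])
       (use pq x0 E h' g0 pos \<eta> in auto)
  have left: "arccos \<eta> \<le> sqrt E * ((x0 - p) - 0)"
  proof (rule descent_length)
    show "piecewise_C2 0 (x0 - p) (\<lambda>x. f (x0 - x)) (\<lambda>x. - g (x0 - x)) (\<lambda>x. (w \<lfloor>x0 - x\<rfloor> - E) * f (x0 - x))"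
      using piecewise_C2_reflect[OF piecewise_C2_subinterval[OF C2, of p x0], of x0] pq x0 by simp
  qed (use pq x0 E h' g0 pos \<eta> in auto)
  have "2 * arccos \<eta> \<le> sqrt E * (q - p)" using left right by (simp add: algebra_simps)
  also have "\<dots> \<le> sqrt E * (real m + 1)" using pq E by (intro mult_left_mono) auto
  finally show "2 * arccos ((2 * sqrt (2 * E) + E) / \<kappa>) \<le> sqrt E * (real m + 1)" by (simp add: \<eta>_def)
qed

text \<open>
  The number \<open>s\<close> controls the relative height of the low points, for the landscape function as well as
  for the ground state. As \<open>s \<rightarrow> 0\<close> and \<open>(m + 1)/R \<rightarrow> 1\<close> both bounds tend to \<open>\<pi>\<^sup>2/8\<close>, since \<open>arccos 0 = \<pi>/2\<close>.
\<close>

lemma eigenvalue_landscape_ratio_bounds: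
  fixes w :: "int \<Rightarrow> real" and L a R m :: nat
  assumes w: "\<And>j. 0 \<le> w j" and R: "0 < R" "a + R \<le> L"
    and zeros: "\<And>j. a \<le> j \<Longrightarrow> j < a + R \<Longrightarrow> w (int j) = 0"
    and k: "0 < k" and \<epsilon>: "0 < \<epsilon>"
    and barrier: "\<And>n. n + m \<le> L \<Longrightarrow> \<exists>j. n \<le> j \<and> j < n + m \<and> \<epsilon> \<le> w (int j)"
    and s: "s = 1 / (k * \<epsilon> * real R)"
  shows "16 * s < 1 \<Longrightarrow> eigenvalue_landscape_ratio (real L) k w
           \<le> pi\<^sup>2 / 8 * ((real m + 1) / real R)\<^sup>2 / (1 - 16 * s)"
    and "28 * s \<le> 1 \<Longrightarrow> (arccos (28 * s))\<^sup>2 / 2 * (real R / (real m + 1))\<^sup>2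
           \<le> eigenvalue_landscape_ratio (real L) k w"
proof -
  define W where "W j = k * w j" for j
  define \<kappa> where "\<kappa> = k * \<epsilon>"
  have \<kappa>: "0 < \<kappa>" using k \<epsilon> by (simp add: \<kappa>_def)
  have W: "0 \<le> W j" for j using w k by (simp add: W_def)
  have zerosW: "W (int j) = 0" if "a \<le> j" "j < a + R" for j using zeros[OF that] by (simp add: W_def)
  have barrierW: "\<exists>j. n \<le> j \<and> j < n + m \<and> \<kappa> \<le> W (int j)" if "n + m \<le> L" for n
    using barrier[OF that] k by (auto simp: W_def \<kappa>_def)
  have L: "0 < L" using R by simp
  have R1: "1 \<le> real R" using R by simp
  obtain E f g where E: "ground_state_eigenvalue (real L) (\<lambda>x. W \<lfloor>x\<rfloor>) = E" "0 < E"
    and f: "f 0 = 0" "f (real L) = 0" "\<And>x. 0 < x \<Longrightarrow> x < real L \<Longrightarrow> 0 < f x"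
    and C2f: "piecewise_C2 0 (real L) f g (\<lambda>x. (W \<lfloor>x\<rfloor> - E) * f x)"
    by (rule ground_state_exists[of W, OF W L]) (rule that; assumption)
  obtain u u' x0 where u: "u 0 = 0" "u (real L) = 0" "\<And>x. 0 < x \<Longrightarrow> x < real L \<Longrightarrow> 0 < u x"
    and C2u: "piecewise_C2 0 (real L) u u' (\<lambda>x. W \<lfloor>x\<rfloor> * u x - 1)"
    and x0: "0 < x0" "x0 < real L" "\<And>x. x \<in> {0..real L} \<Longrightarrow> u x \<le> u x0"
    and min: "min_inverse_landscape (real L) (\<lambda>x. W \<lfloor>x\<rfloor>) = 1 / u x0"
    by (rule min_inverse_landscape_eq[of W, OF W L]) (rule that; assumption)
  define M where "M = u x0"
  have M: "0 < M" using u(3)[OF x0(1,2)] by (simp add: M_def)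
  have ratio: "eigenvalue_landscape_ratio (real L) k w = E * M"
    using E min by (simp add: eigenvalue_landscape_ratio_def anderson_potential_eq W_def M_def)
  have Mlow: "(real R)\<^sup>2 / 8 \<le> M" and Mup: "M \<le> (2 * sqrt (2 * M) + 1) / \<kappa> + (real m + 1)\<^sup>2 / 8"
    unfolding M_def
    by (rule landscape_maximum_bounds[of W R a L \<kappa> m u u' x0]; use W R zerosW \<kappa> barrierW C2u u x0 in blast)+
  have Eup: "E \<le> (pi / real R)\<^sup>2"
    and Elow: "(2 * sqrt (2 * E) + E) / \<kappa> \<le> 1 \<Longrightarrow>
      2 * arccos ((2 * sqrt (2 * E) + E) / \<kappa>) \<le> sqrt E * (real m + 1)"
    by (rule ground_state_eigenvalue_bounds[of W R a L \<kappa> m E f g]; use W R zerosW \<kappa> barrierW C2f f E in blast)+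
  have s0: "0 < s" using k \<epsilon> R by (simp add: s)
  have s_eq: "s = 1 / (\<kappa> * real R)" by (simp add: s \<kappa>_def)
  {
    assume s1: "16 * s < 1"
    \<comment> \<open>both \<open>2 sqrt (2M) R\<close> and \<open>R\<close> are at most \<open>8M\<close>, since \<open>R\<^sup>2 \<le> 8M\<close>\<close>
    have "(2 * sqrt (2 * M) + 1) / \<kappa> \<le> 16 * s * M"
    proof -
      have R8: "real R \<le> sqrt (8 * M)" using Mlow by (intro real_le_rsqrt) simp
      have "2 * sqrt (2 * M) * real R \<le> 2 * sqrt (2 * M) * sqrt (8 * M)" using R8 M by (intro mult_left_mono) auto
      also have "\<dots> = 8 * M"
      proof -
        have "2 * M * (8 * M) = (4 * M)\<^sup>2" by (simp add: power2_eq_square)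
        then have "sqrt (2 * M) * sqrt (8 * M) = \<bar>4 * M\<bar>"
          by (simp only: real_sqrt_abs flip: real_sqrt_mult)
        then show ?thesis using M by simp
      qed
      finally have 1: "2 * sqrt (2 * M) * real R \<le> 8 * M" .
      have "real R \<le> (real R)\<^sup>2" using R1 by (simp add: power2_eq_square)
      then have "real R \<le> 8 * M" using Mlow by linarith
      with 1 have "(2 * sqrt (2 * M) + 1) * real R \<le> 16 * M" by (simp add: algebra_simps)
      then have "2 * sqrt (2 * M) + 1 \<le> 16 * M / real R" using R by (simp add: pos_le_divide_eq)
      then have "(2 * sqrt (2 * M) + 1) / \<kappa> \<le> 16 * M / real R / \<kappa>"
        using \<kappa> by (intro divide_right_mono) auto
      then show ?thesis by (simp add: s_eq mult.commute)
    qed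
    with Mup have "M \<le> 16 * s * M + (real m + 1)\<^sup>2 / 8" by simp
    then have "M * (1 - 16 * s) \<le> (real m + 1)\<^sup>2 / 8" by (simp add: algebra_simps)
    then have Mle: "M \<le> (real m + 1)\<^sup>2 / 8 / (1 - 16 * s)" using s1 by (subst pos_le_divide_eq) simp_all
    have eq: "(pi / real R)\<^sup>2 * (X\<^sup>2 / 8 / D) = pi\<^sup>2 / 8 * (X / real R)\<^sup>2 / D" for X D :: real
      by (simp add: power_divide)
    from Mle have "E * M \<le> (pi / real R)\<^sup>2 * ((real m + 1)\<^sup>2 / 8 / (1 - 16 * s))"
      using Eup E M by (intro mult_mono) auto
    then show "eigenvalue_landscape_ratio (real L) k w \<le> pi\<^sup>2 / 8 * ((real m + 1) / real R)\<^sup>2 / (1 - 16 * s)"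
      unfolding ratio eq .
  }
  {
    assume s1: "28 * s \<le> 1"
    \<comment> \<open>\<open>28 = 12 + 16\<close> comes from \<open>sqrt E \<le> 4/R\<close>, \<open>2 sqrt 2 \<le> 3\<close> and \<open>R \<ge> 1\<close>\<close>
    have \<eta>: "(2 * sqrt (2 * E) + E) / \<kappa> \<le> 28 * s"
    proof -
      have sE: "sqrt E \<le> pi / real R" using Eup by (intro real_le_lsqrt) auto
      have "sqrt 2 \<le> 3 / 2" by (rule real_le_lsqrt) (auto simp: power2_eq_square)
      have "2 * sqrt (2 * E) = 2 * sqrt 2 * sqrt E" by (simp add: real_sqrt_mult)
      also have "\<dots> \<le> 3 * (4 / real R)"
      proof (rule mult_mono)
        have "pi / real R \<le> 4 / real R" using pi_less_4 by (intro divide_right_mono) auto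
        with sE show "sqrt E \<le> 4 / real R" by linarith
      qed (use \<open>sqrt 2 \<le> 3 / 2\<close> E in auto)
      finally have 1: "2 * sqrt (2 * E) \<le> 12 / real R" by simp
      have "pi\<^sup>2 \<le> 4\<^sup>2" using pi_less_4 pi_gt_zero by (intro power_mono) auto
      have "E \<le> pi\<^sup>2 / (real R)\<^sup>2" using Eup by (simp add: power_divide)
      also have "\<dots> \<le> 16 / real R"
        using \<open>pi\<^sup>2 \<le> 4\<^sup>2\<close> R1 by (intro frac_le) (auto simp: power2_eq_square)
      finally have "2 * sqrt (2 * E) + E \<le> 28 / real R" using 1 by simp
      then have "(2 * sqrt (2 * E) + E) / \<kappa> \<le> 28 / real R / \<kappa>" using \<kappa> by (intro divide_right_mono) auto
      then show ?thesis by (simp add: s_eq mult.commute)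
    qed
    have \<eta>0: "0 \<le> (2 * sqrt (2 * E) + E) / \<kappa>" using E \<kappa> by simp
    have "2 * arccos (28 * s) \<le> 2 * arccos ((2 * sqrt (2 * E) + E) / \<kappa>)"
      using \<eta> \<eta>0 s1 by (intro mult_left_mono arccos_le_arccos) auto
    also have "\<dots> \<le> sqrt E * (real m + 1)" using \<eta> s1 by (intro Elow) auto
    finally have "2 * arccos (28 * s) / (real m + 1) \<le> sqrt E" by (simp add: pos_divide_le_eq)
    moreover have "0 \<le> arccos (28 * s)" using s1 s0 by (intro arccos_lbound) auto
    ultimately have "(2 * arccos (28 * s) / (real m + 1))\<^sup>2 \<le> (sqrt E)\<^sup>2" by (intro power_mono) auto
    then have "(2 * arccos (28 * s) / (real m + 1))\<^sup>2 \<le> E" using E by simp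
    then have "(2 * arccos (28 * s) / (real m + 1))\<^sup>2 * ((real R)\<^sup>2 / 8) \<le> E * M"
      using Mlow E by (intro mult_mono) auto
    then show "(arccos (28 * s))\<^sup>2 / 2 * (real R / (real m + 1))\<^sup>2 \<le> eigenvalue_landscape_ratio (real L) k w"
      unfolding ratio by (simp add: power_divide power_mult_distrib mult.commute)
  }
qed

section \<open>Runs in an i.i.d. sequence\<close>

context prob_space
begin

lemma iid_prob_all:
  fixes \<omega> :: "int \<Rightarrow> 'a \<Rightarrow> real"
  assumes indep: "indep_vars (\<lambda>_. borel) \<omega> UNIV"
    and ident: "\<And>j. distr M borel (\<omega> j) = distr M borel (\<omega> 0)"
    and J: "finite J" and A: "A \<in> sets borel"
  shows "{x \<in> space M. \<forall>j\<in>J. \<omega> j x \<in> A} \<in> events"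
    and "prob {x \<in> space M. \<forall>j\<in>J. \<omega> j x \<in> A} = prob {x \<in> space M. \<omega> 0 x \<in> A} ^ card J"
proof -
  have rv: "random_variable borel (\<omega> j)" for j
    using indep by (auto simp: indep_vars_def)
  have meas: "\<omega> j -` A \<inter> space M \<in> events" for j
    using measurable_sets[OF rv A] .
  show "{x \<in> space M. \<forall>j\<in>J. \<omega> j x \<in> A} \<in> events"
  proof -
    have "{x \<in> space M. \<omega> j x \<in> A} \<in> events" for j
      using meas[of j] by (simp add: vimage_def Int_def conj_commute)
    then show ?thesis using J by (intro sets.sets_Collect_finite_All)
  qed
  have same: "prob (\<omega> j -` A \<inter> space M) = prob {x \<in> space M. \<omega> 0 x \<in> A}" for j
  proof -
    have "prob (\<omega> j -` A \<inter> space M) = measure (distr M borel (\<omega> j)) A"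
      by (rule measure_distr[OF rv A, symmetric])
    also have "\<dots> = prob (\<omega> 0 -` A \<inter> space M)"
      unfolding ident[of j] by (rule measure_distr[OF rv A])
    finally show ?thesis by (simp add: vimage_def Int_def conj_commute)
  qed
  show "prob {x \<in> space M. \<forall>j\<in>J. \<omega> j x \<in> A} = prob {x \<in> space M. \<omega> 0 x \<in> A} ^ card J"
  proof (cases "J = {}")
    case True
    then show ?thesis by (simp add: prob_space)
  next
    case False
    have "{x \<in> space M. \<forall>j\<in>J. \<omega> j x \<in> A} = (\<Inter>j\<in>J. \<omega> j -` A \<inter> space M)"
      using False by auto
    then have "prob {x \<in> space M. \<forall>j\<in>J. \<omega> j x \<in> A} = (\<Prod>j\<in>J. prob (\<omega> j -` A \<inter> space M))"
      using indep_varsD[OF indep False J, of "\<lambda>_. A"] A by simp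
    then show ?thesis by (simp add: same)
  qed
qed

text \<open>
  Disjoint blocks of an independent sequence are independent.
\<close>

lemma iid_prob_no_block:
  fixes \<omega> :: "int \<Rightarrow> 'a \<Rightarrow> real" and r :: nat
  assumes indep: "indep_vars (\<lambda>_. borel) \<omega> UNIV"
    and ident: "\<And>j. distr M borel (\<omega> j) = distr M borel (\<omega> 0)"
    and A: "A \<in> sets borel"
  defines "K \<equiv> \<lambda>i. {int (i * r)..<int (Suc i * r)}"
  shows "prob {x \<in> space M. \<forall>i<N. \<not> (\<forall>j\<in>K i. \<omega> j x \<in> A)} = (1 - prob {x \<in> space M. \<omega> 0 x \<in> A} ^ r) ^ N"
proof (cases "N = 0")
  case True
  then show ?thesis by (simp add: prob_space)
next
  case False
  let ?X = "\<lambda>i x. restrict (\<lambda>j. \<omega> j x) (K i)"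
  let ?B = "\<lambda>i. space (PiM (K i) (\<lambda>_. borel :: real measure)) - PiE (K i) (\<lambda>_. A)"
  have fin: "finite (K i)" and card: "card (K i) = r" for i
    by (simp_all add: K_def algebra_simps)
  have disj: "disjoint_family_on K {..<N}"
  proof (unfold disjoint_family_on_def, intro ballI impI)
    have "K m \<inter> K n = {}" if "m < n" for m n
    proof -
      have "Suc m * r \<le> n * r" using that by (intro mult_right_mono) auto
      then have "int (Suc m * r) \<le> int (n * r)" by (simp only: of_nat_le_iff)
      then show ?thesis unfolding K_def by auto
    qed
    then show "K m \<inter> K n = {}" if "m \<noteq> n" for m n
      using that by (metis Int_commute linorder_neqE_nat)
  qed
  have ind: "indep_vars (\<lambda>i. PiM (K i) (\<lambda>_. borel)) ?X {..<N}"
    by (rule indep_vars_restrict[OF indep _ disj]) auto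
  have B: "?B i \<in> sets (PiM (K i) (\<lambda>_. borel))" for i
    using A fin by (intro sets.compl_sets sets_PiM_I_finite) auto
  have single: "?X i -` ?B i \<inter> space M = space M - {x \<in> space M. \<forall>j\<in>K i. \<omega> j x \<in> A}" for i
    by (auto simp: space_PiM PiE_iff)
  have "prob (?X i -` ?B i \<inter> space M) = 1 - prob {x \<in> space M. \<omega> 0 x \<in> A} ^ r" for i
    unfolding single using prob_compl[OF iid_prob_all(1)[OF indep ident fin A]]
      iid_prob_all(2)[OF indep ident fin A, of i] by (simp add: card)
  moreover have "prob (\<Inter>i\<in>{..<N}. ?X i -` ?B i \<inter> space M) = (\<Prod>i\<in>{..<N}. prob (?X i -` ?B i \<inter> space M))"
    by (rule indep_varsD_finite[OF ind]) (use False B in auto)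
  moreover have "(\<Inter>i\<in>{..<N}. ?X i -` ?B i \<inter> space M) = {x \<in> space M. \<forall>i<N. \<not> (\<forall>j\<in>K i. \<omega> j x \<in> A)}"
    unfolding single using False by auto
  ultimately show ?thesis by simp
qed

text \<open>
  The window of length \<open>b ln n\<close> that ends at the cell \<open>n\<close> lies in the event with probability at most
  \<open>n\<close> to the power \<open>b ln q\<close>, which is summable. Indexing the windows by their last cell makes one
  application of Borel--Cantelli sufficient for all windows in \<open>[0,L]\<close>: the length increases with
  \<open>n\<close>, so a window of length \<open>b ln L\<close> contains the shorter one that ends at the same cell.
\<close>

lemma AE_eventually_no_long_run:
  fixes \<omega> :: "int \<Rightarrow> 'a \<Rightarrow> real"
  assumes indep: "indep_vars (\<lambda>_. borel) \<omega> UNIV"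
    and ident: "\<And>j. distr M borel (\<omega> j) = distr M borel (\<omega> 0)"
    and A: "A \<in> sets borel" and q: "0 < prob {x \<in> space M. \<omega> 0 x \<in> A}"
    and b: "0 < b" and rate: "b * ln (prob {x \<in> space M. \<omega> 0 x \<in> A}) < - 1"
  shows "AE x in M. \<forall>\<^sub>F L in sequentially. \<forall>n. n + nat \<lceil>b * ln (real L)\<rceil> \<le> L \<longrightarrow>
           (\<exists>j. n \<le> j \<and> j < n + nat \<lceil>b * ln (real L)\<rceil> \<and> \<omega> (int j) x \<notin> A)"
proof -
  define q where "q = prob {x \<in> space M. \<omega> 0 x \<in> A}"
  define r where "r n = nat \<lceil>b * ln (real n)\<rceil>" for n :: nat
  define F where "F n = {x \<in> space M. \<forall>j\<in>{int n - int (r n) + 1..int n}. \<omega> j x \<in> A}" for n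
  have q': "0 < q" "q \<le> 1" "b * ln q < - 1" using q rate by (auto simp: q_def)
  have F: "F n \<in> events" "prob (F n) = q ^ r n" for n
    using iid_prob_all[OF indep ident _ A, of "{int n - int (r n) + 1..int n}"]
    by (auto simp: F_def q_def)
  have bound: "prob (F n) \<le> real n powr (b * ln q)" if n: "1 \<le> n" for n
  proof -
    have "b * ln (real n) \<le> real (r n)" unfolding r_def by (rule real_nat_ceiling_ge)
    then have "real (r n) * ln q \<le> b * ln (real n) * ln q"
      using q' by (intro mult_right_mono_neg) auto
    then have le: "exp (real (r n) * ln q) \<le> exp (b * ln q * ln (real n))" by (simp add: mult_ac)
    have "prob (F n) = exp (real (r n) * ln q)" using q' by (simp add: F exp_of_nat_mult)
    also note le
    also have "exp (b * ln q * ln (real n)) = real n powr (b * ln q)" using n by (simp add: powr_def)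
    finally show ?thesis .
  qed
  have "summable (\<lambda>n. prob (F n))"
  proof (rule summable_comparison_test')
    show "summable (\<lambda>n. real n powr (b * ln q))" using q' by (simp only: summable_real_powr_iff)
    show "norm (prob (F n)) \<le> real n powr (b * ln q)" if "1 \<le> n" for n
      using bound[OF that] unfolding real_norm_def abs_of_nonneg[OF measure_nonneg] .
  qed
  then have "AE x in M. \<forall>\<^sub>F n in sequentially. x \<in> space M - F n"
    by (intro borel_cantelli_AE1 F(1)) (simp_all add: emeasure_eq_measure)
  then show ?thesis
  proof (rule AE_mp, intro AE_I2 impI)
    fix x assume x: "x \<in> space M" and "\<forall>\<^sub>F n in sequentially. x \<in> space M - F n"
    then obtain n0 where n0: "\<And>n. n0 \<le> n \<Longrightarrow> x \<notin> F n" unfolding eventually_sequentially by auto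
    have "filterlim (\<lambda>L. b * ln (real L)) at_top sequentially" using b by real_asymp
    then have "\<forall>\<^sub>F L in sequentially. real (n0 + 1) \<le> b * ln (real L)" by (simp add: filterlim_at_top)
    then show "\<forall>\<^sub>F L in sequentially. \<forall>n. n + nat \<lceil>b * ln (real L)\<rceil> \<le> L \<longrightarrow>
           (\<exists>j. n \<le> j \<and> j < n + nat \<lceil>b * ln (real L)\<rceil> \<and> \<omega> (int j) x \<notin> A)"
    proof eventually_elim
      case (elim L)
      have rL: "n0 + 1 \<le> r L"
      proof -
        have "b * ln (real L) \<le> real (r L)" unfolding r_def by (rule real_nat_ceiling_ge)
        with elim have "real (n0 + 1) \<le> real (r L)" by linarith
        then show ?thesis by (simp only: of_nat_le_iff)
      qed
      show ?case unfolding r_def[symmetric]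
      proof (intro allI impI)
        fix n assume n: "n + r L \<le> L"
        \<comment> \<open>the last cell of the window; it lies beyond \<open>n0\<close> because \<open>r L > n0\<close>\<close>
        define e where "e = n + r L - 1"
        have e: "n0 \<le> e" "e < L" using rL n by (auto simp: e_def)
        have "r e \<le> r L"
        proof -
          have "ln (real e) \<le> ln (real L)"
            using e by (cases "e = 0") (auto intro: ln_mono simp: not_le)
          then show ?thesis unfolding r_def using b by (intro nat_mono ceiling_mono mult_left_mono) auto
        qed
        from n0[OF e(1)] x obtain j where j: "int e - int (r e) + 1 \<le> j" "j \<le> int e" "\<omega> j x \<notin> A"
          by (auto simp: F_def)
        have "int n \<le> j" using j(1) \<open>r e \<le> r L\<close> rL by (simp add: e_def of_nat_diff)
        then show "\<exists>j. n \<le> j \<and> j < n + r L \<and> \<omega> (int j) x \<notin> A"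
          using j rL by (intro exI[of _ "nat j"]) (auto simp: e_def nat_less_iff le_nat_iff)
      qed
    qed
  qed
qed

text \<open>
  With \<open>r\<close> about \<open>a ln n\<close> there are nearly \<open>n/r\<close> disjoint blocks of length \<open>r\<close>. Each lies in the event
  with probability \<open>q\<^sup>r\<close>, which is at least \<open>n\<close> to the power \<open>-c\<close> with \<open>c = -a ln q < 1\<close>. The expected
  number of such blocks is at least a positive power of \<open>n\<close> up to logarithms, and the probability that
  there is none is summable.
\<close>

lemma AE_eventually_long_run:
  fixes \<omega> :: "int \<Rightarrow> 'a \<Rightarrow> real"
  assumes indep: "indep_vars (\<lambda>_. borel) \<omega> UNIV"
    and ident: "\<And>j. distr M borel (\<omega> j) = distr M borel (\<omega> 0)"
    and A: "A \<in> sets borel" and q: "0 < prob {x \<in> space M. \<omega> 0 x \<in> A}"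
    and a: "0 < a" and rate: "- 1 < a * ln (prob {x \<in> space M. \<omega> 0 x \<in> A})"
  shows "AE x in M. \<forall>\<^sub>F L in sequentially. \<exists>n. n + nat \<lfloor>a * ln (real L)\<rfloor> \<le> L \<and>
           (\<forall>j. n \<le> j \<and> j < n + nat \<lfloor>a * ln (real L)\<rfloor> \<longrightarrow> \<omega> (int j) x \<in> A)"
proof -
  define q where "q = prob {x \<in> space M. \<omega> 0 x \<in> A}"
  define r where "r n = nat \<lfloor>a * ln (real n)\<rfloor>" for n :: nat
  define F where "F n = {x \<in> space M. \<forall>i<n div r n. \<not> (\<forall>j\<in>{int (i * r n)..<int (Suc i * r n)}. \<omega> j x \<in> A)}" for n
  define c where "c = - (a * ln q)"
  have q': "0 < q" "q \<le> 1" using q by (auto simp: q_def)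
  have c: "0 \<le> c" "c < 1" using rate q' a by (auto simp: c_def q_def mult_le_0_iff)
  have F: "prob (F n) = (1 - q ^ r n) ^ (n div r n)" for n
    unfolding F_def q_def by (rule iid_prob_no_block[OF indep ident A])
  have Fe: "F n \<in> events" for n
  proof -
    have "{x \<in> space M. \<forall>j\<in>{int (i * r n)..<int (Suc i * r n)}. \<omega> j x \<in> A} \<in> events" for i
      by (rule iid_prob_all(1)[OF indep ident _ A]) simp
    from sets.sets_Collect_neg[OF this]
    have "{x \<in> space M. \<forall>i\<in>{..<n div r n}. \<not> (\<forall>j\<in>{int (i * r n)..<int (Suc i * r n)}. \<omega> j x \<in> A)} \<in> events"
      by (intro sets.sets_Collect_finite_All finite_lessThan)
    then show ?thesis by (simp only: F_def Ball_def lessThan_iff)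
  qed
  define d where "d = 1 - c"
  have d: "0 < d" using c by (simp add: d_def)
  have "\<forall>\<^sub>F n in sequentially. 2 * ln (real n) + 1 \<le> real n powr d / (a * ln (real n))"
    using a d by real_asymp
  then have "\<forall>\<^sub>F n in sequentially. 2 * ln (real n) \<le> real n powr (- c) * (real n / (a * ln (real n)) - 1)"
    using eventually_gt_at_top[of 0]
  proof eventually_elim
    case (elim n)
    have "real n powr d = real n powr (- c) * real n" using elim by (simp add: d_def powr_diff powr_minus field_simps)
    moreover have "real n powr (- c) \<le> 1" using elim c powr_mono[of "- c" 0 "real n"] by simp
    ultimately show ?case using elim by (simp add: right_diff_distrib)
  qed
  moreover have "\<forall>\<^sub>F n in sequentially. 1 \<le> a * ln (real n)" using a by real_asymp
  ultimately have "\<forall>\<^sub>F n in sequentially. norm (prob (F n)) \<le> real n powr (- 2)"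
    using eventually_gt_at_top[of 0]
  proof eventually_elim
    case (elim n)
    have r: "1 \<le> r n" "real (r n) \<le> a * ln (real n)"
      using elim(2) by (auto simp: r_def le_nat_iff le_floor_iff)
    have div: "real n / (a * ln (real n)) - 1 \<le> real (n div r n)"
    proof -
      have "real n / (a * ln (real n)) \<le> real n / real (r n)" using r elim by (intro divide_left_mono) auto
      moreover have "real n / real (r n) - 1 \<le> real (n div r n)"
      proof -
        have "\<lfloor>real n / real (r n)\<rfloor> = int (n div r n)" by (rule floor_divide_of_nat_eq)
        then show ?thesis by linarith
      qed
      ultimately show ?thesis by linarith
    qed
    have pow: "real n powr (- c) \<le> q ^ r n"
    proof -
      have "a * ln (real n) * ln q \<le> real (r n) * ln q" using r q' by (intro mult_right_mono_neg) auto
      then have le: "exp (a * ln (real n) * ln q) \<le> exp (real (r n) * ln q)" by simp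
      have "real n powr (- c) = exp (a * ln (real n) * ln q)" using elim by (simp add: powr_def c_def mult_ac)
      also note le
      also have "exp (real (r n) * ln q) = q ^ r n" using q' by (simp add: exp_of_nat_mult)
      finally show ?thesis .
    qed
    have "1 - q ^ r n \<le> exp (- (q ^ r n))" using exp_ge_add_one_self[of "- (q ^ r n)"] by simp
    then have "prob (F n) \<le> exp (- (q ^ r n)) ^ (n div r n)"
      unfolding F using q' by (intro power_mono) (auto simp: power_le_one)
    also have "\<dots> = exp (- (q ^ r n * real (n div r n)))" by (simp add: exp_of_nat_mult[symmetric] mult.commute)
    also have "\<dots> \<le> exp (- (2 * ln (real n)))"
    proof -
      have "2 * ln (real n) \<le> real n powr (- c) * (real n / (a * ln (real n)) - 1)" by (rule elim(1))
      also have "\<dots> \<le> real n powr (- c) * real (n div r n)" using div by (intro mult_left_mono) auto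
      also have "\<dots> \<le> q ^ r n * real (n div r n)" using pow by (intro mult_right_mono) auto
      finally show ?thesis by simp
    qed
    also have "\<dots> = real n powr (- 2)" using elim by (simp add: powr_def)
    finally show ?case by simp
  qed
  then have "summable (\<lambda>n. prob (F n))"
    by (rule summable_comparison_test_ev) (simp add: summable_real_powr_iff)
  then have "AE x in M. \<forall>\<^sub>F n in sequentially. x \<in> space M - F n"
    by (intro borel_cantelli_AE1 Fe) (simp_all add: emeasure_eq_measure)
  then show ?thesis
  proof (rule AE_mp, intro AE_I2 impI)
    fix x assume "\<forall>\<^sub>F n in sequentially. x \<in> space M - F n"
    then show "\<forall>\<^sub>F L in sequentially. \<exists>n. n + nat \<lfloor>a * ln (real L)\<rfloor> \<le> L \<and>
           (\<forall>j. n \<le> j \<and> j < n + nat \<lfloor>a * ln (real L)\<rfloor> \<longrightarrow> \<omega> (int j) x \<in> A)"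
    proof eventually_elim
      case (elim L)
      then obtain i where i: "i < L div r L" "\<And>j. j \<in> {int (i * r L)..<int (Suc i * r L)} \<Longrightarrow> \<omega> j x \<in> A"
        by (auto simp: F_def)
      have "Suc i * r L \<le> L div r L * r L" using i by (intro mult_right_mono) auto
      also have "\<dots> \<le> L" by simp
      finally have "i * r L + r L \<le> L" by simp
      moreover have "\<omega> (int j) x \<in> A" if "i * r L \<le> j" "j < i * r L + r L" for j
      proof (rule i(2))
        have "int (i * r L) \<le> int j" "int j < int (Suc i * r L)"
          using that by (simp_all only: of_nat_le_iff of_nat_less_iff mult_Suc add.commute)
        then show "int j \<in> {int (i * r L)..<int (Suc i * r L)}" by simp
      qed
      ultimately show ?case unfolding r_def[symmetric] by (intro exI[of _ "i * r L"]) auto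
    qed
  qed
qed

lemma prob_below_tendsto:
  fixes X :: "'a \<Rightarrow> real"
  assumes X: "random_variable borel X" and nonneg: "AE x in M. 0 \<le> X x"
  shows "(\<lambda>n. prob {x \<in> space M. X x \<in> {..<1 / real (Suc n)}}) \<longlonglongrightarrow> prob {x \<in> space M. X x = 0}"
proof -
  let ?A = "\<lambda>n. {x \<in> space M. X x \<in> {..<1 / real (Suc n)}}"
  have [measurable]: "X \<in> borel_measurable M" by (rule X)
  have "(\<lambda>n. prob (?A n)) \<longlonglongrightarrow> prob (\<Inter>n. ?A n)"
  proof (rule finite_Lim_measure_decseq)
    show "range ?A \<subseteq> events" by (auto simp: greaterThan_def)
    show "decseq ?A"
    proof (rule decseq_SucI)
      fix n
      have "1 / real (Suc (Suc n)) \<le> 1 / real (Suc n)" by (simp add: field_simps)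
      then show "?A (Suc n) \<subseteq> ?A n" by auto
    qed
  qed
  also have "prob (\<Inter>n. ?A n) = prob {x \<in> space M. X x = 0}"
  proof (rule measure_eq_AE)
    show "AE x in M. (x \<in> (\<Inter>n. ?A n)) = (x \<in> {x \<in> space M. X x = 0})"
      using nonneg
    proof eventually_elim
      case (elim x)
      have "X x \<le> 0" if "\<And>n. X x < 1 / real (Suc n)"
      proof (rule ccontr)
        assume "\<not> X x \<le> 0"
        then obtain n where "1 / real (Suc n) < X x" using nat_approx_posE[of "X x"] by auto
        with that[of n] show False by simp
      qed
      with elim show ?case by auto
    qed
  qed auto
  finally show ?thesis .
qed

end

section \<open>The limit of the ratio\<close>

text \<open>
  The interior of an interval on which the potential vanishes meets every cell between the floor of
  its left end and the ceiling of its right end. The end points do not matter for the length, and the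
  right one, if it is not part of the interval, may lie in a cell with a positive value.
\<close>

lemma zero_interval_in_zero_run:
  fixes w :: "int \<Rightarrow> real" and L :: nat
  assumes I: "is_interval I" "I \<subseteq> {0..real L}" and zero: "\<And>x. x \<in> I \<Longrightarrow> w \<lfloor>x\<rfloor> = 0"
  obtains a R :: nat where "a + R \<le> L" "\<And>j. a \<le> j \<Longrightarrow> j < a + R \<Longrightarrow> w (int j) = 0"
    "measure lborel I \<le> real R"
proof (cases "measure lborel I \<le> 0")
  case True
  then show ?thesis using that[of 0 0] by simp
next
  case False
  then have sets: "I \<in> sets lborel" using measure_notin_sets[of I lborel] by force
  have ne: "I \<noteq> {}" using False by auto
  define c where "c = Inf I"
  define d where "d = Sup I"
  have bdd: "bdd_below I" "bdd_above I" using I(2) by (auto intro: bdd_below_mono bdd_above_mono)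
  have c0: "0 \<le> c" unfolding c_def using I(2) ne by (intro cInf_greatest) auto
  have dL: "d \<le> real L" unfolding d_def using I(2) ne by (intro cSup_least) auto
  have sub: "I \<subseteq> {c..d}"
    using cInf_lower[OF _ bdd(1)] cSup_upper[OF _ bdd(2)] by (auto simp: c_def d_def)
  have cd: "c \<le> d" using sub ne by auto
  have "measure lborel I \<le> measure lborel {c..d}"
    by (rule measure_mono_fmeasurable[OF sub sets]) (simp add: fmeasurable_def cd)
  also have "\<dots> = d - c" using cd by simp
  finally have le: "measure lborel I \<le> d - c" .
  then have cd': "c < d" using False by simp
  have mem: "x \<in> I" if x: "c < x" "x < d" for x
  proof -
    obtain y where "y \<in> I" "y < x" using cInf_lessD[OF ne, of x] x(1) unfolding c_def by blast
    moreover obtain z where "z \<in> I" "x < z" using less_cSupD[OF ne, of x] x(2) unfolding d_def by blast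
    ultimately show ?thesis using I(1) unfolding is_interval_1 by (meson less_imp_le)
  qed
  define a where "a = nat \<lfloor>c\<rfloor>"
  define R where "R = nat \<lceil>d\<rceil> - a"
  have a: "int a = \<lfloor>c\<rfloor>" using c0 by (simp add: a_def)
  have dd: "int (nat \<lceil>d\<rceil>) = \<lceil>d\<rceil>" using c0 cd' by simp
  have ad: "a \<le> nat \<lceil>d\<rceil>" using cd' c0 unfolding a_def by (intro nat_mono) linarith
  have aR: "int a + int R = \<lceil>d\<rceil>" using ad dd by (simp add: R_def)
  show ?thesis
  proof (rule that[of a R])
    have "\<lceil>d\<rceil> \<le> int L" using dL by (simp add: ceiling_le_iff)
    then show "a + R \<le> L" using aR by linarith
    have "d - c \<le> real_of_int \<lceil>d\<rceil> - real_of_int \<lfloor>c\<rfloor>" by linarith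
    also have "\<dots> = real R" using aR a by (metis add_diff_cancel_left' of_int_diff of_int_of_nat_eq)
    finally show "measure lborel I \<le> real R" using le by simp
  next
    fix j assume j: "a \<le> j" "j < a + R"
    have "c < real j + 1" using j(1) a by linarith
    moreover have "real j < d"
    proof -
      have "int j < \<lceil>d\<rceil>" using j(2) aR by linarith
      then show ?thesis by (simp add: less_ceiling_iff)
    qed
    ultimately have "max c (real j) < min d (real j + 1)" using cd' by auto
    then obtain x where x: "max c (real j) < x" "x < min d (real j + 1)" using dense by blast
    then have "\<lfloor>x\<rfloor> = int j" by (intro floor_unique) auto
    with zero[of x] mem[of x] x show "w (int j) = 0" by auto
  qed
qed

definition longest_zero_run :: "(int \<Rightarrow> real) \<Rightarrow> nat \<Rightarrow> nat \<Rightarrow> nat \<Rightarrow> bool" where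
  "longest_zero_run w L a R \<longleftrightarrow> a + R \<le> L \<and> (\<forall>j. a \<le> j \<and> j < a + R \<longrightarrow> w (int j) = 0) \<and>
     (\<forall>b r. b + r \<le> L \<and> (\<forall>j. b \<le> j \<and> j < b + r \<longrightarrow> w (int j) = 0) \<longrightarrow> r \<le> R)"

text \<open>
  The maximum over all intervals is attained, because a run of cells is itself an admissible
  half-open interval and no interval is longer than some run. It is a whole number of cells.
\<close>

lemma longest_zero_interval_eq_run:
  "\<exists>a R. longest_zero_run w L a R \<and> longest_zero_interval (real L) w = real R"
proof -
  define P where "P r \<longleftrightarrow> (\<exists>b. b + r \<le> L \<and> (\<forall>j. b \<le> j \<longrightarrow> j < b + r \<longrightarrow> w (int j) = 0))" for r
  have fin: "finite (Collect P)" by (rule finite_subset[of _ "{..L}"]) (auto simp: P_def)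
  have "P 0" by (auto simp: P_def)
  define R where "R = Max (Collect P)"
  have "P R" using Max_in[OF fin] \<open>P 0\<close> by (auto simp: R_def)
  then obtain a where a: "a + R \<le> L" "\<And>j. a \<le> j \<Longrightarrow> j < a + R \<Longrightarrow> w (int j) = 0"
    by (auto simp: P_def)
  have max: "r \<le> R" if "b + r \<le> L" "\<And>j. b \<le> j \<Longrightarrow> j < b + r \<Longrightarrow> w (int j) = 0" for b r
    unfolding R_def by (rule Max_ge[OF fin]) (use that in \<open>auto simp: P_def\<close>)
  have "longest_zero_interval (real L) w = real R"
    unfolding longest_zero_interval_def anderson_potential_eq
  proof (rule Greatest_equality)
    show "\<exists>I. is_interval I \<and> I \<subseteq> {0..real L} \<and> (\<forall>x\<in>I. w \<lfloor>x\<rfloor> = 0) \<and> real R = measure lborel I"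
    proof (intro exI conjI ballI)
      show "is_interval {real a..<real (a + R)}" by (auto simp: is_interval_1)
      show "{real a..<real (a + R)} \<subseteq> {0..real L}" using a(1) by auto
      show "real R = measure lborel {real a..<real (a + R)}" by simp
      fix x assume x: "x \<in> {real a..<real (a + R)}"
      then have "a \<le> nat \<lfloor>x\<rfloor>" "nat \<lfloor>x\<rfloor> < a + R"
        by (auto simp: le_nat_iff nat_less_iff le_floor_iff floor_less_iff)
      with a(2)[of "nat \<lfloor>x\<rfloor>"] show "w \<lfloor>x\<rfloor> = 0" using x by simp
    qed
  next
    fix l assume "\<exists>I. is_interval I \<and> I \<subseteq> {0..real L} \<and> (\<forall>x\<in>I. w \<lfloor>x\<rfloor> = 0) \<and> l = measure lborel I"
    then obtain I where I: "is_interval I" "I \<subseteq> {0..real L}" "\<And>x. x \<in> I \<Longrightarrow> w \<lfloor>x\<rfloor> = 0" "l = measure lborel I"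
      by blast
    obtain b r :: nat where "b + r \<le> L" "\<And>j. b \<le> j \<Longrightarrow> j < b + r \<Longrightarrow> w (int j) = 0" "measure lborel I \<le> real r"
      by (rule zero_interval_in_zero_run[of I L w, OF I(1,2,3)]) (assumption | rule that; assumption)+
    moreover from max[OF this(1,2)] have "r \<le> R" .
    ultimately show "l \<le> real R" using I(4) by simp
  qed
  moreover have "longest_zero_run w L a R" using a max unfolding longest_zero_run_def by blast
  ultimately show ?thesis by blast
qed

text \<open>
  For a fixed realization: for each \<open>\<delta>\<close> the explicit bounds converge as \<open>L \<rightarrow> \<infinity>\<close> to \<open>\<pi>\<^sup>2/8\<close> times a power
  of \<open>1 + \<delta>\<close>, and \<open>\<delta>\<close> is arbitrary.
\<close>

lemma ratio_tendsto_of_barriers: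
  fixes w :: "int \<Rightarrow> real" and k :: "nat \<Rightarrow> real" and a R :: "nat \<Rightarrow> nat"
  assumes w: "\<And>j. 0 \<le> w j" and k: "\<And>L. 1 \<le> L \<Longrightarrow> 0 < k L"
    and run: "\<And>L. a L + R L \<le> L" "\<And>L j. a L \<le> j \<Longrightarrow> j < a L + R L \<Longrightarrow> w (int j) = 0"
    and kR: "filterlim (\<lambda>L. k L * real (R L)) at_top sequentially"
    and barrier: "\<And>\<delta>. 0 < \<delta> \<Longrightarrow> \<exists>\<epsilon>>0. \<forall>\<^sub>F L in sequentially. \<exists>m. real m + 1 \<le> (1 + \<delta>) * real (R L) \<and>
      (\<forall>n. n + m \<le> L \<longrightarrow> (\<exists>j. n \<le> j \<and> j < n + m \<and> \<epsilon> \<le> w (int j)))"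
  shows "(\<lambda>L. eigenvalue_landscape_ratio (real L) (k L) w) \<longlonglongrightarrow> pi\<^sup>2 / 8"
proof -
  have key: "\<exists>s. s \<longlonglongrightarrow> 0 \<and> (\<forall>\<^sub>F L in sequentially.
      eigenvalue_landscape_ratio (real L) (k L) w \<le> pi\<^sup>2 / 8 * (1 + \<delta>)\<^sup>2 / (1 - 16 * s L) \<and>
      (arccos (28 * s L))\<^sup>2 / 2 * (1 / (1 + \<delta>))\<^sup>2 \<le> eigenvalue_landscape_ratio (real L) (k L) w)"
    if \<delta>: "0 < \<delta>" for \<delta>
  proof -
    obtain \<epsilon> where \<epsilon>: "0 < \<epsilon>" and ev: "\<forall>\<^sub>F L in sequentially. \<exists>m. real m + 1 \<le> (1 + \<delta>) * real (R L) \<and>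
      (\<forall>n. n + m \<le> L \<longrightarrow> (\<exists>j. n \<le> j \<and> j < n + m \<and> \<epsilon> \<le> w (int j)))"
      using barrier[OF \<delta>] by blast
    define s where "s L = 1 / (k L * \<epsilon> * real (R L))" for L
    have s: "s \<longlonglongrightarrow> 0"
    proof -
      have "(\<lambda>L. (1 / \<epsilon>) * inverse (k L * real (R L))) \<longlonglongrightarrow> (1 / \<epsilon>) * 0"
        by (intro tendsto_mult tendsto_const tendsto_inverse_0_at_top kR)
      then show ?thesis by (simp add: s_def[abs_def] field_simps)
    qed
    then have "\<forall>\<^sub>F L in sequentially. s L < 1 / 28" by (rule order_tendstoD) simp
    with ev eventually_ge_at_top[of 1]
    have "\<forall>\<^sub>F L in sequentially.
      eigenvalue_landscape_ratio (real L) (k L) w \<le> pi\<^sup>2 / 8 * (1 + \<delta>)\<^sup>2 / (1 - 16 * s L) \<and>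
      (arccos (28 * s L))\<^sup>2 / 2 * (1 / (1 + \<delta>))\<^sup>2 \<le> eigenvalue_landscape_ratio (real L) (k L) w"
    proof eventually_elim
      case (elim L)
      then obtain m where m: "real m + 1 \<le> (1 + \<delta>) * real (R L)"
        and bar: "\<And>n. n + m \<le> L \<Longrightarrow> \<exists>j. n \<le> j \<and> j < n + m \<and> \<epsilon> \<le> w (int j)" by blast
      have R: "0 < R L" using m by (cases "R L = 0") auto
      have s1: "16 * s L < 1" "28 * s L \<le> 1" using elim by auto
      note b = eigenvalue_landscape_ratio_bounds[of w "R L" "a L" L "k L" \<epsilon> m "s L",
          OF w R run(1) run(2)[of L] k[OF elim(2)] \<epsilon> bar s_def]
      have q: "(real m + 1) / real (R L) \<le> 1 + \<delta>" using m R by (simp add: pos_divide_le_eq)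
      have up: "eigenvalue_landscape_ratio (real L) (k L) w
          \<le> pi\<^sup>2 / 8 * ((real m + 1) / real (R L))\<^sup>2 / (1 - 16 * s L)"
        using b(1) s1 by blast
      also have "\<dots> \<le> pi\<^sup>2 / 8 * (1 + \<delta>)\<^sup>2 / (1 - 16 * s L)"
        using q s1 by (intro divide_right_mono mult_left_mono power_mono) auto
      finally have 1: "eigenvalue_landscape_ratio (real L) (k L) w \<le> pi\<^sup>2 / 8 * (1 + \<delta>)\<^sup>2 / (1 - 16 * s L)" .
      have "1 / (1 + \<delta>) \<le> real (R L) / (real m + 1)" using m \<delta> R by (simp add: divide_simps mult.commute)
      then have "(arccos (28 * s L))\<^sup>2 / 2 * (1 / (1 + \<delta>))\<^sup>2 \<le> (arccos (28 * s L))\<^sup>2 / 2 * (real (R L) / (real m + 1))\<^sup>2"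
        using \<delta> by (intro mult_left_mono power_mono) auto
      also have "\<dots> \<le> eigenvalue_landscape_ratio (real L) (k L) w" using b(2) s1 by blast
      finally show ?case using 1 by blast
    qed
    with s show ?thesis by blast
  qed
  show ?thesis
  proof (rule order_tendstoI)
    fix y :: real assume y: "pi\<^sup>2 / 8 < y"
    have "((\<lambda>\<delta>. pi\<^sup>2 / 8 * (1 + \<delta>)\<^sup>2) \<longlongrightarrow> pi\<^sup>2 / 8 * (1 + 0)\<^sup>2) (at_right 0)" by (intro tendsto_intros)
    then have "\<forall>\<^sub>F \<delta> in at_right 0. pi\<^sup>2 / 8 * (1 + \<delta>)\<^sup>2 < y" using y by (intro order_tendstoD) auto
    with eventually_at_right_less[of 0] have "\<forall>\<^sub>F \<delta> in at_right 0. 0 < \<delta> \<and> pi\<^sup>2 / 8 * (1 + \<delta>)\<^sup>2 < y"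
      by (rule eventually_conj)
    then obtain \<delta> :: real where \<delta>: "0 < \<delta>" "pi\<^sup>2 / 8 * (1 + \<delta>)\<^sup>2 < y"
      using eventually_happens' trivial_limit_at_right_real by blast
    obtain s where s: "s \<longlonglongrightarrow> 0" and ev: "\<forall>\<^sub>F L in sequentially.
        eigenvalue_landscape_ratio (real L) (k L) w \<le> pi\<^sup>2 / 8 * (1 + \<delta>)\<^sup>2 / (1 - 16 * s L)"
      using key[OF \<delta>(1)] by (auto simp: eventually_conj_iff)
    have "(\<lambda>L. pi\<^sup>2 / 8 * (1 + \<delta>)\<^sup>2 / (1 - 16 * s L)) \<longlonglongrightarrow> pi\<^sup>2 / 8 * (1 + \<delta>)\<^sup>2 / (1 - 16 * 0)"
      by (intro tendsto_intros s) auto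
    then have "\<forall>\<^sub>F L in sequentially. pi\<^sup>2 / 8 * (1 + \<delta>)\<^sup>2 / (1 - 16 * s L) < y"
      using \<delta>(2) by (intro order_tendstoD) auto
    with ev show "\<forall>\<^sub>F L in sequentially. eigenvalue_landscape_ratio (real L) (k L) w < y"
      by eventually_elim (rule le_less_trans)
  next
    fix y :: real assume y: "y < pi\<^sup>2 / 8"
    have "((\<lambda>\<delta>. pi\<^sup>2 / 8 * (1 / (1 + \<delta>))\<^sup>2) \<longlongrightarrow> pi\<^sup>2 / 8 * (1 / (1 + 0))\<^sup>2) (at_right 0)"
      by (intro tendsto_intros) auto
    then have "\<forall>\<^sub>F \<delta> in at_right 0. y < pi\<^sup>2 / 8 * (1 / (1 + \<delta>))\<^sup>2" using y by (intro order_tendstoD) auto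
    with eventually_at_right_less[of 0] have "\<forall>\<^sub>F \<delta> in at_right 0. 0 < \<delta> \<and> y < pi\<^sup>2 / 8 * (1 / (1 + \<delta>))\<^sup>2"
      by (rule eventually_conj)
    then obtain \<delta> :: real where \<delta>: "0 < \<delta>" "y < pi\<^sup>2 / 8 * (1 / (1 + \<delta>))\<^sup>2"
      using eventually_happens' trivial_limit_at_right_real by blast
    obtain s where s: "s \<longlonglongrightarrow> 0" and ev: "\<forall>\<^sub>F L in sequentially.
        (arccos (28 * s L))\<^sup>2 / 2 * (1 / (1 + \<delta>))\<^sup>2 \<le> eigenvalue_landscape_ratio (real L) (k L) w"
      using key[OF \<delta>(1)] by (auto simp: eventually_conj_iff)
    have "isCont arccos 0" by (rule isCont_arccos) auto
    moreover have "(\<lambda>L. 28 * s L) \<longlonglongrightarrow> 0" using tendsto_mult_left[OF s, of 28] by simp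
    ultimately have "(\<lambda>L. arccos (28 * s L)) \<longlonglongrightarrow> arccos 0" by (rule isCont_tendsto_compose)
    then have "(\<lambda>L. (arccos (28 * s L))\<^sup>2 / 2 * (1 / (1 + \<delta>))\<^sup>2) \<longlonglongrightarrow> (arccos 0)\<^sup>2 / 2 * (1 / (1 + \<delta>))\<^sup>2"
      by (intro tendsto_intros) auto
    moreover have "(arccos 0)\<^sup>2 / 2 = pi\<^sup>2 / 8" by (simp add: power_divide)
    ultimately have "(\<lambda>L. (arccos (28 * s L))\<^sup>2 / 2 * (1 / (1 + \<delta>))\<^sup>2) \<longlonglongrightarrow> pi\<^sup>2 / 8 * (1 / (1 + \<delta>))\<^sup>2"
      by (simp only:)
    then have "\<forall>\<^sub>F L in sequentially. y < (arccos (28 * s L))\<^sup>2 / 2 * (1 / (1 + \<delta>))\<^sup>2"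
      using \<delta>(2) by (rule order_tendstoD)
    with ev show "\<forall>\<^sub>F L in sequentially. y < eigenvalue_landscape_ratio (real L) (k L) w"
      by eventually_elim (rule less_le_trans)
  qed
qed

context prob_space
begin

text \<open>
  In units of \<open>ln L / ln (1/p)\<close>, zero runs of length slightly below \<open>1\<close> exist, and runs of \<open>\<omega> < \<epsilon>\<close> of
  length slightly above \<open>1\<close> do not, provided that \<open>P(\<omega> < \<epsilon>)\<close> is close enough to \<open>p\<close>.
\<close>

lemma AE_barriers_comparable_to_zero_run:
  fixes \<omega> :: "int \<Rightarrow> 'a \<Rightarrow> real"
  assumes indep: "indep_vars (\<lambda>_. borel) \<omega> UNIV"
    and ident: "\<And>j. distr M borel (\<omega> j) = distr M borel (\<omega> 0)"
    and nonneg: "AE x in M. 0 \<le> \<omega> 0 x"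
    and p: "0 < prob {x \<in> space M. \<omega> 0 x = 0}" "prob {x \<in> space M. \<omega> 0 x = 0} < 1"
    and \<delta>: "0 < \<delta>"
  shows "\<exists>\<epsilon>>0. AE x in M. \<forall>\<^sub>F L in sequentially. \<exists>m b r. real m + 1 \<le> (1 + \<delta>) * real r \<and>
    b + r \<le> L \<and> (\<forall>j. b \<le> j \<and> j < b + r \<longrightarrow> \<omega> (int j) x = 0) \<and>
    (\<forall>n. n + m \<le> L \<longrightarrow> (\<exists>j. n \<le> j \<and> j < n + m \<and> \<epsilon> \<le> \<omega> (int j) x))"
proof -
  define l where "l = - ln (prob {x \<in> space M. \<omega> 0 x = 0})"
  have l: "0 < l" using p by (simp add: l_def)
  \<comment> \<open>\<open>\<theta>\<close> divides the leeway \<open>1 + \<delta>\<close>: one part brings \<open>b l\<close> above \<open>1\<close>, the other \<open>a l\<close> below\<close>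
  define \<theta> where "\<theta> = (1 + \<delta> / 2) / (1 + \<delta>)"
  define b where "b = (1 + \<delta> / 2) / l"
  define a where "a = (\<theta> + 1) / 2 / l"
  have \<theta>: "0 < \<theta>" "\<theta> < 1" "(1 + \<delta>) * \<theta> = 1 + \<delta> / 2" using \<delta> by (auto simp: \<theta>_def)
  have ab: "0 < a" "0 < b" "a * l < 1" "1 < b * l" using l \<delta> \<theta> by (auto simp: a_def b_def)
  have "b = (1 + \<delta>) * (\<theta> / l)" using \<theta>(3) by (simp add: b_def)
  also have "\<dots> < (1 + \<delta>) * a"
    unfolding a_def using \<theta> l \<delta> by (intro mult_strict_left_mono divide_strict_right_mono) auto
  finally have ba: "b < (1 + \<delta>) * a" .
  have rv: "random_variable borel (\<omega> 0)" using indep by (auto simp: indep_vars_def)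
  let ?q = "\<lambda>n. prob {x \<in> space M. \<omega> 0 x \<in> {..<1 / real (Suc n)}}"
  have "(\<lambda>n. b * ln (?q n)) \<longlonglongrightarrow> b * ln (prob {x \<in> space M. \<omega> 0 x = 0})"
    using p by (intro tendsto_intros prob_below_tendsto rv nonneg) auto
  then have "\<forall>\<^sub>F n in sequentially. b * ln (?q n) < - 1"
    by (rule order_tendstoD) (use ab in \<open>simp add: l_def\<close>)
  then obtain N where N: "b * ln (?q N) < - 1"
    using eventually_happens' sequentially_bot by blast
  define \<epsilon> where "\<epsilon> = 1 / real (Suc N)"
  have \<epsilon>: "0 < \<epsilon>" by (simp add: \<epsilon>_def)
  have [measurable]: "\<omega> 0 \<in> borel_measurable M" by (rule rv)
  have q: "0 < prob {x \<in> space M. \<omega> 0 x \<in> {..<\<epsilon>}}"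
  proof (rule less_le_trans[OF p(1)])
    show "prob {x \<in> space M. \<omega> 0 x = 0} \<le> prob {x \<in> space M. \<omega> 0 x \<in> {..<\<epsilon>}}"
      using \<epsilon> by (intro finite_measure_mono) auto
  qed
  have upper: "AE x in M. \<forall>\<^sub>F L in sequentially. \<forall>n. n + nat \<lceil>b * ln (real L)\<rceil> \<le> L \<longrightarrow>
           (\<exists>j. n \<le> j \<and> j < n + nat \<lceil>b * ln (real L)\<rceil> \<and> \<omega> (int j) x \<notin> {..<\<epsilon>})"
    by (rule AE_eventually_no_long_run[OF indep ident _ q ab(2)]) (use N in \<open>auto simp: \<epsilon>_def\<close>)
  have lower: "AE x in M. \<forall>\<^sub>F L in sequentially. \<exists>n. n + nat \<lfloor>a * ln (real L)\<rfloor> \<le> L \<and>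
           (\<forall>j. n \<le> j \<and> j < n + nat \<lfloor>a * ln (real L)\<rfloor> \<longrightarrow> \<omega> (int j) x \<in> {0})"
    by (rule AE_eventually_long_run[OF indep ident _ _ ab(1)]) (use p ab in \<open>auto simp: l_def\<close>)
  have comparable: "\<forall>\<^sub>F L in sequentially. real (nat \<lceil>b * ln (real L)\<rceil>) + 1 \<le> (1 + \<delta>) * real (nat \<lfloor>a * ln (real L)\<rfloor>)"
  proof -
    define e where "e = (1 + \<delta>) * a - b"
    have e: "0 < e" using ba by (simp add: e_def)
    have "\<forall>\<^sub>F L in sequentially. 3 + \<delta> \<le> e * ln (real L)" using e by real_asymp
    moreover have "\<forall>\<^sub>F L in sequentially. 0 \<le> ln (real L)" by real_asymp
    ultimately show ?thesis
    proof eventually_elim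
      case (elim L)
      have 1: "real (nat \<lceil>b * ln (real L)\<rceil>) \<le> b * ln (real L) + 1"
      proof -
        have "0 \<le> b * ln (real L)" using ab elim by simp
        then show ?thesis by linarith
      qed
      have "a * ln (real L) - 1 \<le> real (nat \<lfloor>a * ln (real L)\<rfloor>)" by linarith
      then have "(1 + \<delta>) * (a * ln (real L) - 1) \<le> (1 + \<delta>) * real (nat \<lfloor>a * ln (real L)\<rfloor>)"
        using \<delta> by (intro mult_left_mono) auto
      moreover have "(1 + \<delta>) * (a * ln (real L) - 1) = e * ln (real L) + b * ln (real L) - 1 - \<delta>"
        by (simp add: e_def algebra_simps)
      ultimately show ?case using 1 elim by linarith
    qed
  qed
  have "AE x in M. \<forall>\<^sub>F L in sequentially. \<exists>m b r. real m + 1 \<le> (1 + \<delta>) * real r \<and>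
    b + r \<le> L \<and> (\<forall>j. b \<le> j \<and> j < b + r \<longrightarrow> \<omega> (int j) x = 0) \<and>
    (\<forall>n. n + m \<le> L \<longrightarrow> (\<exists>j. n \<le> j \<and> j < n + m \<and> \<epsilon> \<le> \<omega> (int j) x))"
    using upper lower
  proof eventually_elim
    case (elim x)
    from elim comparable show ?case
    proof eventually_elim
      case (elim L)
      from elim(2) obtain n where "n + nat \<lfloor>a * ln (real L)\<rfloor> \<le> L"
        "\<forall>j. n \<le> j \<and> j < n + nat \<lfloor>a * ln (real L)\<rfloor> \<longrightarrow> \<omega> (int j) x = 0" by auto
      moreover have "\<forall>n. n + nat \<lceil>b * ln (real L)\<rceil> \<le> L \<longrightarrow>
           (\<exists>j. n \<le> j \<and> j < n + nat \<lceil>b * ln (real L)\<rceil> \<and> \<epsilon> \<le> \<omega> (int j) x)"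
        using elim(1) by (simp only: lessThan_iff not_less)
      ultimately show ?case using elim(3) by blast
    qed
  qed
  with \<epsilon> show ?thesis by blast
qed

lemma AE_longest_zero_interval_at_top:
  fixes \<omega> :: "int \<Rightarrow> 'a \<Rightarrow> real"
  assumes indep: "indep_vars (\<lambda>_. borel) \<omega> UNIV"
    and ident: "\<And>j. distr M borel (\<omega> j) = distr M borel (\<omega> 0)"
    and p: "0 < prob {x \<in> space M. \<omega> 0 x = 0}" "prob {x \<in> space M. \<omega> 0 x = 0} < 1"
  shows "AE x in M. filterlim (\<lambda>L. longest_zero_interval (real L) (\<lambda>j. \<omega> j x)) at_top sequentially"
proof -
  define l where "l = - ln (prob {x \<in> space M. \<omega> 0 x = 0})"
  have l: "0 < l" using p by (simp add: l_def)
  define a where "a = 1 / (2 * l)"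
  have a: "0 < a" "- 1 < - (a * l)" using l by (auto simp: a_def)
  have "AE x in M. \<forall>\<^sub>F L in sequentially. \<exists>n. n + nat \<lfloor>a * ln (real L)\<rfloor> \<le> L \<and>
           (\<forall>j. n \<le> j \<and> j < n + nat \<lfloor>a * ln (real L)\<rfloor> \<longrightarrow> \<omega> (int j) x \<in> {0})"
    by (rule AE_eventually_long_run[OF indep ident _ _ a(1)]) (use p a in \<open>auto simp: l_def\<close>)
  then show ?thesis
  proof eventually_elim
    case (elim x)
    have "filterlim (\<lambda>L. a * ln (real L) - 1) at_top sequentially" using a(1) by real_asymp
    moreover from elim have "\<forall>\<^sub>F L in sequentially. a * ln (real L) - 1 \<le> longest_zero_interval (real L) (\<lambda>j. \<omega> j x)"
    proof eventually_elim
      case (elim L)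
      then obtain n where n: "n + nat \<lfloor>a * ln (real L)\<rfloor> \<le> L"
        "\<And>j. n \<le> j \<Longrightarrow> j < n + nat \<lfloor>a * ln (real L)\<rfloor> \<Longrightarrow> \<omega> (int j) x = 0" by auto
      obtain b R :: nat where R: "longest_zero_interval (real L) (\<lambda>j. \<omega> j x) = real R"
        "longest_zero_run (\<lambda>j. \<omega> j x) L b R"
        using longest_zero_interval_eq_run by metis
      have "nat \<lfloor>a * ln (real L)\<rfloor> \<le> R" using R(2) n unfolding longest_zero_run_def by blast
      then have "real (nat \<lfloor>a * ln (real L)\<rfloor>) \<le> real R" by (simp only: of_nat_le_iff)
      moreover have "a * ln (real L) - 1 \<le> real (nat \<lfloor>a * ln (real L)\<rfloor>)" by linarith
      ultimately show ?case using R(1) by linarith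
    qed
    ultimately show ?case by (rule filterlim_at_top_mono)
  qed
qed

text \<open>
  The value of \<open>\<epsilon>\<close> depends on \<open>\<delta>\<close>, and so does the exceptional null set; it suffices to take
  \<open>\<delta> = 1/(i+1)\<close> and the union of countably many null sets.
\<close>

lemma AE_ratio_tendsto:
  fixes \<omega> :: "int \<Rightarrow> 'a \<Rightarrow> real" and k :: "nat \<Rightarrow> real"
  assumes indep: "indep_vars (\<lambda>_. borel) \<omega> UNIV"
    and ident: "\<And>j. distr M borel (\<omega> j) = distr M borel (\<omega> 0)"
    and nonneg: "\<And>j. AE x in M. 0 \<le> \<omega> j x"
    and p: "0 < prob {x \<in> space M. \<omega> 0 x = 0}" "prob {x \<in> space M. \<omega> 0 x = 0} < 1"
    and k: "\<And>L. 1 \<le> L \<Longrightarrow> 0 < k L"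
    and strong: "AE x in M. filterlim (\<lambda>L. k L * longest_zero_interval (real L) (\<lambda>j. \<omega> j x)) at_top sequentially"
  shows "AE x in M. (\<lambda>L. eigenvalue_landscape_ratio (real L) (k L) (\<lambda>j. \<omega> j x)) \<longlonglongrightarrow> pi\<^sup>2 / 8"
proof -
  let ?good = "\<lambda>\<delta> \<epsilon> x L. \<exists>m b r. real m + 1 \<le> (1 + \<delta>) * real r \<and>
    b + r \<le> L \<and> (\<forall>j. b \<le> j \<and> j < b + r \<longrightarrow> \<omega> (int j) x = 0) \<and>
    (\<forall>n. n + m \<le> L \<longrightarrow> (\<exists>j. n \<le> j \<and> j < n + m \<and> \<epsilon> \<le> \<omega> (int j) x))"
  have "\<forall>i::nat. \<exists>\<epsilon>>0. AE x in M. \<forall>\<^sub>F L in sequentially. ?good (1 / real (Suc i)) \<epsilon> x L"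
    by (intro allI AE_barriers_comparable_to_zero_run indep ident nonneg p) simp
  from choice[OF this] obtain \<epsilon> where *: "\<forall>i. 0 < \<epsilon> i \<and> (AE x in M. \<forall>\<^sub>F L in sequentially. ?good (1 / real (Suc i)) (\<epsilon> i) x L)" ..
  have \<epsilon>: "0 < \<epsilon> i"
    and AE1: "AE x in M. \<forall>\<^sub>F L in sequentially. ?good (1 / real (Suc i)) (\<epsilon> i) x L" for i
    using spec[OF *, of i] by (rule conjunct1, rule conjunct2)
  have "AE x in M. \<forall>i. \<forall>\<^sub>F L in sequentially. ?good (1 / real (Suc i)) (\<epsilon> i) x L"
    unfolding AE_all_countable using AE1 by blast
  moreover have "AE x in M. \<forall>j. 0 \<le> \<omega> j x"
    unfolding AE_all_countable using nonneg by blast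
  ultimately show ?thesis using strong
  proof eventually_elim
    case (elim x)
    let ?w = "\<lambda>j. \<omega> j x"
    obtain a R :: "nat \<Rightarrow> nat" where *: "\<And>L. longest_zero_run ?w L (a L) (R L)"
      and R: "\<And>L. longest_zero_interval (real L) ?w = real (R L)"
      using longest_zero_interval_eq_run by metis
    have run: "a L + R L \<le> L" "\<And>j. a L \<le> j \<Longrightarrow> j < a L + R L \<Longrightarrow> ?w (int j) = 0"
      and longest: "\<And>b r. b + r \<le> L \<Longrightarrow> \<forall>j. b \<le> j \<and> j < b + r \<longrightarrow> ?w (int j) = 0 \<Longrightarrow> r \<le> R L" for L
      using *[of L] unfolding longest_zero_run_def by blast+
    show ?case
    proof (rule ratio_tendsto_of_barriers[where a = a and R = R])
      show "filterlim (\<lambda>L. k L * real (R L)) at_top sequentially" using elim(3) by (simp add: R)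
    next
      fix \<delta> :: real assume "0 < \<delta>"
      then obtain i where i: "1 / real (Suc i) < \<delta>" using nat_approx_posE by blast
      have "\<forall>\<^sub>F L in sequentially. ?good (1 / real (Suc i)) (\<epsilon> i) x L" using elim(1) by blast
      then have "\<forall>\<^sub>F L in sequentially. \<exists>m. real m + 1 \<le> (1 + \<delta>) * real (R L) \<and>
        (\<forall>n. n + m \<le> L \<longrightarrow> (\<exists>j. n \<le> j \<and> j < n + m \<and> \<epsilon> i \<le> ?w (int j)))"
      proof eventually_elim
        case (elim L)
        then obtain m b r where m: "real m + 1 \<le> (1 + 1 / real (Suc i)) * real r" "b + r \<le> L"
          "\<forall>j. b \<le> j \<and> j < b + r \<longrightarrow> ?w (int j) = 0"
          and bar: "\<forall>n. n + m \<le> L \<longrightarrow> (\<exists>j. n \<le> j \<and> j < n + m \<and> \<epsilon> i \<le> ?w (int j))" by blast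
        have "r \<le> R L" using longest[OF m(2,3)] .
        then have "(1 + 1 / real (Suc i)) * real r \<le> (1 + \<delta>) * real (R L)"
          using i \<open>0 < \<delta>\<close> by (intro mult_mono) auto
        with m(1) have "real m + 1 \<le> (1 + \<delta>) * real (R L)" by linarith
        with bar show ?case by blast
      qed
      with \<epsilon>[of i] show "\<exists>\<epsilon>>0. \<forall>\<^sub>F L in sequentially. \<exists>m. real m + 1 \<le> (1 + \<delta>) * real (R L) \<and>
        (\<forall>n. n + m \<le> L \<longrightarrow> (\<exists>j. n \<le> j \<and> j < n + m \<and> \<epsilon> \<le> ?w (int j)))" by blast
    qed (use elim(2) k run in auto)
  qed
qed

end

theorem theorem1:
  fixes M :: "'a measure" and \<omega> :: "int \<Rightarrow> 'a \<Rightarrow> real"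
  assumes "prob_space M"
    and "prob_space.indep_vars M (\<lambda>_. borel) \<omega> UNIV"
    and "\<And>j. distr M borel (\<omega> j) = distr M borel (\<omega> 0)"
    and "\<And>j. AE x in M. 0 \<le> \<omega> j x"
    and "0 < measure M {x \<in> space M. \<omega> 0 x = 0}"
    and "measure M {x \<in> space M. \<omega> 0 x = 0} < 1"
  shows
    "(\<forall>(k :: nat \<Rightarrow> real) (C :: real) (\<alpha> :: real).
        (\<forall>L\<ge>1. 0 < k L) \<and> 0 < C \<and> 0 < \<alpha> \<and>
        (AE x in M. \<forall>\<^sub>F L in sequentially.
           C < k L * longest_zero_interval (real L) (\<lambda>j. \<omega> j x) powr (1 - \<alpha>)) \<longrightarrow>
        (AE x in M.
           (\<lambda>L. eigenvalue_landscape_ratio (real L) (k L) (\<lambda>j. \<omega> j x)) \<longlonglongrightarrow> pi\<^sup>2 / 8)) \<and>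
     (\<forall>k::real. 0 < k \<longrightarrow>
        (AE x in M.
           (\<lambda>L. eigenvalue_landscape_ratio (real L) k (\<lambda>j. \<omega> j x)) \<longlonglongrightarrow> pi\<^sup>2 / 8))"
proof -
  interpret prob_space M by fact
  note unbounded = AE_longest_zero_interval_at_top[OF assms(2,3,5,6)]
  note limit = AE_ratio_tendsto[OF assms(2,3,4,5,6)]
  show ?thesis
  proof (intro conjI allI impI)
    fix k :: "nat \<Rightarrow> real" and C \<alpha> :: real
    assume *: "(\<forall>L\<ge>1. 0 < k L) \<and> 0 < C \<and> 0 < \<alpha> \<and>
        (AE x in M. \<forall>\<^sub>F L in sequentially.
           C < k L * longest_zero_interval (real L) (\<lambda>j. \<omega> j x) powr (1 - \<alpha>))"
    then have "AE x in M. \<forall>\<^sub>F L in sequentially.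
           C < k L * longest_zero_interval (real L) (\<lambda>j. \<omega> j x) powr (1 - \<alpha>)" by blast
    with unbounded have strong: "AE x in M. filterlim (\<lambda>L. k L * longest_zero_interval (real L) (\<lambda>j. \<omega> j x)) at_top sequentially"
    proof eventually_elim
      case (elim x)
      let ?l = "\<lambda>L. longest_zero_interval (real L) (\<lambda>j. \<omega> j x)"
      have "filterlim (\<lambda>t::real. C * t powr \<alpha>) at_top at_top" using * by real_asymp
      then have "filterlim (\<lambda>L. C * ?l L powr \<alpha>) at_top sequentially"
        by (rule filterlim_compose) (rule elim(1))
      moreover have "\<forall>\<^sub>F L in sequentially. 0 < ?l L" using elim(1) by (simp add: filterlim_at_top_dense)
      with elim(2) have "\<forall>\<^sub>F L in sequentially. C * ?l L powr \<alpha> \<le> k L * ?l L"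
      proof eventually_elim
        case (elim L)
        \<comment> \<open>the strength \<open>k L * ?l L\<close> of the barriers inherits a positive power of the length\<close>
        have "C * ?l L powr \<alpha> \<le> k L * ?l L powr (1 - \<alpha>) * ?l L powr \<alpha>"
          using elim by (intro mult_right_mono) auto
        also have "\<dots> = k L * ?l L" using elim(2) by (simp add: mult.assoc flip: powr_add)
        finally show ?case .
      qed
      ultimately show ?case by (rule filterlim_at_top_mono)
    qed
    show "AE x in M. (\<lambda>L. eigenvalue_landscape_ratio (real L) (k L) (\<lambda>j. \<omega> j x)) \<longlonglongrightarrow> pi\<^sup>2 / 8"
      by (rule limit[OF _ strong]) (use * in auto)
  next
    fix k :: real assume k: "0 < k"
    from unbounded have "AE x in M. filterlim (\<lambda>L. k * longest_zero_interval (real L) (\<lambda>j. \<omega> j x)) at_top sequentially"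
      by eventually_elim (rule filterlim_tendsto_pos_mult_at_top[OF tendsto_const k])
    then show "AE x in M. (\<lambda>L. eigenvalue_landscape_ratio (real L) k (\<lambda>j. \<omega> j x)) \<longlonglongrightarrow> pi\<^sup>2 / 8"
      by (intro limit k)
  qed
qed

end
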